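(* Let $M$ be a simply connected, compact subset of a compact, closed 2-dimensional smooth manifold $\mathbf{M}$, with $\partial M$ piecewise smooth and all of whose angles are strictly positive, and let $g$ be the metric on $M$. Let $f$ be a Morse eigenfunction of $-\Delta_g$ on $M$ with the extension property and obeying Dirichlet boundary conditions. Let $\mu^{\mathrm{in}}$ and $\mu^{\mathrm{bd}}$ be the numbers of inner and boundary Neumann domains of $f$, $\mu=\mu^{\mathrm{in}}+\mu^{\mathrm{bd}}$, and let $\nu$ be the number of nodal domains of $f$. Then $2\mu^{\mathrm{in}}+\mu^{\mathrm{bd}}\geq\nu$ and $2\mu\geq\nu$.
   Context: $\mathbf M$ carries a smooth Riemannian metric restricting to $g$; $\overline{M}$ is the closure of $M$ (equal to $M$). Nodal domains are the connected components of $M\setminus f^{-1}(0)$. A Morse eigenfunction is a real solution of $-\Delta_g f=\lambda f$ that is a Morse function on $\overline{M}$ (no degenerate critical points); Dirichlet condition: $f=0$ on $\partial M$. $f$ has the extension property if there are an open $\widehat M$ with $\overline M\subset\widehat M\subset\mathbf M$ and a Morse function $\widehat f:\widehat M\to\mathbb R$ with $\widehat f|_{\overline M}=f$; then $f$ also extends to a Morse function $\tilde f:\mathbf M\to\mathbb R$. $\mathscr C(f)$ and $\mathscr S(f)$ are the sets of critical points and saddle points of $f$ in $\overline M$, including those on $\partial M$; $\mathscr M_-(f)$, $\mathscr M_+(f)$ are the sets of (local) minima and maxima of $f$ (none lies on $\partial M$). Flow: let $\tilde\varphi$ be the flow on $\mathbf M$ of $-\nabla\tilde f$. Define $\varphi:\mathbb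 R\times\overline M\to\overline M$ as follows: for $t\ge 0$, $\varphi(t,x)=\tilde\varphi(t,x)$ if $\tilde\varphi([0,t],x)\subset\overline M$, and otherwise $\varphi(t,x)=\tilde\varphi(t_0,x)$ with $t_0\in[0,t]$ minimal such that $\tilde\varphi(t_0,x)\in\partial M$; for $t<0$, $\varphi(t,x)=\tilde\varphi(t,x)$ if $\tilde\varphi([t,0],x)\subset\overline M$, and otherwise $\varphi(t,x)=\tilde\varphi(t_0,x)$ with $t_0\in[t,0]$ maximal such that $\tilde\varphi(t_0,x)\in\partial M$. (The flow does not depend on the choice of $\tilde f$.) For $x\in\mathscr C(f)\cup\partial M$ put $W^s(x)=\{y\in\overline M:\lim_{t\to\infty}\varphi(t,y)=x\}$, $W^u(x)=\{y\in\overline M:\lim_{t\to-\infty}\varphi(t,y)=x\}$. Inner Neumann domains are the connected components of the sets $W^s(p)\cap W^u(q)$, $p\in\mathscr M_-(f)$, $q\in\mathscr M_+(f)$. Boundary Neumann domains are the connected components of the sets $W^s(p)\cap\big(\bigcup_{y\in\partial M\setminus\mathscr S(f)}W^u(y)\big)$, $p\in\mathscr M_-(f)$, and of the sets $\big(\bigcup_{y\in\partial M\setminus\mathscr S(f)}W^s(y)\big)\cap W^u(q)$, $q\in\mathscr M_+(f)$. *)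

theory Defs
  imports "HOL-Analysis.Analysis" "HOL-Library.Extended_Nat"
begin

section \<open>Smooth functions and smooth surfaces\<close>

text \<open>Continuous differentiability of order \<open>k\<close> on an open set \<open>S\<close>.\<close>

primrec Ck_on :: "nat \<Rightarrow> 'a::euclidean_space set \<Rightarrow> ('a \<Rightarrow> 'b::real_normed_vector) \<Rightarrow> bool"
  where
    "Ck_on 0 S h \<longleftrightarrow> continuous_on S h"
  | "Ck_on (Suc k) S h \<longleftrightarrow> (\<forall>x\<in>S. h differentiable (at x)) \<and>
       (\<forall>v. Ck_on k S (\<lambda>x. frechet_derivative h (at x) v))"

definition smooth_on :: "'a::euclidean_space set \<Rightarrow> ('a \<Rightarrow> 'b::real_normed_vector) \<Rightarrow> bool"
  where "smooth_on S h \<longleftrightarrow> (\<forall>k. Ck_on k S h)"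

text \<open>A chart is a pair of its domain and its coordinate map; only the values of the
  coordinate map on the domain matter. The manifold is the whole type \<open>'m\<close>.\<close>

type_synonym 'm chart = "'m set \<times> ('m \<Rightarrow> real^2)"

definition in_chart :: "'m chart \<Rightarrow> ('m \<Rightarrow> 'b) \<Rightarrow> real^2 \<Rightarrow> 'b"
  where "in_chart c h = h \<circ> inv_into (fst c) (snd c)"

definition smooth_atlas :: "('m::topological_space) chart set \<Rightarrow> bool"
  where "smooth_atlas A \<longleftrightarrow>
    (\<forall>c\<in>A. open (fst c) \<and> open (snd c ` fst c) \<and>
       (\<exists>k. homeomorphism (fst c) (snd c ` fst c) (snd c) k)) \<and>
    (\<Union>c\<in>A. fst c) = UNIV \<and>
    (\<forall>c\<in>A. \<forall>d\<in>A. smooth_on (snd c ` (fst c \<inter> fst d)) (in_chart c (snd d)))"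

definition smooth_fun_on ::
    "('m::topological_space) chart set \<Rightarrow> 'm set \<Rightarrow> ('m \<Rightarrow> real) \<Rightarrow> bool"
  where "smooth_fun_on A W F \<longleftrightarrow> (\<forall>c\<in>A. smooth_on (snd c ` (fst c \<inter> W)) (in_chart c F))"

definition partial_deriv :: "2 \<Rightarrow> (real^2 \<Rightarrow> real) \<Rightarrow> real^2 \<Rightarrow> real"
  where "partial_deriv i h u = frechet_derivative h (at u) (axis i 1)"


section \<open>Riemannian metrics, gradient and Laplacian\<close>

text \<open>A metric is given by its component matrices: \<open>g c x $ i $ j\<close> is
  \<open>g\<^sub>x(\<partial>\<^sub>i, \<partial>\<^sub>j)\<close> for the coordinate fields of the chart \<open>c\<close>, and the last condition
  is the transformation law of a covariant 2-tensor.\<close>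

type_synonym 'm metric = "'m chart \<Rightarrow> 'm \<Rightarrow> real^2^2"

definition riemannian_metric :: "('m::topological_space) chart set \<Rightarrow> 'm metric \<Rightarrow> bool"
  where "riemannian_metric A g \<longleftrightarrow>
    (\<forall>c\<in>A. (\<forall>i j. smooth_on (snd c ` fst c) (\<lambda>u. in_chart c (g c) u $ i $ j)) \<and>
       (\<forall>x\<in>fst c. transpose (g c x) = g c x \<and> (\<forall>v. v \<noteq> 0 \<longrightarrow> v \<bullet> (g c x *v v) > 0))) \<and>
    (\<forall>c\<in>A. \<forall>d\<in>A. \<forall>x\<in>fst c \<inter> fst d.
       (let J = jacobian (in_chart c (snd d)) (at (snd c x))
        in g c x = transpose J ** g d x ** J))"

text \<open>The coordinate vector of \<open>\<nabla>F\<close> at \<open>x\<close> in the chart \<open>c\<close>.\<close>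

definition gradient :: "'m metric \<Rightarrow> 'm chart \<Rightarrow> ('m \<Rightarrow> real) \<Rightarrow> 'm \<Rightarrow> real^2"
  where "gradient g c F x =
    matrix_inv (g c x) *v (\<chi> i. partial_deriv i (in_chart c F) (snd c x))"

text \<open>The Laplace--Beltrami operator in coordinates,
  \<open>\<Delta>F = |g|\<^sup>-\<^sup>1\<^sup>/\<^sup>2 \<Sum>\<^sub>i \<partial>\<^sub>i (|g|\<^sup>1\<^sup>/\<^sup>2 \<Sum>\<^sub>j g\<^sup>i\<^sup>j \<partial>\<^sub>j F)\<close> with \<open>|g| = det g\<close>.\<close>

definition laplacian :: "'m metric \<Rightarrow> 'm chart \<Rightarrow> ('m \<Rightarrow> real) \<Rightarrow> 'm \<Rightarrow> real"
  where "laplacian g c F x =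
    (let G = in_chart c (g c); vol = (\<lambda>u. sqrt (det (G u)))
     in (\<Sum>i\<in>UNIV. partial_deriv i
           (\<lambda>u. vol u * (\<Sum>j\<in>UNIV. matrix_inv (G u) $ i $ j * partial_deriv j (in_chart c F) u))
           (snd c x)) / vol (snd c x))"


section \<open>Morse functions\<close>

definition critical_point :: "'m chart set \<Rightarrow> ('m \<Rightarrow> real) \<Rightarrow> 'm \<Rightarrow> bool"
  where "critical_point A F x \<longleftrightarrow>
    (\<forall>c\<in>A. x \<in> fst c \<longrightarrow> (\<forall>i. partial_deriv i (in_chart c F) (snd c x) = 0))"

definition hessian :: "'m chart \<Rightarrow> ('m \<Rightarrow> real) \<Rightarrow> 'm \<Rightarrow> real^2^2"
  where "hessian c F x =
    (\<chi> i j. partial_deriv i (partial_deriv j (in_chart c F)) (snd c x))"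

definition nondegenerate :: "'m chart set \<Rightarrow> ('m \<Rightarrow> real) \<Rightarrow> 'm \<Rightarrow> bool"
  where "nondegenerate A F x \<longleftrightarrow> (\<forall>c\<in>A. x \<in> fst c \<longrightarrow> det (hessian c F x) \<noteq> 0)"

text \<open>Morse functions on an open set \<open>W\<close>.\<close>

definition morse_on :: "('m::topological_space) chart set \<Rightarrow> 'm set \<Rightarrow> ('m \<Rightarrow> real) \<Rightarrow> bool"
  where "morse_on A W F \<longleftrightarrow> smooth_fun_on A W F \<and>
    (\<forall>x\<in>W. critical_point A F x \<longrightarrow> nondegenerate A F x)"

text \<open>Morse functions on a closed domain \<open>M\<close>: \<open>f\<close> is smooth up to the boundary, and the
  critical points on the boundary are nondegenerate too. When \<open>M\<close> is the closure of its
  interior, the derivatives of \<open>F\<close> on \<open>M\<close> do not depend on the extension \<open>F\<close>.\<close>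

definition morse_on_closed ::
    "('m::topological_space) chart set \<Rightarrow> 'm set \<Rightarrow> ('m \<Rightarrow> real) \<Rightarrow> bool"
  where "morse_on_closed A M f \<longleftrightarrow>
    (\<exists>W F. open W \<and> M \<subseteq> W \<and> smooth_fun_on A W F \<and> (\<forall>x\<in>M. F x = f x) \<and>
       (\<forall>x\<in>M. critical_point A F x \<longrightarrow> nondegenerate A F x))"

definition morse_eigenfunction ::
    "('m::topological_space) chart set \<Rightarrow> 'm metric \<Rightarrow> 'm set \<Rightarrow> real \<Rightarrow> ('m \<Rightarrow> real) \<Rightarrow> bool"
  where "morse_eigenfunction A g M ev f \<longleftrightarrow> morse_on_closed A M f \<and>
    (\<forall>x\<in>interior M. \<forall>c\<in>A. x \<in> fst c \<longrightarrow> - laplacian g c f x = ev * f x)"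

definition dirichlet :: "('m::topological_space) set \<Rightarrow> ('m \<Rightarrow> real) \<Rightarrow> bool"
  where "dirichlet M f \<longleftrightarrow> (\<forall>x\<in>frontier M. f x = 0)"

definition extension_property ::
    "('m::topological_space) chart set \<Rightarrow> 'm set \<Rightarrow> ('m \<Rightarrow> real) \<Rightarrow> bool"
  where "extension_property A M f \<longleftrightarrow>
    (\<exists>W F. open W \<and> M \<subseteq> W \<and> morse_on A W F \<and> (\<forall>x\<in>M. F x = f x))"

text \<open>A choice of a Morse function on the whole manifold that extends \<open>f\<close>; it exists when
  \<open>f\<close> has the extension property, and nothing below depends on the choice.\<close>

definition morse_extension ::
    "('m::topological_space) chart set \<Rightarrow> 'm set \<Rightarrow> ('m \<Rightarrow> real) \<Rightarrow> 'm \<Rightarrow> real"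
  where "morse_extension A M f = (SOME F. morse_on A UNIV F \<and> (\<forall>x\<in>M. F x = f x))"

definition crit_pts ::
    "('m::topological_space) chart set \<Rightarrow> 'm set \<Rightarrow> ('m \<Rightarrow> real) \<Rightarrow> 'm set"
  where "crit_pts A M f = {x \<in> M. critical_point A (morse_extension A M f) x}"

text \<open>Extrema are those of the extension. In the interior of \<open>M\<close> this is the same as for
  \<open>f\<close>. A boundary point at which the Dirichlet function \<open>f\<close> is extremal only because the
  other side of the boundary is ignored does not count: with Dirichlet conditions no extremum
  lies on the boundary.\<close>

definition minima ::
    "('m::topological_space) chart set \<Rightarrow> 'm set \<Rightarrow> ('m \<Rightarrow> real) \<Rightarrow> 'm set"
  where "minima A M f = {x \<in> crit_pts A M f.
    \<forall>\<^sub>F y in nhds x. morse_extension A M f x \<le> morse_extension A M f y}"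

definition maxima ::
    "('m::topological_space) chart set \<Rightarrow> 'm set \<Rightarrow> ('m \<Rightarrow> real) \<Rightarrow> 'm set"
  where "maxima A M f = {x \<in> crit_pts A M f.
    \<forall>\<^sub>F y in nhds x. morse_extension A M f y \<le> morse_extension A M f x}"

definition saddles ::
    "('m::topological_space) chart set \<Rightarrow> 'm set \<Rightarrow> ('m \<Rightarrow> real) \<Rightarrow> 'm set"
  where "saddles A M f = crit_pts A M f - (minima A M f \<union> maxima A M f)"


section \<open>Piecewise smooth boundaries\<close>

text \<open>Near its starting point, a regular smooth arc in the plane starting at the origin is a
  graph \<open>\<theta> = a(r)\<close> in polar coordinates, with \<open>a\<close> smooth up to \<open>r = 0\<close> and \<open>a(0)\<close> the
  direction of its tangent. The following is the region between two such arcs.\<close>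

definition curvilinear_sector :: "real \<Rightarrow> (real \<Rightarrow> real) \<Rightarrow> (real \<Rightarrow> real) \<Rightarrow> (real^2) set"
  where "curvilinear_sector e a b =
    {vector [r * cos t, r * sin t] | r t. 0 \<le> r \<and> r < e \<and> a r \<le> t \<and> t \<le> b r}"

text \<open>Near the boundary point \<open>p\<close>, \<open>M\<close> is the region between two regular smooth arcs that
  issue from \<open>p\<close> and form the interior angle \<open>\<theta>\<close>. The condition on \<open>L\<close> makes the differential
  of \<open>\<psi>\<close> at \<open>p\<close> an isometry, so that \<open>\<theta>\<close> is the angle in the metric \<open>g\<close>. At a
  smooth boundary point \<open>\<theta> = \<pi>\<close>; \<open>\<theta> = 0\<close> and \<open>\<theta> = 2\<pi>\<close> are outward and inward cusps.\<close>

definition boundary_angle ::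
    "('m::topological_space) chart set \<Rightarrow> 'm metric \<Rightarrow> 'm set \<Rightarrow> 'm \<Rightarrow> real \<Rightarrow> bool"
  where "boundary_angle A g M p \<theta> \<longleftrightarrow>
    (\<exists>c\<in>A. p \<in> fst c \<and> (\<exists>L e a b.
       let \<psi> = (\<lambda>x. L *v (snd c x - snd c p)) in
       transpose L ** L = g c p \<and> 0 < e \<and>
       smooth_on {-e<..<e} a \<and> smooth_on {-e<..<e} b \<and>
       (\<forall>r\<in>{0<..<e}. a r < b r \<and> b r < a r + 2 * pi) \<and>
       ball 0 e \<subseteq> \<psi> ` fst c \<and>
       \<psi> ` (M \<inter> fst c) \<inter> ball 0 e = curvilinear_sector e a b \<and>
       \<theta> = b 0 - a 0))"

definition piecewise_smooth_boundary ::
    "('m::topological_space) chart set \<Rightarrow> 'm metric \<Rightarrow> 'm set \<Rightarrow> bool"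
  where "piecewise_smooth_boundary A g M \<longleftrightarrow>
    (\<forall>p\<in>frontier M. \<exists>\<theta>. boundary_angle A g M p \<theta>)"

definition boundary_angles_positive ::
    "('m::topological_space) chart set \<Rightarrow> 'm metric \<Rightarrow> 'm set \<Rightarrow> bool"
  where "boundary_angles_positive A g M \<longleftrightarrow>
    (\<forall>p\<in>frontier M. \<forall>\<theta>. boundary_angle A g M p \<theta> \<longrightarrow> \<theta> > 0)"


section \<open>The gradient flow\<close>

definition descent_curve ::
    "('m::topological_space) chart set \<Rightarrow> 'm metric \<Rightarrow> ('m \<Rightarrow> real) \<Rightarrow> (real \<Rightarrow> 'm) \<Rightarrow> bool"
  where "descent_curve A g F \<gamma> \<longleftrightarrow> continuous_on UNIV \<gamma> \<and>
    (\<forall>t. \<forall>c\<in>A. \<gamma> t \<in> fst c \<longrightarrow>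
       ((snd c \<circ> \<gamma>) has_vector_derivative - gradient g c F (\<gamma> t)) (at t))"

definition full_flow ::
    "('m::topological_space) chart set \<Rightarrow> 'm metric \<Rightarrow> ('m \<Rightarrow> real) \<Rightarrow> real \<Rightarrow> 'm \<Rightarrow> 'm"
  where "full_flow A g F t x = (THE \<gamma>. descent_curve A g F \<gamma> \<and> \<gamma> 0 = x) t"

definition flow ::
    "('m::topological_space) chart set \<Rightarrow> 'm metric \<Rightarrow> 'm set \<Rightarrow> ('m \<Rightarrow> real) \<Rightarrow> real \<Rightarrow> 'm \<Rightarrow> 'm"
  where "flow A g M f t x =
    (let \<Phi> = full_flow A g (morse_extension A M f) in
     if 0 \<le> t then
       (if (\<forall>s\<in>{0..t}. \<Phi> s x \<in> M) then \<Phi> t x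
        else \<Phi> (LEAST s. s \<in> {0..t} \<and> \<Phi> s x \<in> frontier M) x)
     else
       (if (\<forall>s\<in>{t..0}. \<Phi> s x \<in> M) then \<Phi> t x
        else \<Phi> (GREATEST s. s \<in> {t..0} \<and> \<Phi> s x \<in> frontier M) x))"

definition stable_set ::
    "('m::topological_space) chart set \<Rightarrow> 'm metric \<Rightarrow> 'm set \<Rightarrow> ('m \<Rightarrow> real) \<Rightarrow> 'm \<Rightarrow> 'm set"
  where "stable_set A g M f x = {y \<in> M. ((\<lambda>t. flow A g M f t y) \<longlongrightarrow> x) at_top}"

definition unstable_set ::
    "('m::topological_space) chart set \<Rightarrow> 'm metric \<Rightarrow> 'm set \<Rightarrow> ('m \<Rightarrow> real) \<Rightarrow> 'm \<Rightarrow> 'm set"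
  where "unstable_set A g M f x = {y \<in> M. ((\<lambda>t. flow A g M f t y) \<longlongrightarrow> x) at_bot}"


section \<open>Nodal and Neumann domains\<close>

definition nodal_domains :: "('m::topological_space) set \<Rightarrow> ('m \<Rightarrow> real) \<Rightarrow> 'm set set"
  where "nodal_domains M f = components (M - f -` {0})"

definition inner_neumann_domains ::
    "('m::topological_space) chart set \<Rightarrow> 'm metric \<Rightarrow> 'm set \<Rightarrow> ('m \<Rightarrow> real) \<Rightarrow> 'm set set"
  where "inner_neumann_domains A g M f =
    (\<Union>p\<in>minima A M f. \<Union>q\<in>maxima A M f.
       components (stable_set A g M f p \<inter> unstable_set A g M f q))"

definition boundary_neumann_domains ::
    "('m::topological_space) chart set \<Rightarrow> 'm metric \<Rightarrow> 'm set \<Rightarrow> ('m \<Rightarrow> real) \<Rightarrow> 'm set set"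
  where "boundary_neumann_domains A g M f =
    (\<Union>p\<in>minima A M f. components (stable_set A g M f p \<inter>
       (\<Union>y\<in>frontier M - saddles A M f. unstable_set A g M f y))) \<union>
    (\<Union>q\<in>maxima A M f. components
       ((\<Union>y\<in>frontier M - saddles A M f. stable_set A g M f y) \<inter> unstable_set A g M f q))"

text \<open>Numbers of domains are counted in the extended naturals, since \<open>card\<close> of an infinite
  set is 0.\<close>

definition number_of :: "'a set \<Rightarrow> enat"
  where "number_of X = (if finite X then enat (card X) else \<infinity>)"

end

theory Submission
  imports Defs "HOL-Computational_Algebra.Polynomial"
begin

text \<open>
  A point where \<open>\<bar>f\<bar>\<close> is maximal on the closure of a nodal domain is an interior local extremum
  of \<open>f\<close> that lies in the domain, so it suffices to attach Neumann domains to interior extrema.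
  Let \<open>q\<close> be an interior local maximum. All descent curves through points near \<open>q\<close> tend to \<open>q\<close>
  backwards in time without leaving \<open>M\<close>. The points that descend to a critical point \<open>s\<close> other
  than a local minimum form a meagre set: with \<open>H\<close> the Hessian at \<open>s\<close>, the form \<open>d \<bullet> H d\<close> of the
  difference \<open>d\<close> of two solutions near \<open>s\<close> does not increase, so two solutions that tend to \<open>s\<close>
  cannot differ by a vector on which the form is negative. By Baire some curve from \<open>q\<close> descends
  to a local minimum of the extended function; either it stays in \<open>M\<close>, which gives an inner
  Neumann domain, or it stops at a noncritical boundary point, which gives a boundary Neumann
  domain. Minima are treated by replacing \<open>f\<close> with \<open>- f\<close>. An inner Neumann domain is attached to
  at most two interior extrema, a boundary Neumann domain to at most one.

  The extension of \<open>f\<close> to a Morse function on the whole surface comes from a cutoff followed by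
  small perturbations that are linear in a chart, with Sard's theorem for the gradient map.
\<close>

section \<open>Calculus of functions of class C^k\<close>

text \<open>The stable set of a saddle is a curve, but Baire only asks for a countable union of
  closed sets without interior that contains it, so no invariant manifolds are constructed. One
  quadratic form serves saddles and local maxima alike. Since it compares two solutions with each
  other, and not one solution with the critical point, its error term calls for strict
  differentiability of the field. Each curve tends to a single critical point because nondegenerate
  critical points are isolated: a connected curve cannot move between finitely many disjoint
  neighbourhoods. The stopped flow is built from \<open>SOME\<close>, \<open>THE\<close>,
  \<open>LEAST\<close> and \<open>GREATEST\<close>, and each of these means something only after an
  existence proof; hence the extension to the whole surface, the completeness of the flow and the
  closedness of the set of hitting times. Neumann domains are attached to interior extrema because
  the two ends of a boundary domain are told apart by lying in the interior or on the frontier. The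
  far end of a curve that stays in \<open>M\<close> may be any extremum of the extension in
  \<open>M\<close>.\<close>

lemma frechet_derivative_eqI:
  "(f has_derivative f') (at x) \<Longrightarrow> frechet_derivative f (at x) = f'"
  using frechet_derivative_at by metis

text \<open>Derivatives in \<open>Ck_on\<close> are taken with \<open>at x\<close>, not
  \<open>at x within S\<close>; openness of \<open>S\<close> makes them depend only on the values on
  \<open>S\<close>.\<close>

lemma Ck_on_cong:
  assumes "open S" "\<And>x. x \<in> S \<Longrightarrow> g x = h x"
  shows "Ck_on k S g \<longleftrightarrow> Ck_on k S h"
  using assms(2)
proof (induction k arbitrary: g h)
  case 0
  then show ?case by (simp cong: continuous_on_cong)
next
  case (Suc k)
  have der: "(g has_derivative D) (at x) \<longleftrightarrow> (h has_derivative D) (at x)" if "x \<in> S" for x D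
    using Suc.prems assms(1) that
    by (metis has_derivative_transform_within_open)
  have diff: "g differentiable (at x) \<longleftrightarrow> h differentiable (at x)" if "x \<in> S" for x
    using der[OF that] unfolding differentiable_def by simp
  have "frechet_derivative g (at x) = frechet_derivative h (at x)" if "x \<in> S" for x
    unfolding frechet_derivative_def using der[OF that] by simp
  then have "Ck_on k S (\<lambda>x. frechet_derivative g (at x) v) = Ck_on k S (\<lambda>x. frechet_derivative h (at x) v)" for v
    by (intro Suc.IH) simp
  with diff show ?case by simp
qed

lemma Ck_on_eqI:
  "open S \<Longrightarrow> Ck_on k S h \<Longrightarrow> (\<And>x. x \<in> S \<Longrightarrow> g x = h x) \<Longrightarrow> Ck_on k S g"
  using Ck_on_cong[of S g h k] by blast

lemma Ck_on_subset: "Ck_on k S h \<Longrightarrow> T \<subseteq> S \<Longrightarrow> Ck_on k T h"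
proof (induction k arbitrary: h)
  case 0
  then show ?case by (auto intro: continuous_on_subset)
next
  case (Suc k)
  then show ?case by (simp add: subset_iff)
qed

lemma Ck_on_Suc_continuous: "Ck_on (Suc k) S h \<Longrightarrow> continuous_on S h"
  by (auto intro!: continuous_at_imp_continuous_on differentiable_imp_continuous_within)

lemma Ck_on_imp_continuous: "Ck_on k S h \<Longrightarrow> continuous_on S h"
  by (cases k) (simp, blast intro: Ck_on_Suc_continuous)

lemma Ck_on_SucD: "Ck_on (Suc k) S h \<Longrightarrow> Ck_on k S h"
proof (induction k arbitrary: h)
  case 0
  then show ?case using Ck_on_Suc_continuous by (metis Ck_on.simps(1))
next
  case (Suc k)
  then show ?case by (metis Ck_on.simps(2))
qed

lemma Ck_on_has_derivative:
  "Ck_on (Suc k) S h \<Longrightarrow> x \<in> S \<Longrightarrow> (h has_derivative frechet_derivative h (at x)) (at x)"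
  using frechet_derivative_works by auto

lemma Ck_on_derivative: "Ck_on (Suc k) S h \<Longrightarrow> Ck_on k S (\<lambda>x. frechet_derivative h (at x) v)"
  by simp

lemma Ck_on_SucI:
  assumes "open S" "\<And>x. x \<in> S \<Longrightarrow> (h has_derivative h' x) (at x)"
    and "\<And>v. Ck_on k S (\<lambda>x. h' x v)"
  shows "Ck_on (Suc k) S h"
proof -
  have eq: "frechet_derivative h (at x) = h' x" if "x \<in> S" for x
    using frechet_derivative_eqI assms(2) that by blast
  have "Ck_on k S (\<lambda>x. frechet_derivative h (at x) v)" for v
    using Ck_on_cong[OF assms(1), of "\<lambda>x. frechet_derivative h (at x) v" "\<lambda>x. h' x v" k] eq assms(3) by simp
  then show ?thesis using assms(2) by (auto simp: differentiable_def)
qed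

lemma Ck_on_local:
  assumes "\<And>x. x \<in> S \<Longrightarrow> \<exists>U. open U \<and> x \<in> U \<and> Ck_on k U h"
  shows "Ck_on k S h"
  using assms
proof (induction k arbitrary: h)
  case 0
  then show ?case
    by (metis Ck_on.simps(1) continuous_at_imp_continuous_on continuous_on_eq_continuous_at)
next
  case (Suc k)
  have "Ck_on k S (\<lambda>x. frechet_derivative h (at x) v)" for v
    by (rule Suc.IH) (use Suc.prems in fastforce)
  then show ?case using Suc.prems by fastforce
qed

lemma Ck_on_const [simp]: "Ck_on k S (\<lambda>x. c)"
  by (induction k arbitrary: c) auto

lemma Ck_on_linear:
  assumes "open S" "bounded_linear L"
  shows "Ck_on k S L"
proof (cases k)
  case 0
  then show ?thesis using assms by (simp add: linear_continuous_on)
next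
  case (Suc j)
  show ?thesis unfolding Suc
    by (rule Ck_on_SucI[OF assms(1), where h'="\<lambda>x. L"])
       (auto intro: bounded_linear_imp_has_derivative assms)
qed

lemma Ck_on_compose_linear:
  assumes "open S" "bounded_linear L" "Ck_on k S h"
  shows "Ck_on k S (\<lambda>x. L (h x))"
  using assms(3)
proof (induction k arbitrary: h)
  case 0
  then show ?case using assms by (auto intro: bounded_linear.continuous_on)
next
  case (Suc k)
  show ?case
    by (rule Ck_on_SucI[OF assms(1), where h'="\<lambda>x v. L (frechet_derivative h (at x) v)"])
       (use Suc in \<open>auto intro!: bounded_linear.has_derivative[OF assms(2)] Ck_on_has_derivative
          simp del: Ck_on.simps(2) dest: Ck_on_derivative\<close>)
qed

lemma Ck_on_add:
  assumes "open S" "Ck_on k S g" "Ck_on k S h"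
  shows "Ck_on k S (\<lambda>x. g x + h x)"
  using assms(2,3)
proof (induction k arbitrary: g h)
  case 0
  then show ?case by (auto intro: continuous_intros)
next
  case (Suc k)
  show ?case
    by (rule Ck_on_SucI[OF assms(1), where h'="\<lambda>x v. frechet_derivative g (at x) v + frechet_derivative h (at x) v"])
       (use Suc in \<open>auto intro!: has_derivative_add Ck_on_has_derivative
          simp del: Ck_on.simps(2) dest: Ck_on_derivative\<close>)
qed

lemma Ck_on_sum:
  assumes "open S" "\<And>i. i \<in> I \<Longrightarrow> Ck_on k S (h i)"
  shows "Ck_on k S (\<lambda>x. \<Sum>i\<in>I. h i x)"
  using assms(2)
  by (induction I rule: infinite_finite_induct) (auto intro: Ck_on_add assms(1))

lemma Ck_on_scaleR:
  assumes "open S" "Ck_on k S g" "Ck_on k S h"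
  shows "Ck_on k S (\<lambda>x. g x *\<^sub>R h x)"
  using assms(2,3)
proof (induction k arbitrary: g h)
  case 0
  then show ?case by (auto intro: continuous_intros)
next
  case (Suc k)
  have "Ck_on k S (\<lambda>x. g x *\<^sub>R frechet_derivative h (at x) v + frechet_derivative g (at x) v *\<^sub>R h x)" for v
    by (intro Ck_on_add assms(1) Suc.IH Ck_on_derivative Suc.prems Ck_on_SucD)
  then show ?case
    by (intro Ck_on_SucI[OF assms(1), where h'="\<lambda>x v. g x *\<^sub>R frechet_derivative h (at x) v + frechet_derivative g (at x) v *\<^sub>R h x"])
       (auto intro!: has_derivative_scaleR Ck_on_has_derivative Suc.prems)
qed

lemma Ck_on_mult:
  fixes g h :: "'a::euclidean_space \<Rightarrow> real"
  shows "open S \<Longrightarrow> Ck_on k S g \<Longrightarrow> Ck_on k S h \<Longrightarrow> Ck_on k S (\<lambda>x. g x * h x)"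
  using Ck_on_scaleR[of S k g h] by simp

lemma Ck_on_compose:
  fixes g :: "'b::euclidean_space \<Rightarrow> 'c::real_normed_vector" and h :: "'a::euclidean_space \<Rightarrow> 'b"
  assumes "open S" "open T" "h ` S \<subseteq> T" "Ck_on k S h" "Ck_on k T g"
  shows "Ck_on k S (\<lambda>x. g (h x))"
  using assms(4,5)
proof (induction k arbitrary: g)
  case 0
  then show ?case using continuous_on_compose2[of T g S h] assms(3) by simp
next
  case (Suc k)
  let ?D = "\<lambda>x v. frechet_derivative g (at (h x)) (frechet_derivative h (at x) v)"
  have hT: "h x \<in> T" if "x \<in> S" for x
    using assms(3) that by blast
  have der: "((\<lambda>x. g (h x)) has_derivative ?D x) (at x)" if "x \<in> S" for x
    using has_derivative_compose[OF Ck_on_has_derivative[OF Suc.prems(1) that]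
        Ck_on_has_derivative[OF Suc.prems(2) hT[OF that]]] .
  \<comment> \<open>\<open>Ck_on\<close> controls derivatives in fixed directions only, whereas the
    inner direction \<open>frechet_derivative h (at x) v\<close> moves with \<open>x\<close>.
    Expanding it in the basis gives a sum of products, each with a factor covered by the induction
    hypothesis.\<close>
  have eq: "?D x v = (\<Sum>b\<in>Basis. (frechet_derivative h (at x) v \<bullet> b) *\<^sub>R frechet_derivative g (at (h x)) b)"
    if "x \<in> S" for x v
  proof -
    have lin: "linear (frechet_derivative g (at (h x)))"
      by (rule has_derivative_linear[OF Ck_on_has_derivative[OF Suc.prems(2) hT[OF that]]])
    have "?D x v = frechet_derivative g (at (h x)) (\<Sum>b\<in>Basis. (frechet_derivative h (at x) v \<bullet> b) *\<^sub>R b)"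
      by (simp only: euclidean_representation)
    also have "\<dots> = (\<Sum>b\<in>Basis. (frechet_derivative h (at x) v \<bullet> b) *\<^sub>R frechet_derivative g (at (h x)) b)"
      by (simp only: linear_sum[OF lin] linear_scale[OF lin])
    finally show ?thesis .
  qed
  have "Ck_on k S (\<lambda>x. (frechet_derivative h (at x) v \<bullet> b) *\<^sub>R frechet_derivative g (at (h x)) b)" for v b
  proof (rule Ck_on_scaleR[OF assms(1)])
    show "Ck_on k S (\<lambda>x. frechet_derivative h (at x) v \<bullet> b)"
      by (rule Ck_on_compose_linear[OF assms(1) bounded_linear_inner_left Ck_on_derivative[OF Suc.prems(1)]])
    show "Ck_on k S (\<lambda>x. frechet_derivative g (at (h x)) b)"
      by (rule Suc.IH[OF Ck_on_SucD[OF Suc.prems(1)] Ck_on_derivative[OF Suc.prems(2)]])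
  qed
  then have sum: "Ck_on k S (\<lambda>x. \<Sum>b\<in>Basis. (frechet_derivative h (at x) v \<bullet> b) *\<^sub>R frechet_derivative g (at (h x)) b)" for v
    by (rule Ck_on_sum[OF assms(1)])
  have "Ck_on k S (\<lambda>x. ?D x v)" for v
    using Ck_on_cong[OF assms(1) eq] sum by simp
  then show ?case by (intro Ck_on_SucI[OF assms(1) der])
qed

lemma Ck_on_inverse:
  fixes h :: "'a::euclidean_space \<Rightarrow> real"
  assumes "open S" "Ck_on k S h" "\<And>x. x \<in> S \<Longrightarrow> h x \<noteq> 0"
  shows "Ck_on k S (\<lambda>x. inverse (h x))"
  using assms(2)
proof (induction k)
  case 0
  then show ?case using assms(3) by (auto intro: continuous_intros)
next
  case (Suc k)
  have "Ck_on k S (\<lambda>x. (-1) *\<^sub>R (inverse (h x) * frechet_derivative h (at x) v * inverse (h x)))" for v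
    by (intro Ck_on_mult Ck_on_scaleR Ck_on_const assms(1) Suc.IH Ck_on_derivative Suc.prems Ck_on_SucD)
  then show ?case
    by (intro Ck_on_SucI[OF assms(1), where h'="\<lambda>x v. - (inverse (h x) * frechet_derivative h (at x) v * inverse (h x))"])
       (auto intro!: Deriv.has_derivative_inverse Ck_on_has_derivative Suc.prems assms(3))
qed

lemma Ck_on_minus:
  "open S \<Longrightarrow> Ck_on k S h \<Longrightarrow> Ck_on k S (\<lambda>x. - h x)"
  by (rule Ck_on_compose_linear) (auto intro: bounded_linear_minus bounded_linear_ident)

lemma Ck_on_diff:
  "open S \<Longrightarrow> Ck_on k S g \<Longrightarrow> Ck_on k S h \<Longrightarrow> Ck_on k S (\<lambda>x. g x - h x)"
  using Ck_on_add[of S k g "\<lambda>x. - h x"] Ck_on_minus[of S k h] by simp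

lemma Ck_on_vec:
  fixes h :: "'a::euclidean_space \<Rightarrow> real^'n"
  assumes "open S" "\<And>i. Ck_on k S (\<lambda>x. h x $ i)"
  shows "Ck_on k S h"
proof -
  have "Ck_on k S (\<lambda>x. \<Sum>i\<in>UNIV. h x $ i *\<^sub>R (axis i 1 :: real^'n))"
    by (intro Ck_on_sum Ck_on_scaleR assms Ck_on_const)
  moreover have "(\<lambda>x. \<Sum>i\<in>UNIV. h x $ i *\<^sub>R (axis i 1 :: real^'n)) = h"
    using basis_expansion[where 'n='n and 'a=real] by (simp add: scalar_mult_eq_scaleR)
  ultimately show ?thesis by simp
qed

lemma Ck_on_nth:
  fixes h :: "'a::euclidean_space \<Rightarrow> real^'n"
  shows "open S \<Longrightarrow> Ck_on k S h \<Longrightarrow> Ck_on k S (\<lambda>x. h x $ i)"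
  by (rule Ck_on_compose_linear) (auto intro: bounded_linear_vec_nth)

lemma smooth_onD: "smooth_on S h \<Longrightarrow> Ck_on k S h"
  by (simp add: smooth_on_def)

lemma smooth_on_has_derivative:
  "smooth_on S h \<Longrightarrow> x \<in> S \<Longrightarrow> (h has_derivative frechet_derivative h (at x)) (at x)"
  unfolding smooth_on_def by (metis Ck_on_has_derivative)

lemma smooth_on_imp_continuous: "smooth_on S h \<Longrightarrow> continuous_on S h"
  unfolding smooth_on_def by (metis Ck_on_imp_continuous)

text \<open>Schwarz: the second difference quotient along \<open>v\<close> and \<open>w\<close> is symmetric in \<open>v, w\<close>.\<close>

lemma second_difference_quotient:
  fixes h :: "'a::euclidean_space \<Rightarrow> real"
  assumes "open S" "x \<in> S" "Ck_on (Suc (Suc 0)) S h"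
  shows "((\<lambda>s. (h (x + s *\<^sub>R v + s *\<^sub>R w) - h (x + s *\<^sub>R v) - h (x + s *\<^sub>R w) + h x) / s^2) \<longlongrightarrow>
      frechet_derivative (\<lambda>y. frechet_derivative h (at y) v) (at x) w) (at_right 0)"
proof -
  define P where "P = (\<lambda>y. frechet_derivative h (at y) v)"
  define L where "L = (\<lambda>y. frechet_derivative P (at y) w)"
  have P: "Ck_on (Suc 0) S P" and "continuous_on S L"
    using assms(3) unfolding L_def P_def by auto
  then have L: "isCont L x"
    using assms by (simp add: continuous_on_eq_continuous_at)
  have "\<exists>d>0. \<forall>s. 0 < s \<and> s < d \<longrightarrow>
      \<bar>(h (x + s *\<^sub>R v + s *\<^sub>R w) - h (x + s *\<^sub>R v) - h (x + s *\<^sub>R w) + h x) / s^2 - L x\<bar> < e" if "e > 0" for e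
  proof -
    obtain d1 where d1: "d1 > 0" "ball x d1 \<subseteq> S"
      using assms openE by blast
    obtain d2 where d2: "d2 > 0" "\<And>y. dist y x < d2 \<Longrightarrow> dist (L y) (L x) < e"
      using L \<open>e > 0\<close> unfolding continuous_at_eps_delta by blast
    define d where "d = min d1 d2"
    have d: "d > 0" using d1 d2 d_def by auto
    \<comment> \<open>For \<open>s < d / N\<close> the whole parallelogram spanned at
      \<open>x\<close> by the \<open>s\<close>-multiples of \<open>v\<close> and \<open>w\<close>
      lies within distance \<open>d\<close> of \<open>x\<close>. The summand 1 keeps
      \<open>N\<close> positive when both vectors vanish.\<close>
    define N where "N = norm v + norm w + 1"
    have N: "N > 0" unfolding N_def by (smt (verit) norm_ge_zero)
    have near: "dist (x + a *\<^sub>R v + b *\<^sub>R w) x < d" if "0 \<le> a" "a \<le> s" "0 \<le> b" "b \<le> s" "0 < s" "s < d / N" for a b s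
    proof -
      have "dist (x + a *\<^sub>R v + b *\<^sub>R w) x \<le> \<bar>a\<bar> * norm v + \<bar>b\<bar> * norm w"
        by (smt (verit, del_insts) add.commute add_diff_cancel_left' dist_norm group_cancel.add1 norm_scaleR norm_triangle_ineq)
      also have "\<dots> \<le> s * norm v + s * norm w"
        using that by (intro add_mono mult_right_mono) auto
      also have "\<dots> \<le> s * N" using that unfolding N_def by (simp add: algebra_simps)
      also have "\<dots> < d" using that N by (simp add: field_simps)
      finally show ?thesis .
    qed
    show ?thesis
    proof (intro exI[of _ "d / N"] conjI allI impI)
      show "d / N > 0" using d N by simp
      fix s assume s: "0 < s \<and> s < d / N"
      have inS: "x + a *\<^sub>R v + b *\<^sub>R w \<in> S" if "0 \<le> a" "a \<le> s" "0 \<le> b" "b \<le> s" for a b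
        using near[OF that] s d1 d_def by (auto simp: dist_commute)
      \<comment> \<open>The second difference is \<open>G s - G 0\<close>. The mean value theorem
        along \<open>v\<close>, and then along \<open>w\<close>, turns it into \<open>s^2\<close>
        times a value of \<open>L\<close> at a nearby point.\<close>
      define G where "G = (\<lambda>a. h (x + a *\<^sub>R v + s *\<^sub>R w) - h (x + a *\<^sub>R v))"
      have dh: "((\<lambda>a. h (x + a *\<^sub>R v + b *\<^sub>R w)) has_real_derivative P (x + a *\<^sub>R v + b *\<^sub>R w)) (at a)"
        if "0 \<le> a" "a \<le> s" "0 \<le> b" "b \<le> s" for a b
      proof -
        have hd: "(h has_derivative frechet_derivative h (at (x + a *\<^sub>R v + b *\<^sub>R w))) (at (x + a *\<^sub>R v + b *\<^sub>R w))"
          using Ck_on_has_derivative[OF assms(3)] inS[OF that] by blast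
        have ld: "((\<lambda>a. x + a *\<^sub>R v + b *\<^sub>R w) has_derivative (\<lambda>t. t *\<^sub>R v)) (at a)"
          by (auto intro!: derivative_eq_intros)
        have "((\<lambda>a. h (x + a *\<^sub>R v + b *\<^sub>R w)) has_derivative (\<lambda>t. frechet_derivative h (at (x + a *\<^sub>R v + b *\<^sub>R w)) (t *\<^sub>R v))) (at a)"
          using has_derivative_compose[OF ld hd] .
        then show ?thesis
          using linear_scale[OF has_derivative_linear[OF hd]]
          unfolding has_field_derivative_def P_def by (simp add: mult_commute_abs)
      qed
      have "\<exists>a. 0 < a \<and> a < s \<and> G s - G 0 = (s - 0) * (P (x + a *\<^sub>R v + s *\<^sub>R w) - P (x + a *\<^sub>R v))"
        unfolding G_def
        by (rule MVT2) (use s dh[of _ 0] dh[of _ s] in \<open>auto intro!: DERIV_diff\<close>)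
      then obtain a where a: "0 < a" "a < s" "G s - G 0 = s * (P (x + a *\<^sub>R v + s *\<^sub>R w) - P (x + a *\<^sub>R v))"
        by auto
      have dP: "((\<lambda>b. P (x + a *\<^sub>R v + b *\<^sub>R w)) has_real_derivative L (x + a *\<^sub>R v + b *\<^sub>R w)) (at b)"
        if "0 \<le> b" "b \<le> s" for b
      proof -
        have hd: "(P has_derivative frechet_derivative P (at (x + a *\<^sub>R v + b *\<^sub>R w))) (at (x + a *\<^sub>R v + b *\<^sub>R w))"
          using Ck_on_has_derivative[OF P] inS that a by auto
        have ld: "((\<lambda>b. x + a *\<^sub>R v + b *\<^sub>R w) has_derivative (\<lambda>t. t *\<^sub>R w)) (at b)"
          by (auto intro!: derivative_eq_intros)
        have "((\<lambda>b. P (x + a *\<^sub>R v + b *\<^sub>R w)) has_derivative (\<lambda>t. frechet_derivative P (at (x + a *\<^sub>R v + b *\<^sub>R w)) (t *\<^sub>R w))) (at b)"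
          using has_derivative_compose[OF ld hd] .
        then show ?thesis
          using linear_scale[OF has_derivative_linear[OF hd]]
          unfolding has_field_derivative_def L_def by (simp add: mult_commute_abs)
      qed
      have "\<exists>b. 0 < b \<and> b < s \<and> P (x + a *\<^sub>R v + s *\<^sub>R w) - P (x + a *\<^sub>R v + 0 *\<^sub>R w) = (s - 0) * L (x + a *\<^sub>R v + b *\<^sub>R w)"
        by (rule MVT2) (use s dP in auto)
      then obtain b where b: "0 < b" "b < s" "P (x + a *\<^sub>R v + s *\<^sub>R w) - P (x + a *\<^sub>R v) = s * L (x + a *\<^sub>R v + b *\<^sub>R w)"
        by auto
      have "h (x + s *\<^sub>R v + s *\<^sub>R w) - h (x + s *\<^sub>R v) - h (x + s *\<^sub>R w) + h x = s^2 * L (x + a *\<^sub>R v + b *\<^sub>R w)"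
        using a(3) unfolding b(3) G_def by (simp add: power2_eq_square algebra_simps)
      then have "(h (x + s *\<^sub>R v + s *\<^sub>R w) - h (x + s *\<^sub>R v) - h (x + s *\<^sub>R w) + h x) / s^2 = L (x + a *\<^sub>R v + b *\<^sub>R w)"
        using s by simp
      moreover have "dist (L (x + a *\<^sub>R v + b *\<^sub>R w)) (L x) < e"
        using near[of a s b] a b s by (intro d2(2)) (auto simp: d_def)
      ultimately show "\<bar>(h (x + s *\<^sub>R v + s *\<^sub>R w) - h (x + s *\<^sub>R v) - h (x + s *\<^sub>R w) + h x) / s^2 - L x\<bar> < e"
        by (simp add: dist_real_def)
    qed
  qed
  then have "((\<lambda>s. (h (x + s *\<^sub>R v + s *\<^sub>R w) - h (x + s *\<^sub>R v) - h (x + s *\<^sub>R w) + h x) / s^2) \<longlongrightarrow> L x) (at_right 0)"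
    unfolding tendsto_iff eventually_at dist_real_def by (metis greaterThan_iff diff_0_right abs_of_pos)
  then show ?thesis unfolding L_def P_def .
qed

lemma symmetric_second_derivative:
  fixes h :: "'a::euclidean_space \<Rightarrow> real"
  assumes "open S" "x \<in> S" "Ck_on (Suc (Suc 0)) S h"
  shows "frechet_derivative (\<lambda>y. frechet_derivative h (at y) v) (at x) w =
    frechet_derivative (\<lambda>y. frechet_derivative h (at y) w) (at x) v"
proof (rule tendsto_unique[OF _ second_difference_quotient[OF assms]])
  show "((\<lambda>s. (h (x + s *\<^sub>R v + s *\<^sub>R w) - h (x + s *\<^sub>R v) - h (x + s *\<^sub>R w) + h x) / s^2) \<longlongrightarrow>
      frechet_derivative (\<lambda>y. frechet_derivative h (at y) w) (at x) v) (at_right 0)"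
    using second_difference_quotient[OF assms, of w v] by (simp add: algebra_simps)
qed simp

section \<open>Smooth bump functions\<close>

text \<open>This is \<open>p(1/s) exp(-1/s)\<close> for positive \<open>s\<close>, continued by 0.
  Keeping the polynomial as a parameter makes the family closed under differentiation, so that
  smoothness is one induction.\<close>

definition flat_fun :: "real poly \<Rightarrow> real \<Rightarrow> real"
  where "flat_fun p s = (if s > 0 then poly p (inverse s) * exp (- inverse s) else 0)"

lemma flat_fun_tendsto_0: "(flat_fun p \<longlongrightarrow> 0) (at_right 0)"
proof -
  have "((\<lambda>x. \<Sum>i\<le>degree p. coeff p i * (x ^ i / exp x)) \<longlongrightarrow> (\<Sum>i\<le>degree p. coeff p i * 0)) at_top"
    by (intro tendsto_sum tendsto_mult tendsto_const tendsto_power_div_exp_0)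
  moreover have "(\<lambda>x. \<Sum>i\<le>degree p. coeff p i * (x ^ i / exp x)) = (\<lambda>x. poly p x * exp (- x))"
    by (auto simp: poly_altdef sum_distrib_right exp_minus field_simps sum_divide_distrib)
  ultimately have "((\<lambda>x. poly p x * exp (- x)) \<longlongrightarrow> 0) at_top"
    by simp
  then have "((\<lambda>s. poly p (inverse s) * exp (- inverse s)) \<longlongrightarrow> 0) (at_right 0)"
    by (rule filterlim_compose[OF _ filterlim_inverse_at_top_right])
  then show ?thesis
    by (rule Lim_transform_eventually)
       (auto simp: flat_fun_def eventually_at_right_less intro: eventually_mono[OF eventually_at_right_less])
qed

text \<open>With \<open>x = 1/s\<close> one has \<open>d/ds = - x^2 d/dx\<close>, and
  \<open>p(x) exp(-x)\<close> has the \<open>x\<close>-derivative \<open>(p' - p) exp(-x)\<close>;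
  this is where the factor \<open>[:0, 0, 1:]\<close>, that is \<open>x^2\<close>, comes
  from.\<close>

lemma flat_fun_has_derivative:
  "(flat_fun p has_real_derivative flat_fun ([:0, 0, 1:] * (p - pderiv p)) s) (at s)"
proof (cases s "0::real" rule: linorder_cases)
  case less
  have "((\<lambda>s. 0) has_real_derivative 0) (at s)" by simp
  then have "(flat_fun p has_real_derivative 0) (at s)"
    by (rule has_field_derivative_transform_within_open[where S="{..<0}"])
       (use less in \<open>auto simp: flat_fun_def\<close>)
  then show ?thesis using less by (simp add: flat_fun_def)
next
  case greater
  have "((\<lambda>s. poly p (inverse s) * exp (- inverse s)) has_real_derivative
      poly ([:0, 0, 1:] * (p - pderiv p)) (inverse s) * exp (- inverse s)) (at s)"
    using greater
    by (auto intro!: derivative_eq_intros DERIV_chain2[OF poly_DERIV] simp: algebra_simps power2_eq_square)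
  then have "(flat_fun p has_real_derivative
      poly ([:0, 0, 1:] * (p - pderiv p)) (inverse s) * exp (- inverse s)) (at s)"
    by (rule has_field_derivative_transform_within_open[where S="{0<..}"])
       (use greater in \<open>auto simp: flat_fun_def\<close>)
  then show ?thesis using greater by (simp add: flat_fun_def)
next
  case equal
  have "((\<lambda>h. (flat_fun p (0 + h) - flat_fun p 0) / h) \<longlongrightarrow> 0) (at 0)"
    unfolding filterlim_at_split
  proof
    show "((\<lambda>h. (flat_fun p (0 + h) - flat_fun p 0) / h) \<longlongrightarrow> 0) (at_left 0)"
      by (rule tendsto_eventually) (auto simp: flat_fun_def eventually_at intro!: exI[of _ 1])
    show "((\<lambda>h. (flat_fun p (0 + h) - flat_fun p 0) / h) \<longlongrightarrow> 0) (at_right 0)"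
      \<comment> \<open>Dividing by \<open>h\<close> multiplies the polynomial by its variable
        \<open>1/h\<close>, so the quotient is again a flat function, with
        \<open>pCons 0 p\<close>.\<close>
      by (rule Lim_transform_eventually[OF flat_fun_tendsto_0[of "pCons 0 p"]])
         (auto simp: flat_fun_def eventually_at field_simps intro!: exI[of _ 1])
  qed
  then have "(flat_fun p has_real_derivative 0) (at 0)"
    by (simp add: DERIV_def)
  then show ?thesis using equal by (simp add: flat_fun_def)
qed

lemma smooth_on_flat_fun: "smooth_on UNIV (flat_fun p)"
proof -
  have "Ck_on k UNIV (flat_fun p)" for k
  proof (induction k arbitrary: p)
    case 0
    then show ?case
      by (auto intro!: continuous_at_imp_continuous_on DERIV_isCont[OF flat_fun_has_derivative])
  next
    case (Suc k)
    have "Ck_on k UNIV (\<lambda>x. flat_fun ([:0, 0, 1:] * (p - pderiv p)) x * v)" for v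
      by (intro Ck_on_mult Suc.IH) auto
    then show ?case
      by (intro Ck_on_SucI[where h'="\<lambda>x v. flat_fun ([:0, 0, 1:] * (p - pderiv p)) x * v"])
         (use flat_fun_has_derivative in \<open>auto simp: has_field_derivative_def\<close>)
  qed
  then show ?thesis by (simp add: smooth_on_def)
qed

text \<open>The denominator never vanishes because \<open>s\<close> and \<open>1 - s\<close> cannot
  both be nonpositive; the quotient rises from 0 on \<open>s \<le> 0\<close> to 1 on
  \<open>s \<ge> 1\<close>.\<close>

definition smooth_step :: "real \<Rightarrow> real"
  where "smooth_step s = flat_fun 1 s * inverse (flat_fun 1 s + flat_fun 1 (1 - s))"

lemma smooth_step_eq_0: "s \<le> 0 \<Longrightarrow> smooth_step s = 0"
  by (simp add: smooth_step_def flat_fun_def)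

lemma smooth_step_eq_1: "s \<ge> 1 \<Longrightarrow> smooth_step s = 1"
  by (simp add: smooth_step_def flat_fun_def)

lemma smooth_on_smooth_step: "smooth_on UNIV smooth_step"
proof -
  have pos: "flat_fun 1 s + flat_fun 1 (1 - s) \<noteq> 0" for s
    by (auto simp: flat_fun_def add_nonneg_eq_0_iff)
  have "Ck_on k UNIV (\<lambda>s. flat_fun 1 s * inverse (flat_fun 1 s + flat_fun 1 (1 - s)))" for k
    by (intro Ck_on_mult Ck_on_inverse Ck_on_add pos smooth_onD[OF smooth_on_flat_fun]
        Ck_on_compose[where T=UNIV and g="flat_fun 1"] Ck_on_diff Ck_on_const)
       (auto intro: Ck_on_linear bounded_linear_ident)
  then show ?thesis unfolding smooth_on_def smooth_step_def[abs_def] by simp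
qed

lemma smooth_bump:
  fixes u :: "'a::euclidean_space"
  assumes "r > 0"
  shows "\<exists>\<beta> :: 'a \<Rightarrow> real. smooth_on UNIV \<beta> \<and> (\<forall>x\<in>cball u r. \<beta> x = 1) \<and>
    (\<forall>x. x \<notin> cball u (2 * r) \<longrightarrow> \<beta> x = 0)"
proof (intro exI conjI ballI allI impI)
  \<comment> \<open>\<open>?q x\<close> is \<open>2 - (dist u x / r)^2\<close>: at least 1 on the
    ball of radius \<open>r\<close>, at most 0 beyond radius \<open>2 * r\<close>. The squared
    distance is written as a sum over the basis to make it visibly a polynomial.\<close>
  let ?q = "\<lambda>x. 2 - inverse (r^2) * (\<Sum>b\<in>Basis. ((x - u) \<bullet> b) * ((x - u) \<bullet> b))"
  have q: "?q x = 2 - (dist u x / r)^2" for x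
  proof -
    have "(\<Sum>b\<in>Basis. ((x - u) \<bullet> b) * ((x - u) \<bullet> b)) = (dist x u)^2"
      unfolding dist_norm power2_norm_eq_inner euclidean_inner[of "x - u" "x - u"] ..
    then show ?thesis by (simp only: dist_commute power_divide) (simp add: divide_inverse)
  qed
  have lin: "Ck_on k UNIV (\<lambda>x. (x - u) \<bullet> b)" for k b
    by (rule Ck_on_compose_linear[OF open_UNIV bounded_linear_inner_left
          Ck_on_diff[OF open_UNIV Ck_on_linear[OF open_UNIV bounded_linear_ident] Ck_on_const]])
  have quad: "Ck_on k UNIV ?q" for k
    by (rule Ck_on_diff[OF open_UNIV Ck_on_const Ck_on_mult[OF open_UNIV Ck_on_const
          Ck_on_sum[OF open_UNIV Ck_on_mult[OF open_UNIV lin lin]]]])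
  have "Ck_on k UNIV (\<lambda>x. smooth_step (?q x))" for k
    by (rule Ck_on_compose[OF open_UNIV open_UNIV subset_UNIV quad smooth_onD[OF smooth_on_smooth_step]])
  then show "smooth_on UNIV (\<lambda>x. smooth_step (?q x))" by (simp add: smooth_on_def)
  show "smooth_step (?q x) = 1" if "x \<in> cball u r" for x
  proof (rule smooth_step_eq_1)
    have "(dist u x / r)^2 \<le> 1" using that assms by (simp add: power_le_one)
    then show "?q x \<ge> 1" unfolding q by simp
  qed
  show "smooth_step (?q x) = 0" if "x \<notin> cball u (2 * r)" for x
  proof (rule smooth_step_eq_0)
    have "dist u x / r \<ge> 2" using that assms by (simp add: field_simps)
    then have "(dist u x / r)^2 \<ge> 2^2" by (intro power_mono) auto
    then show "?q x \<le> 0" unfolding q by simp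
  qed
qed

section \<open>Gradients and Hessians in the plane\<close>

definition euclidean_gradient :: "(real^2 \<Rightarrow> real) \<Rightarrow> real^2 \<Rightarrow> real^2"
  where "euclidean_gradient h u = (\<chi> i. partial_deriv i h u)"

definition euclidean_hessian :: "(real^2 \<Rightarrow> real) \<Rightarrow> real^2 \<Rightarrow> real^2^2"
  where "euclidean_hessian h u = (\<chi> i j. partial_deriv i (partial_deriv j h) u)"

lemma has_derivative_nth_expansion:
  assumes "(h has_derivative h') (at (u::real^'n))"
  shows "h' v = (\<Sum>i\<in>UNIV. v $ i *\<^sub>R h' (axis i 1))"
proof -
  interpret linear h' using assms has_derivative_linear by blast
  have "h' v = h' (\<Sum>i\<in>UNIV. v $ i *\<^sub>R axis i 1)"
    using basis_expansion[of v] by (simp add: scalar_mult_eq_scaleR)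
  then show ?thesis by (simp add: sum scale)
qed

lemma frechet_derivative_gradient:
  assumes "h differentiable (at u)"
  shows "frechet_derivative h (at u) v = euclidean_gradient h u \<bullet> v"
proof -
  have "(h has_derivative frechet_derivative h (at u)) (at u)"
    using assms frechet_derivative_works by blast
  from has_derivative_nth_expansion[OF this, of v] show ?thesis
    by (simp add: euclidean_gradient_def partial_deriv_def inner_vec_def mult.commute)
qed

lemma euclidean_gradient_eqI:
  assumes "(h has_derivative h') (at u)" "\<And>v. h' v = w \<bullet> v"
  shows "euclidean_gradient h u = w"
  using frechet_derivative_eqI[OF assms(1)] assms(2)
  by (simp add: euclidean_gradient_def partial_deriv_def vec_eq_iff inner_axis)

lemma euclidean_hessian_symmetric:
  assumes "open S" "u \<in> S" "Ck_on (Suc (Suc 0)) S h"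
  shows "transpose (euclidean_hessian h u) = euclidean_hessian h u"
proof -
  have "partial_deriv i (partial_deriv j h) u = partial_deriv j (partial_deriv i h) u" for i j
    using symmetric_second_derivative[OF assms] unfolding partial_deriv_def[abs_def] by blast
  then show ?thesis by (simp add: euclidean_hessian_def transpose_def vec_eq_iff)
qed

lemma Ck_on_gradient:
  assumes "open S" "Ck_on (Suc k) S h"
  shows "Ck_on k S (euclidean_gradient h)"
  unfolding euclidean_gradient_def[abs_def] partial_deriv_def
  by (rule Ck_on_vec) (use assms in auto)

lemma Ck_on_hessian_nth:
  assumes "Ck_on (Suc (Suc k)) S h"
  shows "Ck_on k S (\<lambda>u. euclidean_hessian h u $ i $ j)"
  using assms unfolding euclidean_hessian_def partial_deriv_def[abs_def] by simp

text \<open>Differentiating component \<open>i\<close> in direction \<open>v\<close> gives the sum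
  of \<open>v $ j\<close> times the partial derivative \<open>j\<close> of the partial derivative
  \<open>i\<close>, that is, the transposed Hessian; Schwarz removes the transposition.\<close>

lemma gradient_has_derivative:
  assumes "open S" "u \<in> S" "Ck_on (Suc (Suc 0)) S h"
  shows "(euclidean_gradient h has_derivative (\<lambda>v. euclidean_hessian h u *v v)) (at u)"
proof -
  have "Ck_on (Suc 0) S (euclidean_gradient h)" by (rule Ck_on_gradient[OF assms(1,3)])
  then have der: "(euclidean_gradient h has_derivative frechet_derivative (euclidean_gradient h) (at u)) (at u)"
    using Ck_on_has_derivative assms(2) by blast
  have "frechet_derivative (euclidean_gradient h) (at u) v = euclidean_hessian h u *v v" for v
  proof -
    have "frechet_derivative (euclidean_gradient h) (at u) v $ i = (euclidean_hessian h u *v v) $ i" for i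
    proof -
      have "((\<lambda>x. euclidean_gradient h x $ i) has_derivative (\<lambda>v. frechet_derivative (euclidean_gradient h) (at u) v $ i)) (at u)"
        by (rule bounded_linear.has_derivative[OF bounded_linear_vec_nth der])
      then have d: "(partial_deriv i h has_derivative (\<lambda>v. frechet_derivative (euclidean_gradient h) (at u) v $ i)) (at u)"
        by (simp add: euclidean_gradient_def)
      have "frechet_derivative (euclidean_gradient h) (at u) v $ i = (\<Sum>j\<in>UNIV. v $ j * partial_deriv j (partial_deriv i h) u)"
        using has_derivative_nth_expansion[OF d, of v] frechet_derivative_eqI[OF d]
        by (simp add: partial_deriv_def)
      also have "\<dots> = (transpose (euclidean_hessian h u) *v v) $ i"
        by (simp add: matrix_vector_mult_def transpose_def euclidean_hessian_def mult.commute)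
      finally show ?thesis using euclidean_hessian_symmetric[OF assms] by simp
    qed
    then show ?thesis by (simp add: vec_eq_iff)
  qed
  with der show ?thesis by (metis (no_types, lifting) ext)
qed

lemma euclidean_gradient_cong:
  assumes "open S" "u \<in> S" "\<And>x. x \<in> S \<Longrightarrow> g x = h x"
  shows "euclidean_gradient g u = euclidean_gradient h u"
proof -
  have "(g has_derivative D) (at u) \<longleftrightarrow> (h has_derivative D) (at u)" for D
    using has_derivative_transform_within_open[OF _ assms(1,2), of g D UNIV h] 
      has_derivative_transform_within_open[OF _ assms(1,2), of h D UNIV g] assms(3) by auto
  then have "frechet_derivative g (at u) = frechet_derivative h (at u)"
    unfolding frechet_derivative_def by simp
  then show ?thesis by (simp add: euclidean_gradient_def partial_deriv_def)
qed

lemma euclidean_hessian_cong: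
  assumes "open S" "u \<in> S" "\<And>x. x \<in> S \<Longrightarrow> g x = h x"
  shows "euclidean_hessian g u = euclidean_hessian h u"
proof -
  have "partial_deriv j g x = partial_deriv j h x" if "x \<in> S" for x j
    using euclidean_gradient_cong[OF assms(1) that assms(3)] by (simp add: euclidean_gradient_def vec_eq_iff)
  then have "euclidean_gradient (partial_deriv j g) u = euclidean_gradient (partial_deriv j h) u" for j
    by (intro euclidean_gradient_cong[OF assms(1,2)])
  then show ?thesis by (simp add: euclidean_gradient_def euclidean_hessian_def vec_eq_iff)
qed

lemma gradient_compose:
  fixes T :: "real^2 \<Rightarrow> real^2"
  assumes "(T has_derivative T') (at u)" "h differentiable (at (T u))"
  shows "((\<lambda>x. h (T x)) has_derivative (\<lambda>v. euclidean_gradient h (T u) \<bullet> T' v)) (at u)"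
    and "euclidean_gradient (\<lambda>x. h (T x)) u = transpose (matrix T') *v euclidean_gradient h (T u)"
proof -
  have hd: "(h has_derivative (\<lambda>v. euclidean_gradient h (T u) \<bullet> v)) (at (T u))"
    using assms(2) frechet_derivative_works frechet_derivative_gradient by (metis (no_types, lifting) ext)
  show 1: "((\<lambda>x. h (T x)) has_derivative (\<lambda>v. euclidean_gradient h (T u) \<bullet> T' v)) (at u)"
    by (rule has_derivative_compose[OF assms(1) hd])
  have "T' v = matrix T' *v v" for v
    using matrix_vector_mul(2)[OF has_derivative_linear[OF assms(1)]] by metis
  then show "euclidean_gradient (\<lambda>x. h (T x)) u = transpose (matrix T') *v euclidean_gradient h (T u)"
    by (intro euclidean_gradient_eqI[OF 1]) (simp add: dot_lmul_matrix[symmetric])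
qed

text \<open>At a critical point the second derivatives of the coordinate change do not enter.\<close>

lemma hessian_compose:
  fixes T :: "real^2 \<Rightarrow> real^2"
  assumes S: "open S" "u \<in> S" and U: "open U" "T ` S \<subseteq> U"
    and T: "Ck_on (Suc (Suc 0)) S T" and h: "Ck_on (Suc (Suc 0)) U h"
    and crit: "euclidean_gradient h (T u) = 0"
  defines "J \<equiv> matrix (frechet_derivative T (at u))"
  shows "euclidean_hessian (\<lambda>x. h (T x)) u = transpose J ** euclidean_hessian h (T u) ** J"
proof -
  let ?H = "euclidean_hessian h (T u)" and ?J = "\<lambda>x. matrix (frechet_derivative T (at x))"
  have Td: "(T has_derivative frechet_derivative T (at x)) (at x)" if "x \<in> S" for x
    using Ck_on_has_derivative[OF T that] .
  have Jv: "frechet_derivative T (at x) v = ?J x *v v" if "x \<in> S" for x v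
    using matrix_vector_mul(2)[OF has_derivative_linear[OF Td[OF that]]] by metis
  have hd: "h differentiable (at (T x))" if "x \<in> S" for x
    using h U that by auto
  have grad: "euclidean_gradient (\<lambda>x. h (T x)) x = transpose (?J x) *v euclidean_gradient h (T x)" if "x \<in> S" for x
    using gradient_compose(2)[OF Td[OF that] hd[OF that]] .
  have gd: "((\<lambda>x. euclidean_gradient h (T x)) has_derivative (\<lambda>v. ?H *v (J *v v))) (at u)"
    using has_derivative_compose[OF Td[OF S(2)] gradient_has_derivative[OF U(1) _ h]] S U Jv[OF S(2)]
    by (auto simp: J_def)
  have Ck: "Ck_on (Suc (Suc 0)) S (\<lambda>x. h (T x))"
    by (rule Ck_on_compose[OF S(1) U T h])
  have "euclidean_hessian (\<lambda>x. h (T x)) u *v v = (transpose J ** ?H ** J) *v v" for v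
  proof -
    have "(euclidean_hessian (\<lambda>x. h (T x)) u *v v) $ i = ((transpose J ** ?H ** J) *v v) $ i" for i
    proof -
      have "((\<lambda>x. euclidean_gradient (\<lambda>x. h (T x)) x $ i) has_derivative (\<lambda>v. (euclidean_hessian (\<lambda>x. h (T x)) u *v v) $ i)) (at u)"
        by (rule bounded_linear.has_derivative[OF bounded_linear_vec_nth gradient_has_derivative[OF S Ck]])
      moreover have "((\<lambda>x. euclidean_gradient (\<lambda>x. h (T x)) x $ i) has_derivative (\<lambda>v. (transpose J *v (?H *v (J *v v))) $ i)) (at u)"
      proof (rule has_derivative_transform_within_open[OF _ S])
        show "(\<Sum>k\<in>UNIV. frechet_derivative T (at x) (axis i 1) $ k * euclidean_gradient h (T x) $ k) =
            euclidean_gradient (\<lambda>x. h (T x)) x $ i" if "x \<in> S" for x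
          using that by (simp add: grad Jv matrix_vector_mult_def transpose_def axis_def if_distrib cong: if_cong)
        have C1: "Ck_on (Suc 0) S (\<lambda>x. frechet_derivative T (at x) (axis i 1))"
          by (rule Ck_on_derivative[OF T])
        show "((\<lambda>x. \<Sum>k\<in>UNIV. frechet_derivative T (at x) (axis i 1) $ k * euclidean_gradient h (T x) $ k)
            has_derivative (\<lambda>v. (transpose J *v (?H *v (J *v v))) $ i)) (at u)"
        proof (rule has_derivative_eq_rhs)
          show "((\<lambda>x. \<Sum>k\<in>UNIV. frechet_derivative T (at x) (axis i 1) $ k * euclidean_gradient h (T x) $ k)
            has_derivative (\<lambda>v. \<Sum>k\<in>UNIV. frechet_derivative T (at u) (axis i 1) $ k * (?H *v (J *v v)) $ k +
              frechet_derivative (\<lambda>x. frechet_derivative T (at x) (axis i 1)) (at u) v $ k * euclidean_gradient h (T u) $ k)) (at u)"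
            by (intro has_derivative_sum has_derivative_mult
                bounded_linear.has_derivative[OF bounded_linear_vec_nth gd]
                bounded_linear.has_derivative[OF bounded_linear_vec_nth Ck_on_has_derivative[OF C1 S(2)]])
        qed (use S(2) in \<open>simp add: crit Jv J_def[symmetric] matrix_vector_mult_def transpose_def axis_def if_distrib fun_eq_iff cong: if_cong\<close>)
      qed
      ultimately have "(\<lambda>v. (euclidean_hessian (\<lambda>x. h (T x)) u *v v) $ i) = (\<lambda>v. (transpose J *v (?H *v (J *v v))) $ i)"
        by (rule has_derivative_unique)
      from fun_cong[OF this, of v] show ?thesis
        by (simp add: matrix_vector_mul_assoc matrix_mul_assoc)
    qed
    then show ?thesis by (simp add: vec_eq_iff)
  qed
  then show ?thesis by (simp add: matrix_eq)
qed

section \<open>Calculus in charts\<close>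

definition transition_jacobian :: "'m chart \<Rightarrow> 'm chart \<Rightarrow> 'm \<Rightarrow> real^2^2"
  where "transition_jacobian c d x = jacobian (in_chart c (snd d)) (at (snd c x))"

definition chart_gradient :: "'m chart \<Rightarrow> ('m \<Rightarrow> real) \<Rightarrow> 'm \<Rightarrow> real^2"
  where "chart_gradient c F x = euclidean_gradient (in_chart c F) (snd c x)"

lemma hessian_eq_euclidean: "hessian c F x = euclidean_hessian (in_chart c F) (snd c x)"
  by (simp add: hessian_def euclidean_hessian_def)

locale smooth_manifold =
  fixes A :: "('m::t2_space) chart set"
  assumes atlas: "smooth_atlas A"
begin

lemma chart_cover: obtains c where "c \<in> A" "x \<in> fst c"
proof -
  have "x \<in> (\<Union>c\<in>A. fst c)" using atlas unfolding smooth_atlas_def by simp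
  then show ?thesis using that by blast
qed

text \<open>The atlas provides some inverse \<open>k\<close>; on the image it agrees with
  \<open>inv_into\<close>, the inverse on which \<open>in_chart\<close> is built.\<close>

lemma chart_homeomorphism:
  assumes "c \<in> A"
  shows "homeomorphism (fst c) (snd c ` fst c) (snd c) (inv_into (fst c) (snd c))"
proof -
  obtain k where k: "homeomorphism (fst c) (snd c ` fst c) (snd c) k"
    using atlas assms unfolding smooth_atlas_def by blast
  then have inj: "inj_on (snd c) (fst c)"
    unfolding homeomorphism_def by (metis inj_on_inverseI)
  have "k u = inv_into (fst c) (snd c) u" if "u \<in> snd c ` fst c" for u
    using that k inj unfolding homeomorphism_def by (metis f_inv_into_f inv_into_into)
  then show ?thesis
    using homeomorphism_cong[OF k] by metis
qed

lemma open_chart: "c \<in> A \<Longrightarrow> open (fst c)"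
  using atlas unfolding smooth_atlas_def by blast

lemma inj_on_chart: "c \<in> A \<Longrightarrow> inj_on (snd c) (fst c)"
  using chart_homeomorphism unfolding homeomorphism_def by (metis inj_on_inverseI)

lemma inv_chart [simp]: "c \<in> A \<Longrightarrow> x \<in> fst c \<Longrightarrow> inv_into (fst c) (snd c) (snd c x) = x"
  using inj_on_chart inv_into_f_f by metis

lemma in_chart_apply: "c \<in> A \<Longrightarrow> x \<in> fst c \<Longrightarrow> in_chart c h (snd c x) = h x"
  by (simp add: in_chart_def)

lemma continuous_on_chart: "c \<in> A \<Longrightarrow> continuous_on (fst c) (snd c)"
  using chart_homeomorphism unfolding homeomorphism_def by blast

lemma continuous_on_inv_chart:
  "c \<in> A \<Longrightarrow> continuous_on (snd c ` fst c) (inv_into (fst c) (snd c))"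
  using chart_homeomorphism unfolding homeomorphism_def by blast

lemma open_chart_image:
  assumes "c \<in> A" "open U"
  shows "open (snd c ` (fst c \<inter> U))"
proof -
  have "openin (top_of_set (fst c)) (fst c \<inter> U)"
    using assms(2) by (simp add: openin_open_Int)
  then have "openin (top_of_set (snd c ` fst c)) (snd c ` (fst c \<inter> U))"
    by (rule homeomorphism_imp_open_map[OF chart_homeomorphism[OF assms(1)]])
  moreover have "open (snd c ` fst c)"
    using atlas assms(1) unfolding smooth_atlas_def by blast
  ultimately show ?thesis by (rule openin_open_trans)
qed

lemma open_chart_image': "c \<in> A \<Longrightarrow> open U \<Longrightarrow> U \<subseteq> fst c \<Longrightarrow> open (snd c ` U)"
  using open_chart_image[of c U] by (simp add: Int_absorb1)

lemma open_inv_chart_image: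
  assumes "c \<in> A" "open V" "V \<subseteq> snd c ` fst c"
  shows "open (inv_into (fst c) (snd c) ` V)"
proof -
  have "openin (top_of_set (snd c ` fst c)) V"
    using assms by (metis Int_absorb1 openin_open)
  then have "openin (top_of_set (fst c)) (inv_into (fst c) (snd c) ` V)"
    by (rule homeomorphism_imp_open_map[OF homeomorphism_symD[OF chart_homeomorphism[OF assms(1)]]])
  then show ?thesis using open_chart[OF assms(1)] by (rule openin_open_trans)
qed

lemma transition_smooth:
  "c \<in> A \<Longrightarrow> d \<in> A \<Longrightarrow> smooth_on (snd c ` (fst c \<inter> fst d)) (in_chart c (snd d))"
  using atlas unfolding smooth_atlas_def by blast

lemma chart_ball:
  assumes "c \<in> A" "x \<in> fst c" "open U" "x \<in> U"
  obtains r where "r > 0" "cball (snd c x) r \<subseteq> snd c ` (fst c \<inter> U)"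
  using open_chart_image[OF assms(1,3)] assms open_contains_cball
  by (metis (no_types, lifting) IntI image_eqI)

lemma compact_inv_cball:
  assumes "c \<in> A" "cball u r \<subseteq> snd c ` fst c"
  shows "compact (inv_into (fst c) (snd c) ` cball u r)"
  using compact_continuous_image[OF continuous_on_subset[OF continuous_on_inv_chart[OF assms(1)] assms(2)]]
  by simp

lemma mem_inv_image_iff:
  assumes "c \<in> A" "V \<subseteq> snd c ` fst c"
  shows "x \<in> inv_into (fst c) (snd c) ` V \<longleftrightarrow> x \<in> fst c \<and> snd c x \<in> V"
proof
  assume "x \<in> inv_into (fst c) (snd c) ` V"
  then show "x \<in> fst c \<and> snd c x \<in> V"
    using assms by (auto simp: f_inv_into_f inv_into_into subset_iff)
next
  assume "x \<in> fst c \<and> snd c x \<in> V"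
  then show "x \<in> inv_into (fst c) (snd c) ` V"
    using assms by (metis image_eqI inv_chart)
qed

lemma smooth_fun_onD: "smooth_fun_on A W F \<Longrightarrow> c \<in> A \<Longrightarrow> smooth_on (snd c ` (fst c \<inter> W)) (in_chart c F)"
  unfolding smooth_fun_on_def by blast

lemma smooth_fun_on_Ck:
  "smooth_fun_on A W F \<Longrightarrow> c \<in> A \<Longrightarrow> Ck_on k (snd c ` (fst c \<inter> W)) (in_chart c F)"
  using smooth_fun_onD smooth_onD by blast

lemma in_chart_change:
  assumes "c \<in> A" "d \<in> A" "u \<in> snd c ` (fst c \<inter> fst d)"
  shows "in_chart c F u = in_chart d F (in_chart c (snd d) u)"
  using assms by (auto simp: in_chart_apply)

text \<open>One chart around each point suffices, since the expression in any other chart is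
  obtained by composing with a smooth transition map.\<close>

lemma smooth_fun_onI_local:
  assumes "\<And>x. x \<in> W \<Longrightarrow> \<exists>c\<in>A. \<exists>U. open U \<and> x \<in> U \<and> U \<subseteq> fst c \<and> smooth_on (snd c ` U) (in_chart c F)"
  shows "smooth_fun_on A W F"
  unfolding smooth_fun_on_def smooth_on_def
proof (intro ballI allI)
  fix d k assume d: "d \<in> A"
  show "Ck_on k (snd d ` (fst d \<inter> W)) (in_chart d F)"
  proof (rule Ck_on_local)
    fix u assume "u \<in> snd d ` (fst d \<inter> W)"
    then obtain x where x: "x \<in> fst d" "x \<in> W" "u = snd d x" by blast
    obtain c U where c: "c \<in> A" "open U" "x \<in> U" "U \<subseteq> fst c" "smooth_on (snd c ` U) (in_chart c F)"
      using assms[OF x(2)] by blast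
    let ?S = "snd d ` (fst d \<inter> U)"
    have S: "open ?S" using open_chart_image d c by blast
    have "Ck_on k ?S (in_chart d (snd c))"
      by (rule Ck_on_subset[OF smooth_onD[OF transition_smooth[OF d c(1)]]]) (use c in blast)
    moreover have "in_chart d (snd c) ` ?S \<subseteq> snd c ` U"
      using d c by (auto simp: in_chart_apply)
    ultimately have "Ck_on k ?S (\<lambda>u. in_chart c F (in_chart d (snd c) u))"
      using Ck_on_compose[OF S open_chart_image'[OF c(1,2,4)] _ _ smooth_onD[OF c(5)]] by blast
    moreover have eq: "in_chart c F (in_chart d (snd c) v) = in_chart d F v" if "v \<in> ?S" for v
      using in_chart_change[OF d c(1), of v F] that c(4) by auto
    ultimately have "Ck_on k ?S (in_chart d F)"
      using Ck_on_cong[OF S eq] by simp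
    then show "\<exists>V. open V \<and> u \<in> V \<and> Ck_on k V (in_chart d F)"
      using S x c by blast
  qed
qed

lemma smooth_fun_on_subset: "smooth_fun_on A W F \<Longrightarrow> V \<subseteq> W \<Longrightarrow> smooth_fun_on A V F"
  unfolding smooth_fun_on_def smooth_on_def
  by (meson Ck_on_subset Int_mono image_mono order_refl)

lemma smooth_fun_on_cong:
  assumes "open W" "\<And>x. x \<in> W \<Longrightarrow> F x = G x" "smooth_fun_on A W G"
  shows "smooth_fun_on A W F"
  unfolding smooth_fun_on_def smooth_on_def
proof (intro ballI allI)
  fix c k assume c: "c \<in> A"
  have "in_chart c F u = in_chart c G u" if "u \<in> snd c ` (fst c \<inter> W)" for u
    using that assms(2) c by (auto simp: in_chart_apply)
  then show "Ck_on k (snd c ` (fst c \<inter> W)) (in_chart c F)"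
    using Ck_on_cong[OF open_chart_image[OF c assms(1)]] smooth_fun_on_Ck[OF assms(3) c] by blast
qed

lemma smooth_fun_on_cover:
  assumes "\<And>x. x \<in> W \<Longrightarrow> \<exists>U. open U \<and> x \<in> U \<and> smooth_fun_on A U F"
  shows "smooth_fun_on A W F"
proof (rule smooth_fun_onI_local)
  fix x assume "x \<in> W"
  then obtain U where U: "open U" "x \<in> U" "smooth_fun_on A U F" using assms by blast
  obtain c where c: "c \<in> A" "x \<in> fst c" by (rule chart_cover)
  have "open (fst c \<inter> U)" using open_chart c U by blast
  then show "\<exists>c\<in>A. \<exists>U. open U \<and> x \<in> U \<and> U \<subseteq> fst c \<and> smooth_on (snd c ` U) (in_chart c F)"
    using c U smooth_fun_onD[OF U(3) c(1)] by blast
qed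

lemma smooth_fun_on_const: "smooth_fun_on A W (\<lambda>x. a)"
  unfolding smooth_fun_on_def smooth_on_def in_chart_def by (simp add: comp_def)

lemma smooth_fun_on_add:
  "open W \<Longrightarrow> smooth_fun_on A W F \<Longrightarrow> smooth_fun_on A W G \<Longrightarrow> smooth_fun_on A W (\<lambda>x. F x + G x)"
  unfolding smooth_fun_on_def smooth_on_def in_chart_def comp_def
  by (auto intro!: Ck_on_add open_chart_image)

lemma smooth_fun_on_mult:
  "open W \<Longrightarrow> smooth_fun_on A W F \<Longrightarrow> smooth_fun_on A W G \<Longrightarrow> smooth_fun_on A W (\<lambda>x. F x * G x)"
  unfolding smooth_fun_on_def smooth_on_def in_chart_def comp_def
  by (auto intro!: Ck_on_mult open_chart_image)

lemma smooth_fun_on_minus: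
  "open W \<Longrightarrow> smooth_fun_on A W F \<Longrightarrow> smooth_fun_on A W (\<lambda>x. - F x)"
  using smooth_fun_on_mult[OF _ smooth_fun_on_const, of W F "-1"] by simp

lemma smooth_fun_on_prod:
  assumes "open W" "\<And>i. i \<in> I \<Longrightarrow> smooth_fun_on A W (F i)"
  shows "smooth_fun_on A W (\<lambda>x. \<Prod>i\<in>I. F i x)"
  using assms(2)
  by (induction I rule: infinite_finite_induct)
     (auto intro: smooth_fun_on_mult smooth_fun_on_const assms(1))

lemma smooth_fun_on_chart_coordinate:
  assumes "c \<in> A"
  shows "smooth_fun_on A (fst c) (\<lambda>x. snd c x $ i)"
  unfolding smooth_fun_on_def smooth_on_def
proof (intro ballI allI)
  fix d k assume d: "d \<in> A"
  have "Ck_on k (snd d ` (fst d \<inter> fst c)) (\<lambda>u. in_chart d (snd c) u $ i)"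
    by (rule Ck_on_nth[OF open_chart_image[OF d open_chart[OF assms]] smooth_onD[OF transition_smooth[OF d assms]]])
  then show "Ck_on k (snd d ` (fst d \<inter> fst c)) (in_chart d (\<lambda>x. snd c x $ i))"
    by (simp add: in_chart_def comp_def)
qed

lemma smooth_fun_on_imp_continuous_on:
  assumes "open W" "smooth_fun_on A W F"
  shows "continuous_on W F"
proof (rule continuous_at_imp_continuous_on, rule ballI)
  fix x assume x: "x \<in> W"
  obtain c where c: "c \<in> A" "x \<in> fst c" by (rule chart_cover)
  let ?U = "fst c \<inter> W"
  have "continuous_on (snd c ` ?U) (in_chart c F)"
    using smooth_on_imp_continuous[OF smooth_fun_onD[OF assms(2) c(1)]] .
  then have "continuous_on ?U (\<lambda>x. in_chart c F (snd c x))"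
    by (rule continuous_on_compose2) (use continuous_on_subset[OF continuous_on_chart[OF c(1)]] in auto)
  then have "continuous_on ?U F"
    by (rule continuous_on_eq) (use c in \<open>auto simp: in_chart_apply\<close>)
  moreover have "open ?U" using open_chart c assms by blast
  ultimately show "isCont F x" using c x continuous_on_eq_continuous_at by blast
qed

text \<open>A bump in coordinates is continued by 0. Its support lies in the inverse image
  \<open>K\<close> of a closed coordinate ball, which is compact and therefore closed in a Hausdorff
  space; so the chart domain and the complement of \<open>K\<close> form an open cover, and the
  function is smooth on both.\<close>

lemma chart_bump:
  assumes "c \<in> A" "x \<in> fst c" "open V" "x \<in> V"
  obtains \<rho> :: "'m \<Rightarrow> real" and U K where "smooth_fun_on A UNIV \<rho>" "open U" "x \<in> U" "\<forall>y\<in>U. \<rho> y = 1"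
    "closed K" "K \<subseteq> fst c \<inter> V" "U \<subseteq> K" "\<forall>y. y \<notin> K \<longrightarrow> \<rho> y = 0"
proof -
  obtain r where r: "r > 0" "cball (snd c x) r \<subseteq> snd c ` (fst c \<inter> V)"
    by (rule chart_ball[OF assms])
  have r': "cball (snd c x) r \<subseteq> snd c ` fst c" using r by blast
  \<comment> \<open>\<open>smooth_bump\<close> vanishes beyond twice its radius; starting from
    \<open>r / 2\<close> keeps the support inside the ball of radius \<open>r\<close>.\<close>
  have "r / 2 > 0" using r by simp
  from smooth_bump[OF this, of "snd c x"] obtain \<beta> :: "real^2 \<Rightarrow> real" where \<beta>: "smooth_on UNIV \<beta>" "\<And>u. u \<in> cball (snd c x) (r / 2) \<Longrightarrow> \<beta> u = 1"
      "\<And>u. u \<notin> cball (snd c x) (2 * (r / 2)) \<Longrightarrow> \<beta> u = 0"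
    by blast
  define \<rho> where "\<rho> = (\<lambda>y. if y \<in> fst c then \<beta> (snd c y) else 0)"
  define K where "K = inv_into (fst c) (snd c) ` cball (snd c x) r"
  define U where "U = inv_into (fst c) (snd c) ` ball (snd c x) (r / 2)"
  have balls: "ball (snd c x) (r / 2) \<subseteq> cball (snd c x) r" using r(1) by auto
  have memK: "y \<in> K \<longleftrightarrow> y \<in> fst c \<and> snd c y \<in> cball (snd c x) r" for y
    unfolding K_def by (rule mem_inv_image_iff[OF assms(1) r'])
  have memU: "y \<in> U \<longleftrightarrow> y \<in> fst c \<and> snd c y \<in> ball (snd c x) (r / 2)" for y
    unfolding U_def by (rule mem_inv_image_iff[OF assms(1)]) (use balls r' in blast)
  have K: "closed K" unfolding K_def using compact_inv_cball[OF assms(1) r'] by (rule compact_imp_closed)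
  have \<rho>0: "\<rho> y = 0" if "y \<notin> K" for y using that \<beta>(3) memK unfolding \<rho>_def by auto
  have "smooth_fun_on A UNIV \<rho>"
  proof (rule smooth_fun_on_cover)
    fix y :: 'm
    show "\<exists>U. open U \<and> y \<in> U \<and> smooth_fun_on A U \<rho>"
    proof (cases "y \<in> K")
      case True
      then have y: "y \<in> fst c" using memK by simp
      have o: "open (snd c ` fst c)" by (rule open_chart_image'[OF assms(1) open_chart[OF assms(1)] order_refl])
      have "smooth_on (snd c ` fst c) (in_chart c \<rho>)"
        unfolding smooth_on_def
      proof
        fix k
        have "\<beta> u = in_chart c \<rho> u" if "u \<in> snd c ` fst c" for u
          using that assms(1) by (auto simp: in_chart_apply \<rho>_def)
        then show "Ck_on k (snd c ` fst c) (in_chart c \<rho>)"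
          using Ck_on_cong[OF o] Ck_on_subset[OF smooth_onD[OF \<beta>(1)] subset_UNIV] by metis
      qed
      then have "smooth_fun_on A (fst c) \<rho>"
        by (intro smooth_fun_onI_local) (use assms(1) open_chart in blast)
      then show ?thesis using y open_chart assms(1) by blast
    next
      case False
      have "smooth_fun_on A (- K) \<rho>"
        by (rule smooth_fun_on_cong[OF _ _ smooth_fun_on_const[of _ 0]]) (use K \<rho>0 in auto)
      then show ?thesis using False K by blast
    qed
  qed
  moreover have "open U"
    unfolding U_def by (rule open_inv_chart_image[OF assms(1)]) (use balls r' in auto)
  moreover have "x \<in> U" using memU assms(2) r(1) by simp
  moreover have "\<rho> y = 1" if "y \<in> U" for y using that memU \<beta>(2) unfolding \<rho>_def by auto
  moreover have "K \<subseteq> fst c \<inter> V"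
  proof
    fix y assume "y \<in> K"
    then have y: "y \<in> fst c" "snd c y \<in> snd c ` (fst c \<inter> V)" using memK r(2) by auto
    then obtain z where "z \<in> fst c" "z \<in> V" "snd c y = snd c z" by blast
    then show "y \<in> fst c \<inter> V" using y inj_on_chart[OF assms(1)] by (metis IntI inj_onD)
  qed
  moreover have "U \<subseteq> K" using memU memK balls by blast
  ultimately show ?thesis using that K \<rho>0 by blast
qed


subsection \<open>Critical points\<close>

lemma transition_has_derivative:
  assumes "c \<in> A" "d \<in> A" "x \<in> fst c" "x \<in> fst d"
  shows "(in_chart c (snd d) has_derivative (\<lambda>v. transition_jacobian c d x *v v)) (at (snd c x))"
proof -
  have der: "(in_chart c (snd d) has_derivative frechet_derivative (in_chart c (snd d)) (at (snd c x))) (at (snd c x))"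
    by (rule smooth_on_has_derivative[OF transition_smooth[OF assms(1,2)]]) (use assms in blast)
  have "frechet_derivative (in_chart c (snd d)) (at (snd c x)) = (\<lambda>v. transition_jacobian c d x *v v)"
    unfolding transition_jacobian_def jacobian_def matrix_vector_mul(2)[OF has_derivative_linear[OF der]] ..
  with der show ?thesis by simp
qed

lemma transition_jacobian_inverse:
  assumes "c \<in> A" "d \<in> A" "x \<in> fst c" "x \<in> fst d"
  shows "transition_jacobian d c x ** transition_jacobian c d x = mat 1"
proof -
  let ?S = "snd c ` (fst c \<inter> fst d)"
  have S: "open ?S" "snd c x \<in> ?S" using open_chart_image[OF assms(1) open_chart[OF assms(2)]] assms by auto
  have T: "in_chart c (snd d) (snd c x) = snd d x" using assms by (simp add: in_chart_apply)
  have "((\<lambda>u. in_chart d (snd c) (in_chart c (snd d) u)) has_derivative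
     (\<lambda>v. transition_jacobian d c x *v (transition_jacobian c d x *v v))) (at (snd c x))"
    using has_derivative_compose[OF transition_has_derivative[OF assms], of "in_chart d (snd c)"]
      transition_has_derivative[OF assms(2,1,4,3)] unfolding T by blast
  moreover have "in_chart d (snd c) (in_chart c (snd d) u) = u" if "u \<in> ?S" for u
    using that assms by (auto simp: in_chart_apply)
  ultimately have "((\<lambda>u. u) has_derivative
     (\<lambda>v. transition_jacobian d c x *v (transition_jacobian c d x *v v))) (at (snd c x))"
    by (rule has_derivative_transform_within_open[OF _ S])
  then have "(\<lambda>v. v) = (\<lambda>v. transition_jacobian d c x *v (transition_jacobian c d x *v v))"
    by (rule has_derivative_unique[OF has_derivative_ident])
  from fun_cong[OF this] show ?thesis
    by (simp add: matrix_eq matrix_vector_mul_assoc)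
qed

lemma det_transition_jacobian:
  assumes "c \<in> A" "d \<in> A" "x \<in> fst c" "x \<in> fst d"
  shows "det (transition_jacobian c d x) \<noteq> 0"
proof
  assume "det (transition_jacobian c d x) = 0"
  then have "det (transition_jacobian d c x ** transition_jacobian c d x) = 0" by (simp add: det_mul)
  then show False unfolding transition_jacobian_inverse[OF assms] by simp
qed

lemma in_chart_differentiable:
  assumes "smooth_fun_on A W F" "c \<in> A" "x \<in> fst c" "x \<in> W"
  shows "in_chart c F differentiable (at (snd c x))"
  using smooth_fun_on_Ck[OF assms(1,2), of "Suc 0"] assms by auto

lemma chart_gradient_transform:
  assumes "open W" "smooth_fun_on A W F" "x \<in> W" "c \<in> A" "d \<in> A" "x \<in> fst c" "x \<in> fst d"
  shows "chart_gradient c F x = transpose (transition_jacobian c d x) *v chart_gradient d F x"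
proof -
  let ?T = "in_chart c (snd d)"
  have S: "open (snd c ` (fst c \<inter> fst d))" by (rule open_chart_image[OF assms(4) open_chart[OF assms(5)]])
  have T: "?T (snd c x) = snd d x" using assms by (simp add: in_chart_apply)
  have "chart_gradient c F x = euclidean_gradient (\<lambda>u. in_chart d F (?T u)) (snd c x)"
    unfolding chart_gradient_def
    by (rule euclidean_gradient_cong[OF S _ in_chart_change]) (use assms in auto)
  also have "\<dots> = transpose (matrix (\<lambda>v. transition_jacobian c d x *v v)) *v euclidean_gradient (in_chart d F) (?T (snd c x))"
    by (rule gradient_compose(2)[OF transition_has_derivative[OF assms(4,5,6,7)]])
       (use in_chart_differentiable[OF assms(2,5,7,3)] in \<open>simp add: T\<close>)
  finally show ?thesis by (simp add: T chart_gradient_def)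
qed

lemma critical_point_iff:
  assumes "open W" "smooth_fun_on A W F" "x \<in> W" "c \<in> A" "x \<in> fst c"
  shows "critical_point A F x \<longleftrightarrow> chart_gradient c F x = 0"
proof -
  have eq: "critical_point A F x \<longleftrightarrow> (\<forall>d\<in>A. x \<in> fst d \<longrightarrow> chart_gradient d F x = 0)"
    by (simp add: critical_point_def chart_gradient_def euclidean_gradient_def vec_eq_iff)
  have "chart_gradient d F x = 0" if "chart_gradient c F x = 0" "d \<in> A" "x \<in> fst d" for d
    using chart_gradient_transform[OF assms(1-3) that(2) assms(4) that(3) assms(5)] that(1) by simp
  with eq assms show ?thesis by blast
qed

lemma hessian_transform:
  assumes "open W" "smooth_fun_on A W F" "x \<in> W" "c \<in> A" "d \<in> A" "x \<in> fst c" "x \<in> fst d"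
    and crit: "critical_point A F x"
  shows "hessian c F x = transpose (transition_jacobian c d x) ** hessian d F x ** transition_jacobian c d x"
proof -
  let ?T = "in_chart c (snd d)" and ?S = "snd c ` (fst c \<inter> (fst d \<inter> W))" and ?U = "snd d ` (fst d \<inter> W)"
  have S: "open ?S" using open_chart_image[OF assms(4)] open_chart assms by blast
  have U: "open ?U" by (rule open_chart_image[OF assms(5,1)])
  have x: "snd c x \<in> ?S" using assms by blast
  have T: "?T (snd c x) = snd d x" using assms by (simp add: in_chart_apply)
  have TS: "?T ` ?S \<subseteq> ?U" using assms by (auto simp: in_chart_apply)
  have CT: "Ck_on (Suc (Suc 0)) ?S ?T"
    by (rule Ck_on_subset[OF smooth_onD[OF transition_smooth[OF assms(4,5)]]]) blast
  have g0: "euclidean_gradient (in_chart d F) (?T (snd c x)) = 0"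
    using critical_point_iff[OF assms(1-3,5,7)] crit by (simp add: T chart_gradient_def)
  have "hessian c F x = euclidean_hessian (\<lambda>u. in_chart d F (?T u)) (snd c x)"
    unfolding hessian_eq_euclidean
    by (rule euclidean_hessian_cong[OF S x in_chart_change]) (use assms in auto)
  also have "\<dots> = transpose (transition_jacobian c d x) ** euclidean_hessian (in_chart d F) (?T (snd c x)) ** transition_jacobian c d x"
    using hessian_compose[OF S x U TS CT smooth_fun_on_Ck[OF assms(2,5)] g0]
    by (simp add: transition_jacobian_def jacobian_def)
  finally show ?thesis by (simp add: T hessian_eq_euclidean)
qed

text \<open>At a critical point a change of chart multiplies the determinant of the Hessian by the
  square of the nonzero Jacobian determinant.\<close>

lemma nondegenerate_iff:
  assumes "open W" "smooth_fun_on A W F" "x \<in> W" "c \<in> A" "x \<in> fst c" "critical_point A F x"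
  shows "nondegenerate A F x \<longleftrightarrow> det (hessian c F x) \<noteq> 0"
proof -
  have "det (hessian d F x) \<noteq> 0" if "det (hessian c F x) \<noteq> 0" "d \<in> A" "x \<in> fst d" for d
    using hessian_transform[OF assms(1-3) that(2) assms(4) that(3) assms(5,6)] that(1)
      det_transition_jacobian[OF that(2) assms(4) that(3) assms(5)]
    by (simp add: det_mul)
  then show ?thesis using assms unfolding nondegenerate_def by blast
qed

lemma chart_gradient_cong:
  assumes "open U" "x \<in> U" "\<And>y. y \<in> U \<Longrightarrow> F y = G y" "c \<in> A" "x \<in> fst c"
  shows "chart_gradient c F x = chart_gradient c G x" "hessian c F x = hessian c G x"
proof -
  have S: "open (snd c ` (fst c \<inter> U))" "snd c x \<in> snd c ` (fst c \<inter> U)"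
    using open_chart_image assms by auto
  have eq: "in_chart c F u = in_chart c G u" if "u \<in> snd c ` (fst c \<inter> U)" for u
    using that assms by (auto simp: in_chart_apply)
  show "chart_gradient c F x = chart_gradient c G x"
    unfolding chart_gradient_def by (rule euclidean_gradient_cong[OF S eq])
  show "hessian c F x = hessian c G x"
    unfolding hessian_eq_euclidean by (rule euclidean_hessian_cong[OF S eq])
qed

lemma critical_nondegenerate_cong:
  assumes "open U" "x \<in> U" "\<And>y. y \<in> U \<Longrightarrow> F y = G y"
  shows "critical_point A F x \<longleftrightarrow> critical_point A G x" "nondegenerate A F x \<longleftrightarrow> nondegenerate A G x"
proof -
  have "critical_point A H x \<longleftrightarrow> (\<forall>d\<in>A. x \<in> fst d \<longrightarrow> chart_gradient d H x = 0)" for H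
    by (simp add: critical_point_def chart_gradient_def euclidean_gradient_def vec_eq_iff)
  then show "critical_point A F x \<longleftrightarrow> critical_point A G x"
    using chart_gradient_cong(1)[OF assms] by simp
  show "nondegenerate A F x \<longleftrightarrow> nondegenerate A G x"
    unfolding nondegenerate_def by (auto simp: chart_gradient_cong(2)[OF assms])
qed

end

section \<open>Extension of Morse functions to a compact surface\<close>

lemma compact_finite_cover:
  assumes "compact K" "\<And>x. x \<in> K \<Longrightarrow> open (U x) \<and> x \<in> U x"
  shows "\<exists>I\<subseteq>K. finite I \<and> K \<subseteq> (\<Union>x\<in>I. U x)"
proof -
  have "K \<subseteq> (\<Union>x\<in>K. U x)" using assms(2) by blast
  then obtain I where "I \<subseteq> K" "finite I" "K \<subseteq> (\<Union>x\<in>I. U x)"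
    using compactE_image[OF assms(1), of K U] assms(2) by metis
  then show ?thesis by blast
qed

lemma partial_deriv_linear_combination:
  fixes h :: "2 \<Rightarrow> real^2 \<Rightarrow> real"
  assumes "g differentiable (at u)" "\<And>k. h k differentiable (at u)"
  shows "partial_deriv i (\<lambda>u. g u + (\<Sum>k\<in>UNIV. a $ k * h k u)) u =
    partial_deriv i g u + (\<Sum>k\<in>UNIV. a $ k * partial_deriv i (h k) u)"
proof -
  have "((\<lambda>u. g u + (\<Sum>k\<in>UNIV. a $ k * h k u)) has_derivative
    (\<lambda>v. frechet_derivative g (at u) v + (\<Sum>k\<in>UNIV. a $ k * frechet_derivative (h k) (at u) v))) (at u)"
    by (intro has_derivative_add has_derivative_sum has_derivative_mult_right)
       (use assms frechet_derivative_works in blast)+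
  from frechet_derivative_eqI[OF this] show ?thesis
    by (simp add: partial_deriv_def)
qed

lemma hessian_linear_combination:
  fixes h :: "2 \<Rightarrow> real^2 \<Rightarrow> real"
  assumes "open S" "u \<in> S" "Ck_on (Suc (Suc 0)) S g" "\<And>k. Ck_on (Suc (Suc 0)) S (h k)"
  shows "euclidean_hessian (\<lambda>u. g u + (\<Sum>k\<in>UNIV. a $ k * h k u)) u $ i $ j =
    euclidean_hessian g u $ i $ j + (\<Sum>k\<in>UNIV. a $ k * euclidean_hessian (h k) u $ i $ j)"
proof -
  let ?F = "\<lambda>u. g u + (\<Sum>k\<in>UNIV. a $ k * h k u)"
  have d: "g differentiable (at x)" "h k differentiable (at x)" if "x \<in> S" for x k
    using assms(3) assms(4)[of k] that by auto
  have d2: "partial_deriv j g differentiable (at u)" "partial_deriv j (h k) differentiable (at u)" for k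
    using assms(2,3) assms(4)[of k] by (auto simp: partial_deriv_def[abs_def])
  have "euclidean_gradient (partial_deriv j ?F) u =
      euclidean_gradient (\<lambda>x. partial_deriv j g x + (\<Sum>k\<in>UNIV. a $ k * partial_deriv j (h k) x)) u"
    by (rule euclidean_gradient_cong[OF assms(1,2) partial_deriv_linear_combination]) (use d in auto)
  then have "partial_deriv i (partial_deriv j ?F) u =
      partial_deriv i (\<lambda>x. partial_deriv j g x + (\<Sum>k\<in>UNIV. a $ k * partial_deriv j (h k) x)) u"
    by (simp add: euclidean_gradient_def vec_eq_iff)
  also have "\<dots> = partial_deriv i (partial_deriv j g) u + (\<Sum>k\<in>UNIV. a $ k * partial_deriv i (partial_deriv j (h k)) u)"
    by (rule partial_deriv_linear_combination) (use d2 in auto)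
  finally show ?thesis by (simp add: euclidean_hessian_def)
qed

text \<open>The derivative of the gradient map is the Hessian, so these are exactly the critical
  values of the gradient map.\<close>

lemma degenerate_critical_values_negligible:
  fixes g :: "real^2 \<Rightarrow> real"
  assumes "open S" "Ck_on (Suc (Suc 0)) S g"
  shows "negligible (euclidean_gradient g ` {u \<in> S. det (euclidean_hessian g u) = 0})"
proof (rule baby_Sard)
  fix u assume "u \<in> {u \<in> S. det (euclidean_hessian g u) = 0}"
  then have u: "u \<in> S" "det (euclidean_hessian g u) = 0" by auto
  show "(euclidean_gradient g has_derivative (\<lambda>v. euclidean_hessian g u *v v))
      (at u within {u \<in> S. det (euclidean_hessian g u) = 0})"
    using gradient_has_derivative[OF assms(1) u(1) assms(2)] by (rule has_derivative_at_withinI)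
  show "rank (matrix (\<lambda>v. euclidean_hessian g u *v v)) < CARD(2)"
    using u(2) unfolding matrix_of_matrix_vector_mul by (simp only: det_eq_0_rank)
qed simp

locale compact_manifold = smooth_manifold A for A :: "('m::t2_space) chart set" +
  assumes compact_UNIV: "compact (UNIV :: 'm set)"
begin

definition morse_at :: "('m \<Rightarrow> real) \<Rightarrow> 'm \<Rightarrow> bool"
  where "morse_at F x \<longleftrightarrow> (critical_point A F x \<longrightarrow> nondegenerate A F x)"

text \<open>The functions \<open>H k\<close> will be the two coordinates of a chart multiplied by a
  cutoff, so that near a given point \<open>a\<close> is added to the gradient.\<close>

definition perturbation :: "('m \<Rightarrow> real) \<Rightarrow> (2 \<Rightarrow> 'm \<Rightarrow> real) \<Rightarrow> real^2 \<Rightarrow> 'm \<Rightarrow> real"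
  where "perturbation G H a x = G x + (\<Sum>k\<in>UNIV. a $ k * H k x)"

lemma morse_at_cong:
  "open U \<Longrightarrow> x \<in> U \<Longrightarrow> (\<And>y. y \<in> U \<Longrightarrow> F y = G y) \<Longrightarrow> morse_at F x \<longleftrightarrow> morse_at G x"
  unfolding morse_at_def using critical_nondegenerate_cong by blast

lemma morse_at_iff:
  assumes "smooth_fun_on A UNIV F" "c \<in> A" "x \<in> fst c"
  shows "morse_at F x \<longleftrightarrow> \<not> (chart_gradient c F x = 0 \<and> det (hessian c F x) = 0)"
  using critical_point_iff[OF open_UNIV assms(1) UNIV_I assms(2,3)]
    nondegenerate_iff[OF open_UNIV assms(1) UNIV_I assms(2,3)]
  unfolding morse_at_def by blast

lemma smooth_perturbation:
  assumes "smooth_fun_on A UNIV G" "\<And>k. smooth_fun_on A UNIV (H k)"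
  shows "smooth_fun_on A UNIV (perturbation G H a)"
proof -
  have "smooth_fun_on A UNIV (\<lambda>x. a $ k * H k x)" for k
    by (rule smooth_fun_on_mult[OF open_UNIV smooth_fun_on_const assms(2)])
  note * = this
  have "smooth_fun_on A UNIV (\<lambda>x. G x + (a $ 1 * H 1 x + a $ 2 * H 2 x))"
    by (rule smooth_fun_on_add[OF open_UNIV assms(1) smooth_fun_on_add[OF open_UNIV * *]])
  then show ?thesis by (simp add: perturbation_def[abs_def] sum_2)
qed

lemma in_chart_perturbation:
  "in_chart c (perturbation G H a) = (\<lambda>u. in_chart c G u + (\<Sum>k\<in>UNIV. a $ k * in_chart c (H k) u))"
  by (simp add: perturbation_def in_chart_def fun_eq_iff)

text \<open>In a chart, failure of the Morse condition says that the pair of gradient and Hessian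
  determinant is zero. This pair is continuous jointly in the parameter \<open>a\<close> and the
  point, so being nonzero at \<open>(0, x)\<close> persists on a product neighbourhood.\<close>

lemma morse_at_perturbation_stable:
  assumes G: "smooth_fun_on A UNIV G" and H: "\<And>k. smooth_fun_on A UNIV (H k)"
    and x: "morse_at G x"
  obtains V d where "open V" "x \<in> V" "d > 0" "\<forall>a y. norm a < d \<longrightarrow> y \<in> V \<longrightarrow> morse_at (perturbation G H a) y"
proof -
  obtain c where c: "c \<in> A" "x \<in> fst c" by (rule chart_cover)
  let ?S = "snd c ` fst c" and ?g = "in_chart c G" and ?h = "\<lambda>k. in_chart c (H k)"
  have S: "open ?S" by (rule open_chart_image'[OF c(1) open_chart[OF c(1)] order_refl])
  have g: "Ck_on (Suc (Suc 0)) ?S ?g" using smooth_fun_on_Ck[OF G c(1)] by simp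
  have h: "Ck_on (Suc (Suc 0)) ?S (?h k)" for k using smooth_fun_on_Ck[OF H c(1)] by simp
  \<comment> \<open>\<open>P\<close>, \<open>Q\<close> and \<open>D\<close> are the gradient, the
    entries of the Hessian and its determinant for the perturbed function, as functions of the pair
    of parameter and coordinate point.\<close>
  define P where "P = (\<lambda>z::(real^2)\<times>(real^2). \<chi> i. partial_deriv i ?g (snd z) + (\<Sum>k\<in>UNIV. fst z $ k * partial_deriv i (?h k) (snd z)))"
  define Q where "Q = (\<lambda>(z::(real^2)\<times>(real^2)) i j. euclidean_hessian ?g (snd z) $ i $ j + (\<Sum>k\<in>UNIV. fst z $ k * euclidean_hessian (?h k) (snd z) $ i $ j))"
  define D where "D = (\<lambda>z. Q z 1 1 * Q z 2 2 - Q z 1 2 * Q z 2 1)"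
  have cp: "continuous_on (UNIV \<times> ?S) (\<lambda>z. partial_deriv i f (snd z))" if "Ck_on (Suc (Suc 0)) ?S f" for i f
    using Ck_on_imp_continuous[OF Ck_on_derivative[OF that]]
    unfolding partial_deriv_def
    by (intro continuous_on_compose2[OF _ continuous_on_snd[OF continuous_on_id], of ?S]) auto
  have ch: "continuous_on (UNIV \<times> ?S) (\<lambda>z. euclidean_hessian f (snd z) $ i $ j)" if "Ck_on (Suc (Suc 0)) ?S f" for i j f
    using Ck_on_imp_continuous[OF Ck_on_hessian_nth[OF that]]
    by (intro continuous_on_compose2[OF _ continuous_on_snd[OF continuous_on_id], of ?S]) auto
  have cP: "continuous_on (UNIV \<times> ?S) P"
    unfolding P_def by (intro continuous_on_vec_lambda continuous_intros cp[OF g] cp[OF h])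
  have cQ: "continuous_on (UNIV \<times> ?S) (\<lambda>z. Q z i j)" for i j
    unfolding Q_def by (intro continuous_intros ch[OF g] ch[OF h])
  have "continuous_on (UNIV \<times> ?S) (\<lambda>z. (P z, D z))"
    unfolding D_def by (intro continuous_intros cP cQ)
  then have O: "open ((UNIV \<times> ?S) \<inter> (\<lambda>z. (P z, D z)) -` (- {0}))"
    by (rule continuous_open_preimage) (use S in \<open>auto intro: open_Times\<close>)
  have iff: "morse_at (perturbation G H a) y \<longleftrightarrow> (P (a, snd c y), D (a, snd c y)) \<noteq> 0" if y: "y \<in> fst c" for a y
  proof -
    have u: "snd c y \<in> ?S" using y by blast
    have d: "?g differentiable (at (snd c y))" "?h k differentiable (at (snd c y))" for k
      using g h[of k] u by auto
    have "chart_gradient c (perturbation G H a) y = P (a, snd c y)"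
      unfolding chart_gradient_def in_chart_perturbation euclidean_gradient_def P_def
      using partial_deriv_linear_combination[OF d] by simp
    moreover have "det (hessian c (perturbation G H a) y) = D (a, snd c y)"
      unfolding hessian_eq_euclidean in_chart_perturbation det_2 D_def Q_def
      using hessian_linear_combination[OF S u g h] by simp
    ultimately show ?thesis
      using morse_at_iff[OF smooth_perturbation[where H=H, OF G H] c(1) y] by (simp add: zero_prod_def)
  qed
  have "perturbation G H 0 = G" by (simp add: perturbation_def fun_eq_iff)
  then have in0: "(0, snd c x) \<in> (UNIV \<times> ?S) \<inter> (\<lambda>z. (P z, D z)) -` (- {0})"
    using iff[OF c(2), of 0] x c by auto
  obtain B V where BV: "open B" "open V" "(0, snd c x) \<in> B \<times> V"
      "B \<times> V \<subseteq> (UNIV \<times> ?S) \<inter> (\<lambda>z. (P z, D z)) -` (- {0})"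
    by (rule open_prod_elim[OF O in0])
  obtain d where d: "d > 0" "ball 0 d \<subseteq> B" using openE[OF BV(1), of 0] BV(3) by blast
  have VS: "V \<subseteq> ?S" using BV by blast
  show ?thesis
  proof (rule that[of "inv_into (fst c) (snd c) ` V" d])
    show "open (inv_into (fst c) (snd c) ` V)" by (rule open_inv_chart_image[OF c(1) BV(2) VS])
    show "x \<in> inv_into (fst c) (snd c) ` V" unfolding mem_inv_image_iff[OF c(1) VS] using c BV by blast
    show "\<forall>a y. norm a < d \<longrightarrow> y \<in> inv_into (fst c) (snd c) ` V \<longrightarrow> morse_at (perturbation G H a) y"
    proof (intro allI impI)
      fix a :: "real^2" and y assume that: "norm a < d" "y \<in> inv_into (fst c) (snd c) ` V"
      have "y \<in> fst c" "snd c y \<in> V" using that(2) unfolding mem_inv_image_iff[OF c(1) VS] by auto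
      moreover have "a \<in> B" using that(1) d(2) by auto
      ultimately show "morse_at (perturbation G H a) y" using iff BV(4) by blast
    qed
  qed (rule d)
qed

lemma morse_perturbation_stable:
  assumes G: "smooth_fun_on A UNIV G" and H: "\<And>k. smooth_fun_on A UNIV (H k)"
    and K: "compact K" "\<And>x. x \<in> K \<Longrightarrow> morse_at G x"
  obtains d where "d > 0" "\<forall>a y. norm a < d \<longrightarrow> y \<in> K \<longrightarrow> morse_at (perturbation G H a) y"
proof -
  define good where "good = (\<lambda>V d. open V \<and> d > (0::real) \<and> (\<forall>a y. norm a < d \<longrightarrow> y \<in> V \<longrightarrow> morse_at (perturbation G H a) y))"
  have "\<exists>V d. x \<in> V \<and> good V d" if "x \<in> K" for x
    unfolding good_def by (rule morse_at_perturbation_stable[where H=H, OF G H K(2)[OF that]]) blast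
  then obtain V d where V: "\<And>x. x \<in> K \<Longrightarrow> x \<in> V x \<and> good (V x) (d x)" by metis
  have "\<exists>I\<subseteq>K. finite I \<and> K \<subseteq> (\<Union>x\<in>I. V x)"
    by (rule compact_finite_cover[OF K(1)]) (use V in \<open>auto simp: good_def\<close>)
  then obtain I where I: "I \<subseteq> K" "finite I" "K \<subseteq> (\<Union>x\<in>I. V x)" by blast
  \<comment> \<open>The extra 1 keeps the set nonempty when \<open>K\<close>, and with it
    \<open>I\<close>, is empty.\<close>
  define e where "e = Min (insert 1 (d ` I))"
  have "e > 0" unfolding e_def using I V by (auto simp: good_def)
  moreover have "morse_at (perturbation G H a) y" if ay: "norm a < e" "y \<in> K" for a y
  proof -
    obtain x where x: "x \<in> I" "y \<in> V x" using I ay(2) by blast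
    have "e \<le> d x" unfolding e_def using x I by simp
    then have "norm a < d x" using ay(1) by simp
    then show ?thesis using V[of x] x I ay unfolding good_def by blast
  qed
  ultimately show ?thesis using that by blast
qed

lemma compact_neighbourhood:
  assumes "open U" "x \<in> (U :: 'm set)"
  obtains V C where "open V" "x \<in> V" "V \<subseteq> C" "compact C" "C \<subseteq> U"
proof -
  obtain c where c: "c \<in> A" "x \<in> fst c" by (rule chart_cover)
  obtain r where r: "r > 0" "cball (snd c x) r \<subseteq> snd c ` (fst c \<inter> U)"
    by (rule chart_ball[OF c assms])
  then have r': "cball (snd c x) r \<subseteq> snd c ` fst c" "ball (snd c x) r \<subseteq> snd c ` fst c"
    using ball_subset_cball by blast+
  let ?i = "inv_into (fst c) (snd c)"
  show ?thesis
  proof (rule that[of "?i ` ball (snd c x) r" "?i ` cball (snd c x) r"])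
    show "open (?i ` ball (snd c x) r)" by (rule open_inv_chart_image[OF c(1) open_ball r'(2)])
    show "x \<in> ?i ` ball (snd c x) r" unfolding mem_inv_image_iff[OF c(1) r'(2)] using c r by simp
    show "compact (?i ` cball (snd c x) r)" by (rule compact_inv_cball[OF c(1) r'(1)])
    show "?i ` cball (snd c x) r \<subseteq> U"
    proof
      fix y assume "y \<in> ?i ` cball (snd c x) r"
      then have "y \<in> fst c" "snd c y \<in> snd c ` (fst c \<inter> U)"
        using r(2) unfolding mem_inv_image_iff[OF c(1) r'(1)] by auto
      then show "y \<in> U" using inj_on_chart[OF c(1)] by (auto dest: inj_onD)
    qed
  qed auto
qed

text \<open>Quantifying over all \<open>G\<close> and \<open>K\<close> lets the steps be chained:
  what has been achieved so far is passed on as \<open>K\<close>, and \<open>C\<close> is added to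
  it while the values on \<open>M\<close> stay fixed.\<close>

definition perturbable_to_morse :: "'m set \<Rightarrow> 'm set \<Rightarrow> bool"
  where "perturbable_to_morse M C \<longleftrightarrow>
    (\<forall>G K. smooth_fun_on A UNIV G \<longrightarrow> compact K \<longrightarrow> (\<forall>y\<in>K. morse_at G y) \<longrightarrow>
      (\<exists>G'. smooth_fun_on A UNIV G' \<and> (\<forall>y\<in>M. G' y = G y) \<and> (\<forall>y\<in>K \<union> C. morse_at G' y)))"

text \<open>In the chart where the cutoff is 1, adding the linear function \<open>a \<bullet> u\<close> shifts the
  gradient by \<open>a\<close> and keeps the Hessian, so by Sard almost every small \<open>a\<close> works.\<close>

lemma morse_perturbation_step:
  assumes "closed M" "x \<notin> M"
  obtains V C where "open V" "x \<in> V" "V \<subseteq> C" "compact C"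
    "perturbable_to_morse M C"
proof -
  obtain c where c: "c \<in> A" "x \<in> fst c" by (rule chart_cover)
  have "open (- M)" "x \<in> - M" using assms by auto
  then obtain \<rho> U L where \<rho>: "smooth_fun_on A UNIV \<rho>" "open U" "x \<in> U" "\<forall>y\<in>U. \<rho> y = 1"
      "closed L" "L \<subseteq> fst c \<inter> - M" "U \<subseteq> L" "\<forall>y. y \<notin> L \<longrightarrow> \<rho> y = 0"
    by (rule chart_bump[OF c])
  obtain V C where VC: "open V" "x \<in> V" "V \<subseteq> C" "compact C" "C \<subseteq> U"
    by (rule compact_neighbourhood[OF \<rho>(2,3)])
  \<comment> \<open>Outside the chart domain \<open>snd c y\<close> is an arbitrary value, but there
    the cutoff \<open>\<rho>\<close> vanishes.\<close>
  define H where "H = (\<lambda>(k::2) y. \<rho> y * snd c y $ k)"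
  have "smooth_fun_on A UNIV (H k)" for k
  proof (rule smooth_fun_on_cover)
    fix y :: 'm
    show "\<exists>W. open W \<and> y \<in> W \<and> smooth_fun_on A W (H k)"
    proof (cases "y \<in> L")
      case True
      have "smooth_fun_on A (fst c) (H k)" unfolding H_def
        by (rule smooth_fun_on_mult[OF open_chart[OF c(1)] smooth_fun_on_subset[OF \<rho>(1) subset_UNIV]
              smooth_fun_on_chart_coordinate[OF c(1)]])
      then show ?thesis using True \<rho>(6) open_chart[OF c(1)] by blast
    next
      case False
      have "smooth_fun_on A (- L) (H k)"
        by (rule smooth_fun_on_cong[OF _ _ smooth_fun_on_const[of _ 0]]) (use \<rho> in \<open>auto simp: H_def\<close>)
      then show ?thesis using False \<rho>(5) by blast
    qed
  qed
  note H = this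
  show ?thesis
  proof (rule that[OF VC(1-4)], unfold perturbable_to_morse_def, intro allI impI)
    fix G :: "'m \<Rightarrow> real" and K :: "'m set"
    assume G: "smooth_fun_on A UNIV G" and K: "compact K" and "\<forall>y\<in>K. morse_at G y"
    then have K: "compact K" "\<And>y. y \<in> K \<Longrightarrow> morse_at G y" by auto
    obtain d where d: "d > 0" "\<forall>a y. norm a < d \<longrightarrow> y \<in> K \<longrightarrow> morse_at (perturbation G H a) y"
      by (rule morse_perturbation_stable[where H=H, OF G H K])
    let ?g = "in_chart c G" and ?S = "snd c ` U"
    have Uc: "U \<subseteq> fst c" using \<rho> by blast
    have S: "open ?S" by (rule open_chart_image'[OF c(1) \<rho>(2) Uc])
    have g: "Ck_on (Suc (Suc 0)) ?S ?g"
      by (rule Ck_on_subset[OF smooth_fun_on_Ck[OF G c(1)]]) (use Uc in auto)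
    let ?N = "euclidean_gradient ?g ` {u \<in> ?S. det (euclidean_hessian ?g u) = 0}"
    have "negligible ?N" by (rule degenerate_critical_values_negligible[OF S g])
    moreover have "\<not> negligible (ball (0::real^2) d)"
      using d(1) by (intro open_not_negligible) auto
    ultimately have "\<not> ball 0 d \<subseteq> ?N" using negligible_subset by blast
    then obtain b where b: "b \<in> ball 0 d" "b \<notin> ?N" by blast
    \<comment> \<open>On \<open>U\<close> the perturbed gradient is the old one minus
      \<open>b\<close>, so a critical point there has old gradient \<open>b\<close>. As
      \<open>b\<close> is not in \<open>?N\<close>, the Hessian at such a point is nonsingular; as
      \<open>norm b < d\<close>, nothing is lost on \<open>K\<close>.\<close>
    define a where "a = - b"
    let ?F = "perturbation G H a"
    have F: "smooth_fun_on A UNIV ?F" by (rule smooth_perturbation[where H=H, OF G H])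
    have "?F y = G y" if "y \<in> M" for y
    proof -
      have "\<rho> y = 0" using \<rho>(6,8) that by blast
      then show ?thesis by (simp add: perturbation_def H_def)
    qed
    moreover have "morse_at ?F y" if "y \<in> K \<union> C" for y
    proof (cases "y \<in> K")
      case True
      then show ?thesis using d(2) b by (simp add: a_def)
    next
      case False
      then have y: "y \<in> U" "y \<in> fst c" using that VC Uc by auto
      then have u: "snd c y \<in> ?S" by blast
      have lin: "Ck_on (Suc (Suc 0)) ?S (\<lambda>u. u $ k)" for k :: 2
        by (rule Ck_on_linear[OF S bounded_linear_vec_nth])
      have pl: "partial_deriv i (\<lambda>u. u $ k) = (\<lambda>u. axis i 1 $ k)" for i k :: 2
        unfolding partial_deriv_def
        by (simp add: frechet_derivative_eqI[OF bounded_linear_imp_has_derivative[OF bounded_linear_vec_nth]])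
      have hl: "euclidean_hessian (\<lambda>u. u $ k) v $ i $ j = 0" for v i j and k :: 2
        unfolding euclidean_hessian_def pl by (simp add: partial_deriv_def)
      have gd: "?g differentiable (at (snd c y))" using g u by auto
      have ld: "(\<lambda>u. u $ k) differentiable (at (snd c y))" for k :: 2
        using lin[of k] u by auto
      have eq: "in_chart c ?F v = ?g v + (\<Sum>k\<in>UNIV. a $ k * v $ k)" if "v \<in> ?S" for v
        using that Uc \<rho>(4) c(1) by (auto simp: in_chart_apply perturbation_def H_def subset_iff)
      have "chart_gradient c ?F y = euclidean_gradient (\<lambda>v. ?g v + (\<Sum>k\<in>UNIV. a $ k * v $ k)) (snd c y)"
        unfolding chart_gradient_def by (rule euclidean_gradient_cong[OF S u eq])
      also have "\<dots> = euclidean_gradient ?g (snd c y) + a"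
        unfolding euclidean_gradient_def
        using partial_deriv_linear_combination[OF gd ld] by (simp add: vec_eq_iff pl axis_def if_distrib cong: if_cong)
      finally have 1: "chart_gradient c ?F y = euclidean_gradient ?g (snd c y) - b" by (simp add: a_def)
      have "hessian c ?F y = euclidean_hessian (\<lambda>v. ?g v + (\<Sum>k\<in>UNIV. a $ k * v $ k)) (snd c y)"
        unfolding hessian_eq_euclidean by (rule euclidean_hessian_cong[OF S u eq])
      also have "\<dots> = euclidean_hessian ?g (snd c y)"
        using hessian_linear_combination[OF S u g lin] by (simp add: vec_eq_iff hl)
      finally have 2: "hessian c ?F y = euclidean_hessian ?g (snd c y)" .
      show ?thesis unfolding morse_at_iff[OF F c(1) y(2)] 1 2
        using b(2) u by (auto simp: image_iff)
    qed
    ultimately show "\<exists>G'. smooth_fun_on A UNIV G' \<and> (\<forall>y\<in>M. G' y = G y) \<and> (\<forall>y\<in>K \<union> C. morse_at G' y)"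
      using F by blast
  qed
qed

text \<open>Agreement on a whole neighbourhood \<open>V\<close> of \<open>M\<close>, not just on
  \<open>M\<close>, carries derivatives over, and with them the Morse condition.\<close>

lemma smooth_extension:
  assumes "open W" "compact M" "M \<subseteq> W" "smooth_fun_on A W F"
  obtains G V where "smooth_fun_on A UNIV G" "open V" "M \<subseteq> V" "V \<subseteq> W" "\<forall>y\<in>V. G y = F y"
proof -
  define good where "good = (\<lambda>(\<rho> :: 'm \<Rightarrow> real) U L. smooth_fun_on A UNIV \<rho> \<and> open U \<and> (\<forall>y\<in>U. \<rho> y = 1) \<and>
      closed L \<and> L \<subseteq> W \<and> U \<subseteq> L \<and> (\<forall>y. y \<notin> L \<longrightarrow> \<rho> y = 0))"
  have "\<exists>\<rho> U L. x \<in> U \<and> good \<rho> U L" if x: "x \<in> M" for x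
  proof -
    obtain c where c: "c \<in> A" "x \<in> fst c" by (rule chart_cover)
    have "x \<in> W" using assms x by blast
    show ?thesis unfolding good_def by (rule chart_bump[OF c assms(1) \<open>x \<in> W\<close>]) blast
  qed
  then obtain \<rho> U L where good: "\<And>x. x \<in> M \<Longrightarrow> x \<in> U x \<and> good (\<rho> x) (U x) (L x)" by metis
  have "\<exists>I\<subseteq>M. finite I \<and> M \<subseteq> (\<Union>x\<in>I. U x)"
    by (rule compact_finite_cover[OF assms(2)]) (use good in \<open>auto simp: good_def\<close>)
  then obtain I where I: "I \<subseteq> M" "finite I" "M \<subseteq> (\<Union>x\<in>I. U x)" by blast
  \<comment> \<open>\<open>1 - \<Prod>(1 - \<rho>)\<close> is 1 as soon as one of the cutoffs is 1,
    and 0 where all of them vanish.\<close>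
  define \<sigma> where "\<sigma> = (\<lambda>y. 1 + (-1) * (\<Prod>x\<in>I. 1 + (-1) * \<rho> x y))"
  define V where "V = (\<Union>x\<in>I. U x)"
  define K where "K = (\<Union>x\<in>I. L x)"
  have "smooth_fun_on A UNIV (\<lambda>y. 1 + (-1) * \<rho> i y)" if "i \<in> I" for i
  proof -
    have "smooth_fun_on A UNIV (\<rho> i)" using good[of i] that I unfolding good_def by blast
    then have "smooth_fun_on A UNIV (\<lambda>y. (-1) * \<rho> i y)"
      by (rule smooth_fun_on_mult[OF open_UNIV smooth_fun_on_const])
    then show ?thesis by (rule smooth_fun_on_add[OF open_UNIV smooth_fun_on_const])
  qed
  then have "smooth_fun_on A UNIV (\<lambda>y. \<Prod>x\<in>I. 1 + (-1) * \<rho> x y)"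
    by (rule smooth_fun_on_prod[OF open_UNIV])
  then have "smooth_fun_on A UNIV (\<lambda>y. (-1) * (\<Prod>x\<in>I. 1 + (-1) * \<rho> x y))"
    by (rule smooth_fun_on_mult[OF open_UNIV smooth_fun_on_const])
  then have \<sigma>: "smooth_fun_on A UNIV \<sigma>"
    unfolding \<sigma>_def by (rule smooth_fun_on_add[OF open_UNIV smooth_fun_on_const])
  have V: "open V" "M \<subseteq> V" "V \<subseteq> W" "V \<subseteq> K" and K: "closed K" "K \<subseteq> W"
    using I good unfolding V_def K_def good_def by (blast intro: closed_UN)+
  have \<sigma>1: "\<sigma> y = 1" if y: "y \<in> V" for y
  proof -
    obtain x where x: "x \<in> I" "y \<in> U x" using y unfolding V_def by blast
    then have "\<rho> x y = 1" using good[of x] I unfolding good_def by blast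
    then have "(\<Prod>x\<in>I. 1 + (-1) * \<rho> x y) = 0" using x I(2) by (intro prod_zero) auto
    then show ?thesis by (simp add: \<sigma>_def)
  qed
  have \<sigma>0: "\<sigma> y = 0" if y: "y \<notin> K" for y
  proof -
    have "\<rho> x y = 0" if "x \<in> I" for x
      using that y good[of x] I unfolding K_def good_def by blast
    then show ?thesis by (simp add: \<sigma>_def)
  qed
  define G where "G = (\<lambda>y. if y \<in> W then \<sigma> y * F y else 0)"
  have "smooth_fun_on A UNIV G"
  proof (rule smooth_fun_on_cover)
    fix y :: 'm
    show "\<exists>O1. open O1 \<and> y \<in> O1 \<and> smooth_fun_on A O1 G"
    proof (cases "y \<in> K")
      case True
      have "smooth_fun_on A W G"
        by (rule smooth_fun_on_cong[OF assms(1) _ smooth_fun_on_mult[OF assms(1) smooth_fun_on_subset[OF \<sigma> subset_UNIV] assms(4)]])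
           (simp add: G_def)
      then show ?thesis using True K assms(1) by blast
    next
      case False
      have "smooth_fun_on A (- K) G"
        by (rule smooth_fun_on_cong[OF _ _ smooth_fun_on_const[of _ 0]]) (use K \<sigma>0 in \<open>auto simp: G_def\<close>)
      then show ?thesis using False K(1) by blast
    qed
  qed
  moreover have "G y = F y" if "y \<in> V" for y
    using that V \<sigma>1 by (auto simp: G_def)
  ultimately show ?thesis using that V by blast
qed

text \<open>A smooth extension is already Morse on the open set \<open>V\<close> around
  \<open>M\<close>. The rest of the surface is compact and is repaired by finitely many
  perturbations, each supported away from \<open>M\<close> and too small to destroy the Morse
  condition where it already holds.\<close>

lemma morse_extension_exists:
  assumes "open W" "compact M" "M \<subseteq> W" "morse_on A W F"
  shows "\<exists>G. morse_on A UNIV G \<and> (\<forall>x\<in>M. G x = F x)"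
proof -
  have F: "smooth_fun_on A W F" "\<And>x. x \<in> W \<Longrightarrow> morse_at F x"
    using assms(4) unfolding morse_on_def morse_at_def by auto
  obtain G V where G: "smooth_fun_on A UNIV G" and V: "open V" "M \<subseteq> V" "V \<subseteq> W" and "\<forall>y\<in>V. G y = F y"
    by (rule smooth_extension[OF assms(1-3) F(1)])
  then have GF: "\<And>y. y \<in> V \<Longrightarrow> G y = F y" by blast
  have GV: "morse_at G y" if "y \<in> V" for y
  proof -
    have "morse_at G y \<longleftrightarrow> morse_at F y" by (rule morse_at_cong[OF V(1) that GF])
    then show ?thesis using F(2) V that by auto
  qed
  have "\<exists>U C. open U \<and> x \<in> U \<and> U \<subseteq> C \<and> compact C \<and> perturbable_to_morse M C" if "x \<in> - V" for x
  proof -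
    have "x \<notin> M" using that V by blast
    show ?thesis
      by (rule morse_perturbation_step[OF compact_imp_closed[OF assms(2)] \<open>x \<notin> M\<close>]) blast
  qed
  then obtain U C where UC: "\<And>x. x \<in> - V \<Longrightarrow> open (U x) \<and> x \<in> U x \<and> U x \<subseteq> C x \<and> compact (C x) \<and> perturbable_to_morse M (C x)"
    by metis
  have "compact (- V)" using compact_Int_closed[OF compact_UNIV closed_Compl[OF V(1)]] by simp
  then have "\<exists>I\<subseteq>- V. finite I \<and> - V \<subseteq> (\<Union>x\<in>I. U x)"
    by (rule compact_finite_cover) (use UC in auto)
  then obtain I where I: "I \<subseteq> - V" "finite I" "- V \<subseteq> (\<Union>x\<in>I. U x)" by blast
  \<comment> \<open>The stability argument wants a compact set. What the sets \<open>U x\<close>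
    leave uncovered is compact and lies in \<open>V\<close>; together with the sets
    \<open>C x\<close> it exhausts the surface.\<close>
  define K where "K = - (\<Union>x\<in>I. U x)"
  have "closed K" unfolding K_def using UC I by (intro closed_Compl open_UN) blast
  then have K: "compact K" using compact_Int_closed[OF compact_UNIV, of K] by simp
  have KV: "K \<subseteq> V" using I(3) unfolding K_def by blast
  have "J \<subseteq> - V \<Longrightarrow> \<exists>G'. smooth_fun_on A UNIV G' \<and> (\<forall>y\<in>M. G' y = F y) \<and> (\<forall>y\<in>K \<union> (\<Union>x\<in>J. C x). morse_at G' y)"
    if "finite J" for J
    using that
  proof (induction J)
    case empty
    show ?case using G GF GV V KV by (intro exI[of _ G]) auto
  next
    case (insert z J)
    then obtain G1 where G1: "smooth_fun_on A UNIV G1" "\<forall>y\<in>M. G1 y = F y" "\<forall>y\<in>K \<union> (\<Union>x\<in>J. C x). morse_at G1 y"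
      by blast
    have "compact (K \<union> (\<Union>x\<in>J. C x))"
      using K insert.hyps insert.prems UC by (intro compact_Un compact_UN) auto
    moreover have "perturbable_to_morse M (C z)" using UC insert.prems by blast
    ultimately obtain G2 where "smooth_fun_on A UNIV G2" "\<forall>y\<in>M. G2 y = G1 y" "\<forall>y\<in>(K \<union> (\<Union>x\<in>J. C x)) \<union> C z. morse_at G2 y"
      using G1 unfolding perturbable_to_morse_def by metis
    then show ?case using G1 by (intro exI[of _ G2]) auto
  qed
  from this[OF I(2,1)] obtain G' where G': "smooth_fun_on A UNIV G'" "\<forall>y\<in>M. G' y = F y"
      "\<forall>y\<in>K \<union> (\<Union>x\<in>I. C x). morse_at G' y" by blast
  have "K \<union> (\<Union>x\<in>I. C x) = UNIV" unfolding K_def using UC I(1) by blast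
  then show ?thesis using G' unfolding morse_on_def morse_at_def by (intro exI[of _ G']) auto
qed

end

section \<open>Ordinary differential equations\<close>

lemma integral_lipschitz_diff:
  fixes w :: "'a::euclidean_space \<Rightarrow> 'a"
  assumes "L-lipschitz_on UNIV w" "continuous_on UNIV x" "continuous_on UNIV y"
    and "\<And>s. dist (x s) (y s) \<le> d" and "a \<le> (t::real)"
  shows "norm (integral {a..t} (\<lambda>s. w (x s)) - integral {a..t} (\<lambda>s. w (y s))) \<le> L * d * (t - a)"
proof -
  have cw: "continuous_on UNIV w" using assms(1) lipschitz_on_continuous_on by blast
  have c: "continuous_on {a..t} (\<lambda>s. w (x s))" "continuous_on {a..t} (\<lambda>s. w (y s))"
    using continuous_on_compose2[OF cw continuous_on_subset[OF assms(2) subset_UNIV]]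
      continuous_on_compose2[OF cw continuous_on_subset[OF assms(3) subset_UNIV]] by auto
  have L: "L \<ge> 0" using assms(1) lipschitz_on_nonneg by blast
  have "integral {a..t} (\<lambda>s. w (x s)) - integral {a..t} (\<lambda>s. w (y s)) = integral {a..t} (\<lambda>s. w (x s) - w (y s))"
    using c integrable_continuous_real by (intro Henstock_Kurzweil_Integration.integral_diff[symmetric]) blast+
  moreover have "norm (integral {a..t} (\<lambda>s. w (x s) - w (y s))) \<le> L * d * (t - a)"
  proof (rule integral_bound[OF assms(5)])
    show "continuous_on {a..t} (\<lambda>s. w (x s) - w (y s))" using c by (rule continuous_on_diff)
    show "norm (w (x s) - w (y s)) \<le> L * d" for s
    proof -
      have "norm (w (x s) - w (y s)) \<le> L * dist (x s) (y s)"
        using lipschitz_onD[OF assms(1), of "x s" "y s"] by (simp add: dist_norm)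
      also have "\<dots> \<le> L * d" by (rule mult_left_mono[OF assms(4) L])
      finally show ?thesis .
    qed
  qed
  ultimately show ?thesis by simp
qed

text \<open>The Picard operator is a contraction of the complete space of bounded continuous
  functions on the whole line.\<close>

lemma picard_lindelof_lipschitz:
  fixes w :: "'a::euclidean_space \<Rightarrow> 'a"
  assumes w: "L-lipschitz_on UNIV w" and tau: "\<tau> > 0" "3 * \<tau> * L < 1"
  obtains \<phi> where "\<phi> 0 = u" "\<forall>t\<in>{-\<tau><..<\<tau>}. (\<phi> has_vector_derivative w (\<phi> t)) (at t)"
proof -
  \<comment> \<open>Integrating from \<open>-\<tau>\<close> and subtracting the integral up to 0
    yields the integral from 0 to \<open>t\<close> for both signs of \<open>t\<close>.\<close>
  define J where "J = (\<lambda>x t. u + (integral {-\<tau>..t} (\<lambda>s. w (x s)) - integral {-\<tau>..0} (\<lambda>s. w (x s))))"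
  \<comment> \<open>Clamping the time to \<open>{-\<tau>..\<tau>}\<close> makes the image of the
    operator bounded and defined on the whole line.\<close>
  define h where "h = (\<lambda>t. max (-\<tau>) (min \<tau> t))"
  have h: "h t \<in> {-\<tau>..\<tau>}" for t using tau unfolding h_def by auto
  have hc: "continuous_on UNIV h" unfolding h_def by (intro continuous_intros)
  have cw: "continuous_on UNIV w" using w lipschitz_on_continuous_on by blast
  have L: "L \<ge> 0" using w lipschitz_on_nonneg by blast
  have cwx: "continuous_on S (\<lambda>s. w (apply_bcontfun x s))" for x :: "real \<Rightarrow>\<^sub>C 'a" and S
    by (rule continuous_on_compose2[OF cw]) (auto intro: continuous_on_subset[OF continuous_on_apply_bcontfun])
  have cJ: "continuous_on {-\<tau>..\<tau>} (J (apply_bcontfun x))" for x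
    unfolding J_def
    by (intro continuous_intros indefinite_integral_continuous_1 integrable_continuous_real cwx)
  have bJ: "(\<lambda>t. J (apply_bcontfun x) (h t)) \<in> bcontfun" for x
  proof -
    have "bounded (J (apply_bcontfun x) ` {-\<tau>..\<tau>})"
      by (rule compact_imp_bounded[OF compact_continuous_image[OF cJ compact_Icc]])
    then obtain B where B: "\<And>t. t \<in> {-\<tau>..\<tau>} \<Longrightarrow> norm (J (apply_bcontfun x) t) \<le> B"
      unfolding bounded_iff by blast
    have "continuous_on UNIV (\<lambda>t. J (apply_bcontfun x) (h t))"
      by (rule continuous_on_compose2[OF cJ hc]) (use h in auto)
    then show ?thesis by (rule bcontfun_normI) (rule B[OF h])
  qed
  define T where "T = (\<lambda>x. Bcontfun (\<lambda>t. J (apply_bcontfun x) (h t)))"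
  have T: "apply_bcontfun (T x) t = J (apply_bcontfun x) (h t)" for x t
    unfolding T_def using Bcontfun_inverse[OF bJ] by simp
  have contraction: "dist (T x) (T y) \<le> (3 * \<tau> * L) * dist x y" for x y
  proof (rule dist_bound)
    fix t
    let ?d = "dist x y"
    have I: "norm (integral {-\<tau>..s} (\<lambda>s. w (apply_bcontfun x s)) - integral {-\<tau>..s} (\<lambda>s. w (apply_bcontfun y s))) \<le> L * ?d * (s - -\<tau>)"
      if "-\<tau> \<le> s" for s
      by (rule integral_lipschitz_diff[OF w continuous_on_apply_bcontfun continuous_on_apply_bcontfun dist_bounded that])
    have "dist (T x t) (T y t) \<le>
        norm (integral {-\<tau>..h t} (\<lambda>s. w (apply_bcontfun x s)) - integral {-\<tau>..h t} (\<lambda>s. w (apply_bcontfun y s))) +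
        norm (integral {-\<tau>..0} (\<lambda>s. w (apply_bcontfun x s)) - integral {-\<tau>..0} (\<lambda>s. w (apply_bcontfun y s)))"
      unfolding T J_def dist_norm
      by (rule order_trans[OF _ norm_triangle_ineq4]) (simp add: algebra_simps)
    also have "\<dots> \<le> L * ?d * (h t - -\<tau>) + L * ?d * (0 - -\<tau>)"
      by (intro add_mono I) (use h[of t] tau in auto)
    also have "\<dots> = L * ?d * (h t + 2 * \<tau>)" by (simp add: algebra_simps)
    \<comment> \<open>The first integral runs over a length of at most \<open>2 * \<tau>\<close>,
      the second over \<open>\<tau>\<close>; this is the 3 in the hypothesis
      \<open>3 * \<tau> * L < 1\<close>.\<close>
    also have "\<dots> \<le> L * ?d * (3 * \<tau>)"
      by (rule mult_left_mono) (use h[of t] L in auto)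
    finally show "dist (T x t) (T y t) \<le> (3 * \<tau> * L) * ?d" by (simp add: mult_ac)
  qed
  have "\<exists>!x. T x = x"
    by (rule banach_fix_type[where c="3 * \<tau> * L"]) (use contraction tau L in auto)
  then obtain x where x: "T x = x" by blast
  have fixpt: "apply_bcontfun x t = J (apply_bcontfun x) t" if "t \<in> {-\<tau>..\<tau>}" for t
  proof -
    have "h t = t" using that unfolding h_def by auto
    then show ?thesis using T[of x t] x by simp
  qed
  show ?thesis
  proof (rule that[of "apply_bcontfun x"])
    show "apply_bcontfun x 0 = u" using fixpt[of 0] tau by (simp add: J_def)
    show "\<forall>t\<in>{-\<tau><..<\<tau>}. (apply_bcontfun x has_vector_derivative w (apply_bcontfun x t)) (at t)"
    proof
      fix t assume t: "t \<in> {-\<tau><..<\<tau>}"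
      have "((\<lambda>t. integral {-\<tau>..t} (\<lambda>s. w (apply_bcontfun x s))) has_vector_derivative w (apply_bcontfun x t)) (at t within {-\<tau>..\<tau>})"
        by (rule integral_has_vector_derivative[OF cwx]) (use t in auto)
      then have "((\<lambda>t. integral {-\<tau>..t} (\<lambda>s. w (apply_bcontfun x s))) has_vector_derivative w (apply_bcontfun x t)) (at t)"
        using t by (simp add: at_within_Icc_at)
      then have "(J (apply_bcontfun x) has_vector_derivative w (apply_bcontfun x t)) (at t)"
        unfolding J_def by (auto intro!: derivative_eq_intros)
      then show "(apply_bcontfun x has_vector_derivative w (apply_bcontfun x t)) (at t)"
        by (rule has_vector_derivative_transform_within_open[OF _ open_greaterThanLessThan t])
           (use fixpt in auto)
    qed
  qed
qed

lemma has_derivative_dist_square: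
  fixes x y :: "real \<Rightarrow> 'a::euclidean_space"
  assumes "(x has_vector_derivative x') (at t)" "(y has_vector_derivative y') (at t)"
  shows "((\<lambda>s. (x s - y s) \<bullet> (x s - y s)) has_real_derivative 2 * ((x t - y t) \<bullet> (x' - y'))) (at t)"
proof -
  have "((\<lambda>s. x s - y s) has_derivative (\<lambda>h. h *\<^sub>R (x' - y'))) (at t)"
    using has_vector_derivative_diff[OF assms] by (simp add: has_vector_derivative_def)
  moreover have "(\<lambda>h. (x t - y t) \<bullet> h *\<^sub>R (x' - y') + h *\<^sub>R (x' - y') \<bullet> (x t - y t)) =
      (*) (2 * ((x t - y t) \<bullet> (x' - y')))"
    by (simp add: fun_eq_iff inner_commute[of "x' - y'"])
  ultimately show ?thesis
    unfolding has_field_derivative_def using has_derivative_inner by fastforce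
qed

text \<open>The squared distance \<open>q\<close>, differentiable even where the curves meet,
  satisfies \<open>\<bar>q'\<bar> \<le> 2 * L * q\<close>. So \<open>q\<close> times
  \<open>exp (- 2 * L * s)\<close> does not increase forwards, and \<open>q\<close> times
  \<open>exp (2 * L * s)\<close> does not decrease on the negative side.\<close>

lemma gronwall_dist:
  fixes v :: "'a::euclidean_space \<Rightarrow> 'a"
  assumes v: "L-lipschitz_on D v"
    and D: "\<And>t. \<bar>t\<bar> < \<tau> \<Longrightarrow> x t \<in> D \<and> y t \<in> D"
    and dx: "\<And>t. \<bar>t\<bar> < \<tau> \<Longrightarrow> (x has_vector_derivative v (x t)) (at t)"
    and dy: "\<And>t. \<bar>t\<bar> < \<tau> \<Longrightarrow> (y has_vector_derivative v (y t)) (at t)"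
    and t: "\<bar>t\<bar> < \<tau>"
  shows "dist (x t) (y t) \<le> exp (L * \<bar>t\<bar>) * dist (x 0) (y 0)"
proof -
  define q where "q = (\<lambda>s. (x s - y s) \<bullet> (x s - y s))"
  define q' where "q' = (\<lambda>s. 2 * ((x s - y s) \<bullet> (v (x s) - v (y s))))"
  have dq: "(q has_real_derivative q' s) (at s)" if "\<bar>s\<bar> < \<tau>" for s
    unfolding q_def q'_def by (rule has_derivative_dist_square[OF dx[OF that] dy[OF that]])
  have q'_le: "\<bar>q' s\<bar> \<le> 2 * L * q s" if "\<bar>s\<bar> < \<tau>" for s
  proof -
    have "\<bar>(x s - y s) \<bullet> (v (x s) - v (y s))\<bar> \<le> norm (x s - y s) * norm (v (x s) - v (y s))"
      by (rule Cauchy_Schwarz_ineq2)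
    also have "\<dots> \<le> norm (x s - y s) * (L * norm (x s - y s))"
      using lipschitz_onD[OF v, of "x s" "y s"] D[OF that] by (intro mult_left_mono) (auto simp: dist_norm)
    also have "\<dots> = L * q s" by (simp add: q_def power2_norm_eq_inner[symmetric] power2_eq_square)
    finally show ?thesis by (simp add: q'_def abs_mult)
  qed
  have "q t \<le> exp (2 * L * \<bar>t\<bar>) * q 0"
  proof (cases "t \<ge> 0")
    case True
    have "q t * exp (- 2 * L * t) \<le> q 0 * exp (- 2 * L * 0)"
    proof (rule DERIV_nonpos_imp_nonincreasing[OF True, of "\<lambda>s. q s * exp (- 2 * L * s)"])
      fix s assume s: "0 \<le> s" "s \<le> t"
      have "((\<lambda>s. q s * exp (- 2 * L * s)) has_real_derivative (q' s - 2 * L * q s) * exp (- 2 * L * s)) (at s)"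
        using dq[of s] s t by (auto intro!: derivative_eq_intros simp: algebra_simps)
      moreover have "(q' s - 2 * L * q s) * exp (- 2 * L * s) \<le> 0"
        using q'_le[of s] s t by (intro mult_nonpos_nonneg) auto
      ultimately show "\<exists>z. ((\<lambda>s. q s * exp (- 2 * L * s)) has_real_derivative z) (at s) \<and> z \<le> 0" by blast
    qed
    then show ?thesis using True by (simp add: exp_minus field_simps)
  next
    case False
    then have "t \<le> 0" by simp
    have "q t * exp (2 * L * t) \<le> q 0 * exp (2 * L * 0)"
    proof (rule DERIV_nonneg_imp_nondecreasing[OF \<open>t \<le> 0\<close>, of "\<lambda>s. q s * exp (2 * L * s)"])
      fix s assume s: "t \<le> s" "s \<le> 0"
      have "((\<lambda>s. q s * exp (2 * L * s)) has_real_derivative (q' s + 2 * L * q s) * exp (2 * L * s)) (at s)"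
        using dq[of s] s t by (auto intro!: derivative_eq_intros simp: algebra_simps)
      moreover have "(q' s + 2 * L * q s) * exp (2 * L * s) \<ge> 0"
        using q'_le[of s] s t by (intro mult_nonneg_nonneg) auto
      ultimately show "\<exists>z. ((\<lambda>s. q s * exp (2 * L * s)) has_real_derivative z) (at s) \<and> 0 \<le> z" by blast
    qed
    then show ?thesis using False by (simp add: exp_minus field_simps)
  qed
  also have "\<dots> = (exp (L * \<bar>t\<bar>) * dist (x 0) (y 0))^2"
    by (simp add: q_def dist_norm power_mult_distrib power2_norm_eq_inner exp_double[symmetric] mult.assoc)
  finally have "(dist (x t) (y t))^2 \<le> (exp (L * \<bar>t\<bar>) * dist (x 0) (y 0))^2"
    by (simp add: q_def dist_norm power2_norm_eq_inner)
  then show ?thesis by (rule power2_le_imp_le) simp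
qed

lemma derivative_bound_lipschitz_on_cball:
  fixes v :: "'a::euclidean_space \<Rightarrow> 'b::real_normed_vector"
  assumes der: "\<And>x. x \<in> cball u r \<Longrightarrow> (v has_derivative D x) (at x)"
    and bound: "\<And>x b. x \<in> cball u r \<Longrightarrow> b \<in> Basis \<Longrightarrow> norm (D x b) \<le> B b"
  shows "\<bar>\<Sum>b\<in>Basis. B b\<bar>-lipschitz_on (cball u r) v"
proof -
  \<comment> \<open>The absolute value gives an admissible constant even for an empty ball, where
    \<open>B\<close> is unconstrained.\<close>
  define L where "L = \<bar>\<Sum>b\<in>Basis. B b\<bar>"
  have "norm (v x - v y) \<le> L * norm (x - y)" if "x \<in> cball u r" "y \<in> cball u r" for x y
  proof (rule differentiable_bound[OF convex_cball _ _ that])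
    fix z assume z: "z \<in> cball u r"
    show "(v has_derivative D z) (at z within cball u r)"
      using der[OF z] by (rule has_derivative_at_withinI)
    show "onorm (D z) \<le> L"
    proof (rule onorm_bound)
      fix h
      have lin: "linear (D z)" by (rule has_derivative_linear[OF der[OF z]])
      have "D z h = D z (\<Sum>b\<in>Basis. (h \<bullet> b) *\<^sub>R b)"
        by (simp only: euclidean_representation)
      also have "\<dots> = (\<Sum>b\<in>Basis. (h \<bullet> b) *\<^sub>R D z b)"
        by (simp only: linear_sum[OF lin] linear_scale[OF lin])
      also have "norm \<dots> \<le> (\<Sum>b\<in>Basis. norm h * B b)"
      proof (rule sum_norm_le)
        fix b :: 'a assume b: "b \<in> Basis"
        show "norm ((h \<bullet> b) *\<^sub>R D z b) \<le> norm h * B b"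
          using mult_mono[OF Basis_le_norm[OF b, of h] bound[OF z b]] by simp
      qed
      also have "\<dots> = norm h * (\<Sum>b\<in>Basis. B b)" by (simp only: sum_distrib_left)
      also have "\<dots> \<le> norm h * L" unfolding L_def by (rule mult_left_mono) auto
      finally show "norm (D z h) \<le> L * norm h" by (simp add: mult.commute)
    qed (simp add: L_def)
  qed
  then show ?thesis
    unfolding L_def[symmetric] by (intro lipschitz_onI) (auto simp: dist_norm L_def)
qed

lemma C1_lipschitz_on_cball:
  fixes v :: "'a::euclidean_space \<Rightarrow> 'b::real_normed_vector"
  assumes "Ck_on (Suc 0) S v" "cball u r \<subseteq> S"
  obtains L where "L-lipschitz_on (cball u r) v"
proof -
  have "bounded ((\<lambda>x. frechet_derivative v (at x) b) ` cball u r)" for b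
  proof -
    have "continuous_on S (\<lambda>x. frechet_derivative v (at x) b)" using assms(1) by simp
    then show ?thesis
      by (rule compact_imp_bounded[OF compact_continuous_image[OF continuous_on_subset[OF _ assms(2)] compact_cball]])
  qed
  then have "\<forall>b. \<exists>B. \<forall>x\<in>cball u r. norm (frechet_derivative v (at x) b) \<le> B"
    unfolding bounded_iff by blast
  then obtain B where B: "\<And>b x. x \<in> cball u r \<Longrightarrow> norm (frechet_derivative v (at x) b) \<le> B b" by metis
  have "(v has_derivative frechet_derivative v (at x)) (at x)" if "x \<in> cball u r" for x
    using Ck_on_has_derivative[OF assms(1)] assms(2) that by blast
  from derivative_bound_lipschitz_on_cball[OF this B] show ?thesis by (rule that)
qed

text \<open>Differentiability at \<open>u\<close> compares points with \<open>u\<close> only.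
  Continuity of the derivative gives a small Lipschitz constant for the remainder, which compares
  two points near \<open>u\<close> with each other.\<close>

lemma C1_strictly_differentiable:
  fixes v :: "'a::euclidean_space \<Rightarrow> 'b::real_normed_vector"
  assumes "open S" "Ck_on (Suc 0) S v" "u \<in> S" "e > 0"
  obtains r where "r > 0" "cball u r \<subseteq> S" "e-lipschitz_on (cball u r) (\<lambda>x. v x - frechet_derivative v (at u) x)"
proof -
  let ?D = "\<lambda>x. frechet_derivative v (at x)"
  \<comment> \<open>The Lipschitz constant is a sum over the basis vectors, so each of them receives
    an equal share of \<open>e\<close>.\<close>
  define e' where "e' = e / DIM('a)"
  have e': "e' > 0" using assms(4) by (simp add: e'_def)
  have lin: "bounded_linear (?D u)"
    using Ck_on_has_derivative[OF assms(2,3)] has_derivative_bounded_linear by blast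
  have "\<forall>\<^sub>F x in nhds u. norm (?D x b - ?D u b) < e'" for b
  proof -
    have "continuous_on S (\<lambda>x. ?D x b)" using assms(2) by simp
    then have "isCont (\<lambda>x. ?D x b) u" using assms(1,3) continuous_on_eq_continuous_at by blast
    then have "((\<lambda>x. ?D x b) \<longlongrightarrow> ?D u b) (nhds u)" using tendsto_at_iff_tendsto_nhds[of "\<lambda>x. ?D x b" u] by (simp add: isCont_def)
    from tendstoD[OF this e'] show ?thesis by (simp add: dist_norm)
  qed
  then have "\<forall>\<^sub>F x in nhds u. \<forall>b\<in>Basis. norm (?D x b - ?D u b) < e'"
    by (simp add: eventually_ball_finite_distrib)
  moreover have "\<forall>\<^sub>F x in nhds u. x \<in> S" using assms(1,3) by (simp add: eventually_nhds_in_open)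
  ultimately have "\<forall>\<^sub>F x in nhds u. (\<forall>b\<in>Basis. norm (?D x b - ?D u b) < e') \<and> x \<in> S"
    by (rule eventually_conj)
  then obtain d where d: "d > 0" "\<And>x. dist x u < d \<Longrightarrow> (\<forall>b\<in>Basis. norm (?D x b - ?D u b) < e') \<and> x \<in> S"
    unfolding eventually_nhds_metric by blast
  have near: "(\<forall>b\<in>Basis. norm (?D x b - ?D u b) < e') \<and> x \<in> S" if "x \<in> cball u (d/2)" for x
    using that d by (intro d(2)) (auto simp: dist_commute)
  have "\<bar>\<Sum>b\<in>(Basis::'a set). e'\<bar>-lipschitz_on (cball u (d/2)) (\<lambda>x. v x - ?D u x)"
  proof (rule derivative_bound_lipschitz_on_cball)
    fix x assume x: "x \<in> cball u (d/2)"
    show "((\<lambda>x. v x - ?D u x) has_derivative (\<lambda>h. ?D x h - ?D u h)) (at x)"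
      by (rule has_derivative_diff[OF Ck_on_has_derivative[OF assms(2)] bounded_linear_imp_has_derivative[OF lin]])
         (use near[OF x] in blast)
    show "norm (?D x b - ?D u b) \<le> e'" if "b \<in> Basis" for b using near[OF x] that by (simp add: less_imp_le)
  qed
  moreover have "\<bar>\<Sum>b\<in>(Basis::'a set). e'\<bar> = e" using assms(4) by (simp add: e'_def)
  ultimately have "e-lipschitz_on (cball u (d/2)) (\<lambda>x. v x - ?D u x)" by metis
  moreover have "cball u (d/2) \<subseteq> S" using near by blast
  moreover have "d/2 > 0" using d(1) by simp
  ultimately show ?thesis using that by blast
qed

text \<open>Composing \<open>v\<close> with the nearest-point projection onto the ball, which does
  not expand distances, gives a field that is Lipschitz on the whole space. Its solutions solve the
  original equation as long as they remain in the ball, and a bound on the speed ensures this for a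
  short time.\<close>

lemma flow_box:
  fixes v :: "'a::euclidean_space \<Rightarrow> 'a"
  assumes v: "L-lipschitz_on (cball u0 (2 * r)) v" and r: "r > 0"
  obtains \<tau> where "\<tau> > 0" "\<forall>u\<in>ball u0 r. \<exists>\<phi>. \<phi> 0 = u \<and>
    (\<forall>t\<in>{-\<tau><..<\<tau>}. \<phi> t \<in> cball u0 (2 * r) \<and> (\<phi> has_vector_derivative v (\<phi> t)) (at t))"
proof -
  let ?C = "cball u0 (2 * r)"
  define w where "w = (\<lambda>x. v (closest_point ?C x))"
  have C: "convex ?C" "closed ?C" "?C \<noteq> {}" using r by auto
  have cp: "closest_point ?C x \<in> ?C" for x by (rule closest_point_in_set[OF C(2,3)])
  have L: "L \<ge> 0" using v lipschitz_on_nonneg by blast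
  have w: "L-lipschitz_on UNIV w"
  proof (rule lipschitz_onI[OF _ L])
    fix x y
    have "dist (w x) (w y) \<le> L * dist (closest_point ?C x) (closest_point ?C y)"
      unfolding w_def by (rule lipschitz_onD[OF v cp cp])
    also have "\<dots> \<le> L * dist x y"
      by (rule mult_left_mono[OF closest_point_lipschitz[OF C(1,2,3)] L])
    finally show "dist (w x) (w y) \<le> L * dist x y" .
  qed
  have wv: "w x = v x" if "x \<in> ?C" for x unfolding w_def closest_point_self[OF that] ..
  have "compact (v ` ?C)"
    by (rule compact_continuous_image[OF lipschitz_on_continuous_on[OF v] compact_cball])
  then have "bounded (v ` ?C)" by (rule compact_imp_bounded)
  then obtain B0 where "\<forall>y\<in>v ` ?C. norm y \<le> B0" unfolding bounded_iff ..
  then have B0: "\<And>x. x \<in> ?C \<Longrightarrow> norm (v x) \<le> B0" by blast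
  define B where "B = \<bar>B0\<bar> + 1"
  have B: "B > 0" "norm (w x) \<le> B" for x using B0[OF cp[of x]] unfolding B_def w_def by auto
  \<comment> \<open>The first bound limits the distance travelled to \<open>r\<close>, so that a
    start in the ball of radius \<open>r\<close> leads no farther than \<open>2 * r\<close>; the
    second gives \<open>3 * \<tau> * L < 1\<close>. With \<open>L + 1\<close> the quotient makes
    sense for \<open>L = 0\<close>.\<close>
  define \<tau> where "\<tau> = min (r / B) (1 / (4 * (L + 1)))"
  have \<tau>: "\<tau> > 0" unfolding \<tau>_def using r B(1) L by simp
  have \<tau>B: "\<tau> * B \<le> r"
  proof -
    have "\<tau> \<le> r / B" by (simp add: \<tau>_def)
    then show ?thesis using B(1) by (simp add: pos_le_divide_eq)
  qed
  have "\<tau> \<le> 1 / (4 * (L + 1))" by (simp add: \<tau>_def)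
  then have "3 * \<tau> * (L + 1) \<le> 3 / 4" using L by (simp add: field_simps)
  then have \<tau>L: "3 * \<tau> * L < 1" using \<tau> L by (simp add: algebra_simps)
  show ?thesis
  proof (rule that[OF \<tau>], rule ballI)
    fix u assume u: "u \<in> ball u0 r"
    obtain \<phi> where \<phi>: "\<phi> 0 = u" "\<forall>t\<in>{-\<tau><..<\<tau>}. (\<phi> has_vector_derivative w (\<phi> t)) (at t)"
      by (rule picard_lindelof_lipschitz[OF w \<tau> \<tau>L])
    have inC: "\<phi> t \<in> ?C" if t: "t \<in> {-\<tau><..<\<tau>}" for t
    proof -
      have "norm (\<phi> t - \<phi> 0) \<le> B * norm (t - 0)"
      proof (rule differentiable_bound[where S="{-\<tau><..<\<tau>}"])
        fix s assume s: "s \<in> {-\<tau><..<\<tau>}"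
        show "(\<phi> has_derivative (\<lambda>h. h *\<^sub>R w (\<phi> s))) (at s within {-\<tau><..<\<tau>})"
          using \<phi>(2) s by (auto simp: has_vector_derivative_def intro: has_derivative_at_withinI)
        show "onorm (\<lambda>h. h *\<^sub>R w (\<phi> s)) \<le> B"
        proof (rule onorm_bound)
          show "norm (h *\<^sub>R w (\<phi> s)) \<le> B * norm h" for h
            using mult_right_mono[OF B(2)[of "\<phi> s"], of "\<bar>h\<bar>"] by (simp add: mult.commute)
        qed (use B in simp)
      qed (use t \<tau> in auto)
      also have "\<dots> \<le> B * \<tau>" using t B(1) by (intro mult_left_mono) auto
      also have "\<dots> \<le> r" using \<tau>B by (simp add: mult.commute)
      finally have "dist u (\<phi> t) \<le> r" by (simp add: \<phi>(1) dist_norm norm_minus_commute)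
      then show ?thesis using u dist_triangle[of u0 "\<phi> t" u] by simp
    qed
    show "\<exists>\<phi>. \<phi> 0 = u \<and> (\<forall>t\<in>{-\<tau><..<\<tau>}. \<phi> t \<in> ?C \<and> (\<phi> has_vector_derivative v (\<phi> t)) (at t))"
      using \<phi> inC wv by (intro exI[of _ \<phi>]) auto
  qed
qed

section \<open>Flows on compact surfaces\<close>

locale vector_field = compact_manifold A for A :: "('m::t2_space) chart set" +
  fixes V :: "'m chart \<Rightarrow> 'm \<Rightarrow> real^2"
  assumes field_C1: "c \<in> A \<Longrightarrow> Ck_on (Suc 0) (snd c ` fst c) (in_chart c (V c))"
    and field_transform: "c \<in> A \<Longrightarrow> d \<in> A \<Longrightarrow> x \<in> fst c \<Longrightarrow> x \<in> fst d \<Longrightarrow>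
      V d x = transition_jacobian c d x *v V c x"
begin

text \<open>Continuity is demanded separately: \<open>snd c\<close> has arbitrary values outside its
  domain, so differentiability of \<open>snd c \<circ> \<gamma>\<close> alone does not keep the
  curve near \<open>\<gamma> t\<close>.\<close>

definition integral_curve :: "real set \<Rightarrow> (real \<Rightarrow> 'm) \<Rightarrow> bool"
  where "integral_curve S \<gamma> \<longleftrightarrow> (\<forall>t\<in>S. isCont \<gamma> t \<and>
    (\<forall>c\<in>A. \<gamma> t \<in> fst c \<longrightarrow> ((snd c \<circ> \<gamma>) has_vector_derivative V c (\<gamma> t)) (at t)))"

lemma integral_curve_subset: "integral_curve S \<gamma> \<Longrightarrow> T \<subseteq> S \<Longrightarrow> integral_curve T \<gamma>"
  unfolding integral_curve_def by blast

lemma integral_curve_isCont: "integral_curve S \<gamma> \<Longrightarrow> t \<in> S \<Longrightarrow> isCont \<gamma> t"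
  unfolding integral_curve_def by blast

lemma integral_curve_local:
  assumes "\<And>t. t \<in> S \<Longrightarrow> \<exists>T \<delta>. open T \<and> t \<in> T \<and> integral_curve T \<delta> \<and> (\<forall>s\<in>T. \<delta> s = \<gamma> s)"
  shows "integral_curve S \<gamma>"
  unfolding integral_curve_def
proof (intro ballI conjI impI)
  fix t assume "t \<in> S"
  then obtain T \<delta> where T: "open T" "t \<in> T" "integral_curve T \<delta>" "\<forall>s\<in>T. \<delta> s = \<gamma> s"
    using assms by meson
  have "continuous_on T \<delta>" using T(3) by (intro continuous_at_imp_continuous_on) (auto simp: integral_curve_def)
  then have "continuous_on T \<gamma>" by (rule continuous_on_eq) (use T in auto)
  then show "isCont \<gamma> t" using T continuous_on_eq_continuous_at by blast
  fix c assume c: "c \<in> A" "\<gamma> t \<in> fst c"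
  have "((snd c \<circ> \<delta>) has_vector_derivative V c (\<delta> t)) (at t)"
    using T c unfolding integral_curve_def by auto
  then have "((snd c \<circ> \<gamma>) has_vector_derivative V c (\<delta> t)) (at t)"
    by (rule has_vector_derivative_transform_within_open[OF _ T(1,2)]) (use T(4) in simp)
  then show "((snd c \<circ> \<gamma>) has_vector_derivative V c (\<gamma> t)) (at t)" using T by simp
qed

lemma integral_curve_shift:
  assumes "integral_curve S \<gamma>"
  shows "integral_curve {t. t + s \<in> S} (\<lambda>t. \<gamma> (t + s))"
  unfolding integral_curve_def
proof (intro ballI conjI impI)
  fix t assume t: "t \<in> {t. t + s \<in> S}"
  have "isCont \<gamma> (t + s)" using assms t unfolding integral_curve_def by auto
  moreover have "isCont (\<lambda>t. t + s) t" by (intro continuous_intros)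
  ultimately show "isCont (\<lambda>t. \<gamma> (t + s)) t" by (rule isCont_o2[rotated])
  fix c assume c: "c \<in> A" "\<gamma> (t + s) \<in> fst c"
  have d: "((snd c \<circ> \<gamma>) has_vector_derivative V c (\<gamma> (t + s))) (at (t + s))"
    using assms t c unfolding integral_curve_def by auto
  have l: "((\<lambda>t. t + s) has_vector_derivative 1) (at t)"
    by (auto intro!: derivative_eq_intros)
  show "((snd c \<circ> (\<lambda>t. \<gamma> (t + s))) has_vector_derivative V c (\<gamma> (t + s))) (at t)"
    using vector_diff_chain_at[OF l d] by (simp add: comp_def)
qed

lemma integral_curve_in_chart:
  assumes "integral_curve S \<gamma>" "t \<in> S" "c \<in> A" "\<gamma> t \<in> fst c"
  shows "((snd c \<circ> \<gamma>) has_vector_derivative in_chart c (V c) ((snd c \<circ> \<gamma>) t)) (at t)"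
  using assms unfolding integral_curve_def by (simp add: in_chart_apply)

lemma integral_curve_from_chart:
  assumes c: "c \<in> A" and \<phi>: "\<And>t. t \<in> S \<Longrightarrow> \<phi> t \<in> snd c ` fst c"
    and d\<phi>: "\<And>t. t \<in> S \<Longrightarrow> (\<phi> has_vector_derivative in_chart c (V c) (\<phi> t)) (at t)"
  shows "integral_curve S (\<lambda>t. inv_into (fst c) (snd c) (\<phi> t))"
  unfolding integral_curve_def
proof (intro ballI conjI impI)
  let ?i = "inv_into (fst c) (snd c)"
  fix t assume t: "t \<in> S"
  have o: "open (snd c ` fst c)" by (rule open_chart_image'[OF c open_chart[OF c] order_refl])
  have "isCont \<phi> t" using d\<phi>[OF t] has_vector_derivative_continuous by blast
  moreover have "isCont ?i (\<phi> t)"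
    using continuous_on_inv_chart[OF c] o \<phi>[OF t] continuous_on_eq_continuous_at by blast
  ultimately show "isCont (\<lambda>t. ?i (\<phi> t)) t" by (rule isCont_o2)
  fix d assume d: "d \<in> A" "?i (\<phi> t) \<in> fst d"
  let ?x = "?i (\<phi> t)"
  have x: "?x \<in> fst c" "snd c ?x = \<phi> t"
    using \<phi>[OF t] by (auto simp: inv_into_into f_inv_into_f)
  have "(\<phi> has_derivative (\<lambda>h. h *\<^sub>R V c ?x)) (at t)"
    using d\<phi>[OF t] unfolding has_vector_derivative_def in_chart_def by simp
  from has_derivative_compose[OF this, of "in_chart c (snd d)"] transition_has_derivative[OF c d(1) x(1) d(2)]
  have "((\<lambda>s. in_chart c (snd d) (\<phi> s)) has_derivative (\<lambda>h. transition_jacobian c d ?x *v (h *\<^sub>R V c ?x))) (at t)"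
    unfolding x(2) by blast
  then show "((snd d \<circ> (\<lambda>t. ?i (\<phi> t))) has_vector_derivative V d ?x) (at t)"
    unfolding has_vector_derivative_def field_transform[OF c d(1) x(1) d(2)]
    by (simp add: in_chart_def comp_def matrix_vector_mult_scaleR)
qed

lemma chart_flow_box:
  obtains c r L \<tau> where "c \<in> A" "p \<in> fst c" "r > 0" "cball (snd c p) (2 * r) \<subseteq> snd c ` fst c"
    "L-lipschitz_on (cball (snd c p) (2 * r)) (in_chart c (V c))" "\<tau> > 0"
    "\<forall>u\<in>ball (snd c p) r. \<exists>\<phi>. \<phi> 0 = u \<and> (\<forall>t\<in>{-\<tau><..<\<tau>}. \<phi> t \<in> cball (snd c p) (2 * r) \<and>
      (\<phi> has_vector_derivative in_chart c (V c) (\<phi> t)) (at t))"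
proof -
  obtain c where c: "c \<in> A" "p \<in> fst c" by (rule chart_cover)
  obtain r where r: "r > 0" "cball (snd c p) r \<subseteq> snd c ` (fst c \<inter> UNIV)"
    by (rule chart_ball[OF c open_UNIV UNIV_I])
  define r' where "r' = r / 2"
  have r': "r' > 0" "cball (snd c p) (2 * r') \<subseteq> snd c ` fst c" using r by (auto simp: r'_def)
  obtain L where L: "L-lipschitz_on (cball (snd c p) (2 * r')) (in_chart c (V c))"
    by (rule C1_lipschitz_on_cball[OF field_C1[OF c(1)] r'(2)])
  obtain \<tau> where "\<tau> > 0" "\<forall>u\<in>ball (snd c p) r'. \<exists>\<phi>. \<phi> 0 = u \<and> (\<forall>t\<in>{-\<tau><..<\<tau>}. \<phi> t \<in> cball (snd c p) (2 * r') \<and>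
      (\<phi> has_vector_derivative in_chart c (V c) (\<phi> t)) (at t))"
    by (rule flow_box[OF L r'(1)])
  then show ?thesis by (rule that[OF c r' L])
qed

section \<open>Uniqueness and completeness of integral curves\<close>

lemma integral_curve_unique_local:
  assumes "integral_curve S \<gamma>" "integral_curve S \<delta>" "open S" "t \<in> S" "\<gamma> t = \<delta> t"
  shows "\<exists>T. open T \<and> t \<in> T \<and> (\<forall>s\<in>T. \<gamma> s = \<delta> s)"
proof -
  obtain c r L \<tau> where c: "c \<in> A" "\<gamma> t \<in> fst c" "r > 0" and r: "cball (snd c (\<gamma> t)) (2 * r) \<subseteq> snd c ` fst c"
    and L: "L-lipschitz_on (cball (snd c (\<gamma> t)) (2 * r)) (in_chart c (V c))" and "\<tau> > 0"
    "\<forall>u\<in>ball (snd c (\<gamma> t)) r. \<exists>\<phi>. \<phi> 0 = u \<and> (\<forall>s\<in>{-\<tau><..<\<tau>}. \<phi> s \<in> cball (snd c (\<gamma> t)) (2 * r) \<and>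
      (\<phi> has_vector_derivative in_chart c (V c) (\<phi> s)) (at s))"
    by (rule chart_flow_box)
  let ?B = "ball (snd c (\<gamma> t)) r"
  have B: "?B \<subseteq> snd c ` fst c" using r c(3) by auto
  define U where "U = inv_into (fst c) (snd c) ` ?B"
  have U: "open U" "\<gamma> t \<in> U" unfolding U_def
    using open_inv_chart_image[OF c(1) open_ball B] mem_inv_image_iff[OF c(1) B] c by auto
  have ev: "\<exists>T. open T \<and> t \<in> T \<and> (\<forall>s\<in>T. \<eta> s \<in> U)" if "isCont \<eta> t" "\<eta> t \<in> U" for \<eta>
    using that U(1) unfolding continuous_at_open by blast
  obtain T1 where T1: "open T1" "t \<in> T1" "\<forall>s\<in>T1. \<gamma> s \<in> U"
    using ev[OF integral_curve_isCont[OF assms(1,4)] U(2)] by blast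
  obtain T2 where T2: "open T2" "t \<in> T2" "\<forall>s\<in>T2. \<delta> s \<in> U"
    using ev[OF integral_curve_isCont[OF assms(2,4)]] U(2) assms(5) by metis
  have "open (T1 \<inter> T2 \<inter> S)" "t \<in> T1 \<inter> T2 \<inter> S" using T1 T2 assms by auto
  then obtain e where e: "e > 0" "ball t e \<subseteq> T1 \<inter> T2 \<inter> S" using openE by blast
  have ins: "t + s \<in> T1 \<inter> T2 \<inter> S" if "\<bar>s\<bar> < e" for s
    using e(2) that by (auto simp: dist_real_def subset_iff)
  have mem: "\<gamma> (t + s) \<in> fst c \<and> snd c (\<gamma> (t + s)) \<in> ?B \<and> \<delta> (t + s) \<in> fst c \<and> snd c (\<delta> (t + s)) \<in> ?B"
    if "\<bar>s\<bar> < e" for s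
    using T1 T2 ins[OF that] mem_inv_image_iff[OF c(1) B] unfolding U_def by blast
  have der: "((\<lambda>s. snd c (\<eta> (t + s))) has_vector_derivative in_chart c (V c) (snd c (\<eta> (t + s)))) (at s)"
    if "integral_curve S \<eta>" "\<bar>s\<bar> < e" "\<eta> (t + s) \<in> fst c" for \<eta> s
  proof -
    have "((snd c \<circ> (\<lambda>s. \<eta> (s + t))) has_vector_derivative in_chart c (V c) ((snd c \<circ> (\<lambda>s. \<eta> (s + t))) s)) (at s)"
      by (rule integral_curve_in_chart[OF integral_curve_shift[OF that(1)] _ c(1)])
         (use ins[OF that(2)] that(3) in \<open>auto simp: add.commute\<close>)
    then show ?thesis by (simp add: comp_def add.commute)
  qed
  have sub: "?B \<subseteq> cball (snd c (\<gamma> t)) (2 * r)" using c(3) by auto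
  have memC: "snd c (\<gamma> (t + s)) \<in> cball (snd c (\<gamma> t)) (2 * r) \<and> snd c (\<delta> (t + s)) \<in> cball (snd c (\<gamma> t)) (2 * r)"
    if "\<bar>s\<bar> < e" for s
    using mem[OF that] sub by blast
  have eq: "\<gamma> (t + s) = \<delta> (t + s)" if s: "\<bar>s\<bar> < e" for s
  proof -
    have "dist (snd c (\<gamma> (t + s))) (snd c (\<delta> (t + s))) \<le> exp (L * \<bar>s\<bar>) * dist (snd c (\<gamma> (t + 0))) (snd c (\<delta> (t + 0)))"
      by (rule gronwall_dist[OF L _ _ _ s, where x="\<lambda>s. snd c (\<gamma> (t + s))" and y="\<lambda>s. snd c (\<delta> (t + s))"])
         (use memC mem der[OF assms(1)] der[OF assms(2)] in auto)
    then have "snd c (\<gamma> (t + s)) = snd c (\<delta> (t + s))" using assms(5) by simp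
    then show ?thesis using mem[OF s] inj_on_chart[OF c(1)] by (auto dest: inj_onD)
  qed
  show ?thesis
  proof (intro exI[of _ "ball t e"] conjI ballI)
    fix s assume "s \<in> ball t e"
    then show "\<gamma> s = \<delta> s" using eq[of "s - t"] by (simp add: dist_real_def)
  qed (use e in auto)
qed

text \<open>Agreement of the curves is an open condition by local uniqueness, disagreement is open
  because the surface is Hausdorff, and \<open>S\<close> is connected.\<close>

lemma integral_curve_unique:
  assumes "integral_curve S \<gamma>" "integral_curve S \<delta>" "open S" "connected S" "s \<in> S" "\<gamma> s = \<delta> s" "t \<in> S"
  shows "\<gamma> t = \<delta> t"
proof (rule ccontr)
  assume ne: "\<gamma> t \<noteq> \<delta> t"
  let ?E = "{t\<in>S. \<gamma> t = \<delta> t}" and ?N = "{t\<in>S. \<gamma> t \<noteq> \<delta> t}"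
  have "open ?E"
  proof (subst open_subopen, rule ballI)
    fix x assume x: "x \<in> ?E"
    then obtain T where "open T" "x \<in> T" "\<forall>s\<in>T. \<gamma> s = \<delta> s"
      using integral_curve_unique_local[OF assms(1-3), of x] by blast
    then show "\<exists>T. open T \<and> x \<in> T \<and> T \<subseteq> ?E"
      using x assms(3) by (intro exI[of _ "T \<inter> S"]) auto
  qed
  moreover have "open ?N"
  proof (subst open_subopen, rule ballI)
    fix x assume x: "x \<in> ?N"
    then obtain U W where UW: "open U" "open W" "\<gamma> x \<in> U" "\<delta> x \<in> W" "U \<inter> W = {}"
      using hausdorff[of "\<gamma> x" "\<delta> x"] by blast
    have "isCont \<gamma> x" "isCont \<delta> x" using assms(1,2) x integral_curve_isCont by auto
    then obtain T1 T2 where "open T1" "x \<in> T1" "\<forall>s\<in>T1. \<gamma> s \<in> U" "open T2" "x \<in> T2" "\<forall>s\<in>T2. \<delta> s \<in> W"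
      using UW unfolding continuous_at_open by metis
    then show "\<exists>T. open T \<and> x \<in> T \<and> T \<subseteq> ?N"
      using x UW(5) assms(3) by (intro exI[of _ "T1 \<inter> T2 \<inter> S"]) auto
  qed
  moreover have "S \<subseteq> ?E \<union> ?N" "?E \<inter> ?N \<inter> S = {}" by auto
  ultimately have "?E \<inter> S = {} \<or> ?N \<inter> S = {}" using connectedD[OF assms(4)] by blast
  then show False using ne assms by blast
qed

text \<open>Compactness turns the local existence times into a common one; with a common time,
  curves can be prolonged indefinitely by restarting them.\<close>

lemma integral_curve_exists_uniform:
  obtains \<tau> where "\<tau> > 0" "\<forall>x. \<exists>\<gamma>. \<gamma> 0 = x \<and> integral_curve {-\<tau><..<\<tau>} \<gamma>"
proof -
  define good where "good = (\<lambda>U \<tau>. open U \<and> \<tau> > (0::real) \<and> (\<forall>x\<in>U. \<exists>\<gamma>. \<gamma> 0 = x \<and> integral_curve {-\<tau><..<\<tau>} \<gamma>))"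
  have "\<exists>U \<tau>. p \<in> U \<and> good U \<tau>" for p
  proof -
    obtain c r L \<tau> where c: "c \<in> A" "p \<in> fst c" "r > 0" and r: "cball (snd c p) (2 * r) \<subseteq> snd c ` fst c"
      and L: "L-lipschitz_on (cball (snd c p) (2 * r)) (in_chart c (V c))" and \<tau>: "\<tau> > 0"
        "\<forall>u\<in>ball (snd c p) r. \<exists>\<phi>. \<phi> 0 = u \<and> (\<forall>s\<in>{-\<tau><..<\<tau>}. \<phi> s \<in> cball (snd c p) (2 * r) \<and>
        (\<phi> has_vector_derivative in_chart c (V c) (\<phi> s)) (at s))"
      by (rule chart_flow_box)
    let ?B = "ball (snd c p) r"
    have B: "?B \<subseteq> snd c ` fst c" using r c(3) by auto
    show ?thesis
    proof (intro exI conjI)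
      show "p \<in> inv_into (fst c) (snd c) ` ?B" unfolding mem_inv_image_iff[OF c(1) B] using c by simp
      show "good (inv_into (fst c) (snd c) ` ?B) \<tau>"
        unfolding good_def
      proof (intro conjI ballI)
        show "open (inv_into (fst c) (snd c) ` ?B)" by (rule open_inv_chart_image[OF c(1) open_ball B])
        fix x assume "x \<in> inv_into (fst c) (snd c) ` ?B"
        then have x: "x \<in> fst c" "snd c x \<in> ?B" using mem_inv_image_iff[OF c(1) B] by auto
        then obtain \<phi> where \<phi>: "\<phi> 0 = snd c x" "\<forall>s\<in>{-\<tau><..<\<tau>}. \<phi> s \<in> cball (snd c p) (2 * r) \<and>
            (\<phi> has_vector_derivative in_chart c (V c) (\<phi> s)) (at s)"
          using \<tau>(2) by blast
        have "integral_curve {-\<tau><..<\<tau>} (\<lambda>t. inv_into (fst c) (snd c) (\<phi> t))"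
          by (rule integral_curve_from_chart[OF c(1)]) (use \<phi>(2) r in blast)+
        then show "\<exists>\<gamma>. \<gamma> 0 = x \<and> integral_curve {-\<tau><..<\<tau>} \<gamma>"
          using \<phi>(1) x c(1) by (intro exI[of _ "\<lambda>t. inv_into (fst c) (snd c) (\<phi> t)"]) simp
      qed (rule \<tau>(1))
    qed
  qed
  then obtain U T where UT: "\<And>p. p \<in> U p \<and> good (U p) (T p)" by metis
  have "\<exists>I\<subseteq>UNIV. finite I \<and> UNIV \<subseteq> (\<Union>x\<in>I. U x)"
    by (rule compact_finite_cover[OF compact_UNIV]) (use UT in \<open>auto simp: good_def\<close>)
  then obtain I where I: "finite I" "UNIV \<subseteq> (\<Union>x\<in>I. U x)" by blast
  define \<tau> where "\<tau> = Min (insert 1 (T ` I))"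
  have "\<tau> > 0" unfolding \<tau>_def using I UT by (auto simp: good_def)
  moreover have "\<exists>\<gamma>. \<gamma> 0 = x \<and> integral_curve {-\<tau><..<\<tau>} \<gamma>" for x
  proof -
    obtain p where p: "p \<in> I" "x \<in> U p" using I by blast
    then obtain \<gamma> where \<gamma>: "\<gamma> 0 = x" "integral_curve {-T p<..<T p} \<gamma>"
      using UT[of p] unfolding good_def by blast
    have "\<tau> \<le> T p" unfolding \<tau>_def using p I by simp
    then have "{-\<tau><..<\<tau>} \<subseteq> {-T p<..<T p}" by auto
    then show ?thesis using \<gamma> integral_curve_subset by blast
  qed
  ultimately show ?thesis using that by blast
qed

text \<open>The curve is restarted at the times \<open>a/2\<close> and \<open>-a/2\<close>. The new
  pieces agree with it on the overlaps by uniqueness and reach as far as \<open>3/2 * a\<close> in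
  both directions. Because this holds for every starting point, it can be iterated.\<close>

lemma integral_curve_extend:
  assumes a: "a > 0" and ex: "\<And>x. \<exists>\<gamma>. \<gamma> 0 = x \<and> integral_curve {-a<..<a} \<gamma>"
  shows "\<exists>\<gamma>. \<gamma> 0 = x \<and> integral_curve {-(3/2*a)<..<3/2*a} \<gamma>"
proof -
  obtain \<gamma> where \<gamma>: "\<gamma> 0 = x" "integral_curve {-a<..<a} \<gamma>" using ex by blast
  obtain \<delta> where \<delta>: "\<delta> 0 = \<gamma> (a/2)" "integral_curve {-a<..<a} \<delta>" using ex by blast
  obtain \<eta> where \<eta>: "\<eta> 0 = \<gamma> (-a/2)" "integral_curve {-a<..<a} \<eta>" using ex by blast
  have d: "integral_curve {-a/2<..<3/2*a} (\<lambda>t. \<delta> (t + -a/2))"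
    by (rule integral_curve_subset[OF integral_curve_shift[OF \<delta>(2)]]) auto
  have e: "integral_curve {-(3/2*a)<..<a/2} (\<lambda>t. \<eta> (t + a/2))"
    by (rule integral_curve_subset[OF integral_curve_shift[OF \<eta>(2)]]) auto
  have eqd: "\<gamma> t = \<delta> (t + -a/2)" if "t \<in> {-a/2<..<a}" for t
    by (rule integral_curve_unique[OF integral_curve_subset[OF \<gamma>(2)] integral_curve_subset[OF d], where S="{-a/2<..<a}" and s="a/2"])
       (use a \<delta>(1) that in auto)
  have eqe: "\<gamma> t = \<eta> (t + a/2)" if "t \<in> {-a<..<a/2}" for t
    by (rule integral_curve_unique[OF integral_curve_subset[OF \<gamma>(2)] integral_curve_subset[OF e], where S="{-a<..<a/2}" and s="-a/2"])
       (use a \<eta>(1) that in auto)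
  define \<beta> where "\<beta> = (\<lambda>t. if \<bar>t\<bar> < a then \<gamma> t else if t > 0 then \<delta> (t + -a/2) else \<eta> (t + a/2))"
  have "integral_curve {-(3/2*a)<..<3/2*a} \<beta>"
  proof (rule integral_curve_local)
    fix t assume t: "t \<in> {-(3/2*a)<..<3/2*a}"
    consider "\<bar>t\<bar> < a" | "t \<ge> a" | "t \<le> -a" by linarith
    then show "\<exists>T \<delta>. open T \<and> t \<in> T \<and> integral_curve T \<delta> \<and> (\<forall>s\<in>T. \<delta> s = \<beta> s)"
    proof cases
      case 1
      show ?thesis
        by (intro exI[of _ "{-a<..<a}"] exI[of _ \<gamma>] conjI \<gamma>(2)) (use 1 in \<open>auto simp: \<beta>_def\<close>)
    next
      case 2
      show ?thesis
      proof (intro exI conjI)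
        show "integral_curve {0<..<3/2*a} (\<lambda>t. \<delta> (t + -a/2))"
          by (rule integral_curve_subset[OF d]) (use a in auto)
        show "\<forall>s\<in>{0<..<3/2*a}. \<delta> (s + -a/2) = \<beta> s"
          using eqd a by (auto simp: \<beta>_def)
      qed (use 2 a t in auto)
    next
      case 3
      show ?thesis
      proof (intro exI conjI)
        show "integral_curve {-(3/2*a)<..<0} (\<lambda>t. \<eta> (t + a/2))"
          by (rule integral_curve_subset[OF e]) (use a in auto)
        show "\<forall>s\<in>{-(3/2*a)<..<0}. \<eta> (s + a/2) = \<beta> s"
          using eqe a by (auto simp: \<beta>_def)
      qed (use 3 a t in auto)
    qed
  qed
  then show ?thesis using \<gamma>(1) a by (intro exI[of _ \<beta>]) (simp add: \<beta>_def)
qed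

lemma integral_curve_exists_bounded: "\<exists>\<gamma>. \<gamma> 0 = x \<and> integral_curve {-b<..<b} \<gamma>"
proof -
  obtain \<tau> where \<tau>: "\<tau> > 0" "\<forall>x. \<exists>\<gamma>. \<gamma> 0 = x \<and> integral_curve {-\<tau><..<\<tau>} \<gamma>"
    by (rule integral_curve_exists_uniform)
  have P: "\<forall>x. \<exists>\<gamma>. \<gamma> 0 = x \<and> integral_curve {-((3/2)^n * \<tau>)<..<(3/2)^n * \<tau>} \<gamma>" for n
  proof (induction n)
    case 0
    then show ?case using \<tau>(2) by simp
  next
    case (Suc n)
    show ?case
    proof
      fix x
      show "\<exists>\<gamma>. \<gamma> 0 = x \<and> integral_curve {-((3/2)^Suc n * \<tau>)<..<(3/2)^Suc n * \<tau>} \<gamma>"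
        using integral_curve_extend[of "(3/2)^n * \<tau>" x] Suc.IH \<tau>(1) by (simp add: mult.assoc)
    qed
  qed
  obtain n where "b / \<tau> < (3/2)^n" using real_arch_pow[of "3/2" "b / \<tau>"] by auto
  then have "b < (3/2)^n * \<tau>" using \<tau>(1) by (simp add: pos_divide_less_eq)
  then have sub: "{-b<..<b} \<subseteq> {-((3/2)^n * \<tau>)<..<(3/2)^n * \<tau>}" by auto
  obtain \<gamma> where "\<gamma> 0 = x" "integral_curve {-((3/2)^n * \<tau>)<..<(3/2)^n * \<tau>} \<gamma>" using P by blast
  then show ?thesis using integral_curve_subset[OF _ sub] by blast
qed

lemma integral_curve_ex1: "\<exists>!\<gamma>. integral_curve UNIV \<gamma> \<and> \<gamma> 0 = x"
proof -
  obtain G where G: "\<And>b. G b 0 = x \<and> integral_curve {-b<..<b} (G b)"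
    using integral_curve_exists_bounded[of x] by metis
  \<comment> \<open>At time \<open>t\<close> any curve that lives beyond
    \<open>\<bar>t\<bar>\<close> may be used; uniqueness makes the value independent of its
    lifetime.\<close>
  define \<gamma> where "\<gamma> = (\<lambda>t. G (\<bar>t\<bar> + 1) t)"
  have "integral_curve UNIV \<gamma>"
  proof (rule integral_curve_local)
    fix t :: real
    let ?b = "\<bar>t\<bar> + 1"
    have "G ?b s = \<gamma> s" if s: "s \<in> {-?b<..<?b}" for s
    proof -
      define m where "m = min ?b (\<bar>s\<bar> + 1)"
      have "integral_curve {-m<..<m} (G ?b)" "integral_curve {-m<..<m} (G (\<bar>s\<bar> + 1))"
        by (rule integral_curve_subset[OF conjunct2[OF G]], auto simp: m_def)+
      then have "G ?b s = G (\<bar>s\<bar> + 1) s"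
        by (rule integral_curve_unique[where s=0]) (use G s in \<open>auto simp: m_def\<close>)
      then show ?thesis unfolding \<gamma>_def .
    qed
    then have "\<forall>s\<in>{-?b<..<?b}. G ?b s = \<gamma> s" by blast
    moreover have "open {-?b<..<?b}" "t \<in> {-?b<..<?b}" by auto
    moreover have "integral_curve {-?b<..<?b} (G ?b)" by (rule conjunct2[OF G])
    ultimately show "\<exists>T \<delta>. open T \<and> t \<in> T \<and> integral_curve T \<delta> \<and> (\<forall>s\<in>T. \<delta> s = \<gamma> s)"
      by metis
  qed
  moreover have "\<gamma> 0 = x" using G by (simp add: \<gamma>_def)
  moreover have "\<delta> = \<gamma>" if "integral_curve UNIV \<gamma>" "\<gamma> 0 = x" "integral_curve UNIV \<delta> \<and> \<delta> 0 = x" for \<delta>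
  proof
    fix t
    show "\<delta> t = \<gamma> t"
      by (rule integral_curve_unique[of UNIV \<delta> \<gamma> 0]) (use that in auto)
  qed
  ultimately show ?thesis by blast
qed

section \<open>The global flow and its continuity in the starting point\<close>

definition flow_line :: "real \<Rightarrow> 'm \<Rightarrow> 'm"
  where "flow_line t x = (THE \<gamma>. integral_curve UNIV \<gamma> \<and> \<gamma> 0 = x) t"

lemma flow_line_curve: "integral_curve UNIV (\<lambda>t. flow_line t x)" and flow_line_0 [simp]: "flow_line 0 x = x"
  using theI'[OF integral_curve_ex1[of x]] by (auto simp: flow_line_def)

lemma flow_line_unique:
  assumes "integral_curve S \<gamma>" "open S" "connected S" "0 \<in> S" "t \<in> S"
  shows "\<gamma> t = flow_line t (\<gamma> 0)"
  by (rule integral_curve_unique[OF assms(1) integral_curve_subset[OF flow_line_curve subset_UNIV] assms(2,3,4) _ assms(5)]) simp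

lemma flow_line_add: "flow_line (s + t) x = flow_line s (flow_line t x)"
proof -
  have "integral_curve {s. s + t \<in> UNIV} (\<lambda>s. flow_line (s + t) x)"
    by (rule integral_curve_shift[OF flow_line_curve])
  then have "integral_curve UNIV (\<lambda>s. flow_line (s + t) x)" by simp
  from flow_line_unique[OF this open_UNIV connected_UNIV, of s] show ?thesis by simp
qed

lemma flow_line_isCont: "isCont (\<lambda>t. flow_line t x) t"
  using integral_curve_isCont[OF flow_line_curve] by blast

lemma flow_line_continuous_small:
  obtains \<tau> where "\<tau> > 0" "\<forall>t. \<bar>t\<bar> < \<tau> \<longrightarrow> continuous_on UNIV (flow_line t)"
proof -
  define good where "good = (\<lambda>U \<tau>. open U \<and> \<tau> > (0::real) \<and> (\<forall>t. \<bar>t\<bar> < \<tau> \<longrightarrow> continuous_on U (flow_line t)))"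
  have "\<exists>U \<tau>. p \<in> U \<and> good U \<tau>" for p
  proof -
    obtain c r L \<tau> where c: "c \<in> A" "p \<in> fst c" "r > 0" and r: "cball (snd c p) (2 * r) \<subseteq> snd c ` fst c"
      and L: "L-lipschitz_on (cball (snd c p) (2 * r)) (in_chart c (V c))" and \<tau>: "\<tau> > 0"
        "\<forall>u\<in>ball (snd c p) r. \<exists>\<phi>. \<phi> 0 = u \<and> (\<forall>s\<in>{-\<tau><..<\<tau>}. \<phi> s \<in> cball (snd c p) (2 * r) \<and>
        (\<phi> has_vector_derivative in_chart c (V c) (\<phi> s)) (at s))"
      by (rule chart_flow_box)
    let ?B = "ball (snd c p) r" and ?C = "cball (snd c p) (2 * r)" and ?i = "inv_into (fst c) (snd c)"
    have B: "?B \<subseteq> snd c ` fst c" using r c(3) by auto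
    obtain \<phi> where \<phi>: "\<And>u. u \<in> ?B \<Longrightarrow> \<phi> u 0 = u \<and> (\<forall>s\<in>{-\<tau><..<\<tau>}. \<phi> u s \<in> ?C \<and>
        (\<phi> u has_vector_derivative in_chart c (V c) (\<phi> u s)) (at s))"
      using \<tau>(2) by metis
    have fl: "flow_line t x = ?i (\<phi> (snd c x) t)" if x: "x \<in> fst c" "snd c x \<in> ?B" and t: "\<bar>t\<bar> < \<tau>" for x t
    proof -
      have "integral_curve {-\<tau><..<\<tau>} (\<lambda>t. ?i (\<phi> (snd c x) t))"
        by (rule integral_curve_from_chart[OF c(1)]) (use \<phi>[OF x(2)] r in blast)+
      then have "?i (\<phi> (snd c x) t) = flow_line t (?i (\<phi> (snd c x) 0))"
        by (rule flow_line_unique) (use t \<tau>(1) in auto)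
      then show ?thesis using \<phi>[OF x(2)] x(1) c(1) by simp
    qed
    have sol: "\<phi> u t \<in> ?C \<and> (\<phi> u has_vector_derivative in_chart c (V c) (\<phi> u t)) (at t)"
      if "u \<in> ?B" "\<bar>t\<bar> < \<tau>" for u t
    proof -
      have "t \<in> {-\<tau><..<\<tau>}" using that(2) by auto
      then show ?thesis using \<phi>[OF that(1)] by blast
    qed
    have cont: "continuous_on ?B (\<lambda>u. \<phi> u t)" if t: "\<bar>t\<bar> < \<tau>" for t
    proof -
      have "dist (\<phi> u t) (\<phi> u' t) \<le> exp (L * \<bar>t\<bar>) * dist u u'" if "u \<in> ?B" "u' \<in> ?B" for u u'
      proof -
        have "dist (\<phi> u t) (\<phi> u' t) \<le> exp (L * \<bar>t\<bar>) * dist (\<phi> u 0) (\<phi> u' 0)"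
          by (rule gronwall_dist[OF L _ _ _ t]) (use sol[OF that(1)] sol[OF that(2)] in auto)
        then show ?thesis using \<phi>[OF that(1)] \<phi>[OF that(2)] by simp
      qed
      then have "(exp (L * \<bar>t\<bar>))-lipschitz_on ?B (\<lambda>u. \<phi> u t)" by (intro lipschitz_onI) auto
      then show ?thesis by (rule lipschitz_on_continuous_on)
    qed
    let ?U = "?i ` ?B"
    have memU: "x \<in> ?U \<longleftrightarrow> x \<in> fst c \<and> snd c x \<in> ?B" for x by (rule mem_inv_image_iff[OF c(1) B])
    have "continuous_on ?U (flow_line t)" if t: "\<bar>t\<bar> < \<tau>" for t
    proof -
      have c1: "continuous_on ?U (snd c)"
        by (rule continuous_on_subset[OF continuous_on_chart[OF c(1)]]) (use memU in blast)
      have c2: "continuous_on ?U (\<lambda>x. \<phi> (snd c x) t)"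
        by (rule continuous_on_compose2[OF cont[OF t] c1]) (use memU in blast)
      have c3: "continuous_on ?U (\<lambda>x. ?i (\<phi> (snd c x) t))"
      proof (rule continuous_on_compose2[OF continuous_on_inv_chart[OF c(1)] c2], rule image_subsetI)
        fix x assume "x \<in> ?U"
        then have "snd c x \<in> ?B" using memU by blast
        then have "\<phi> (snd c x) t \<in> ?C" using sol t by blast
        then show "\<phi> (snd c x) t \<in> snd c ` fst c" using r by blast
      qed
      show ?thesis
        by (rule continuous_on_eq[OF c3]) (use fl[OF _ _ t] memU in auto)
    qed
    moreover have "open ?U" by (rule open_inv_chart_image[OF c(1) open_ball B])
    moreover have "p \<in> ?U" using memU c by simp
    ultimately show ?thesis using \<tau>(1) unfolding good_def by blast
  qed
  then obtain U T where UT: "\<And>p. p \<in> U p \<and> good (U p) (T p)" by metis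
  have "\<exists>I\<subseteq>UNIV. finite I \<and> UNIV \<subseteq> (\<Union>x\<in>I. U x)"
    by (rule compact_finite_cover[OF compact_UNIV]) (use UT in \<open>auto simp: good_def\<close>)
  then obtain I where I: "finite I" "UNIV \<subseteq> (\<Union>x\<in>I. U x)" by blast
  define \<tau> where "\<tau> = Min (insert 1 (T ` I))"
  have "\<tau> > 0" unfolding \<tau>_def using I UT by (auto simp: good_def)
  moreover have "continuous_on UNIV (flow_line t)" if t: "\<bar>t\<bar> < \<tau>" for t
  proof (rule continuous_at_imp_continuous_on, rule ballI)
    fix x :: 'm
    obtain p where p: "p \<in> I" "x \<in> U p" using I by blast
    have "\<tau> \<le> T p" unfolding \<tau>_def using p I by simp
    then have "continuous_on (U p) (flow_line t)" "open (U p)" using UT[of p] t unfolding good_def by auto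
    then show "isCont (flow_line t) x" using p continuous_on_eq_continuous_at by blast
  qed
  ultimately show ?thesis using that by blast
qed

text \<open>A long time is cut into equal steps short enough for the chartwise Gronwall estimate,
  and the time-\<open>t\<close> map is a composition of these.\<close>

lemma flow_line_continuous: "continuous_on UNIV (flow_line t)"
proof -
  obtain \<tau> where \<tau>: "\<tau> > 0" "\<forall>t. \<bar>t\<bar> < \<tau> \<longrightarrow> continuous_on UNIV (flow_line t)"
    by (rule flow_line_continuous_small)
  obtain n :: nat where n: "\<bar>t\<bar> / \<tau> < real n" using reals_Archimedean2 by blast
  moreover have "\<bar>t\<bar> / \<tau> \<ge> 0" using \<tau>(1) by simp
  ultimately have n0: "n > 0" by linarith
  define s where "s = t / n"
  have "\<bar>t\<bar> < n * \<tau>" using n \<tau>(1) by (simp add: pos_divide_less_eq)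
  then have "\<bar>s\<bar> < \<tau>" using n0 by (simp add: s_def field_simps)
  then have cs: "continuous_on UNIV (flow_line s)" using \<tau> by blast
  have "continuous_on UNIV (flow_line (real k * s))" for k :: nat
  proof (induction k)
    case 0
    have "flow_line (real 0 * s) = (\<lambda>x. x)" by (simp add: fun_eq_iff)
    then show ?case by (simp only: continuous_on_id)
  next
    case (Suc k)
    have "flow_line (real (Suc k) * s) = (\<lambda>x. flow_line s (flow_line (real k * s) x))"
      by (simp add: fun_eq_iff flow_line_add[symmetric] algebra_simps)
    then show ?case
      using continuous_on_compose2[OF cs Suc.IH] by simp
  qed
  from this[of n] show ?thesis using n0 by (simp add: s_def)
qed

lemma open_flow_line_image:
  assumes "open U"
  shows "open (flow_line t ` U)"
proof -
  have "flow_line t ` U = flow_line (-t) -` U"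
    by (auto simp: image_iff flow_line_add[symmetric]) (metis add.right_inverse flow_line_0 flow_line_add)
  then show ?thesis
    using continuous_open_preimage[OF flow_line_continuous open_UNIV assms, of "-t"] by simp
qed

end

section \<open>Dynamics near a nondegenerate critical point\<close>

lemma pos_def_bounded_below:
  fixes P :: "real^'n^'n"
  assumes "\<And>v. v \<noteq> 0 \<Longrightarrow> v \<bullet> (P *v v) > 0"
  obtains m where "m > 0" "\<forall>v. m * (norm v)^2 \<le> v \<bullet> (P *v v)"
proof -
  have cont: "continuous_on (sphere 0 1) (\<lambda>v. v \<bullet> (P *v v))"
    by (intro continuous_intros linear_continuous_on matrix_vector_mul_bounded_linear)
  have ne: "sphere (0::real^'n) 1 \<noteq> {}" by simp
  obtain w where w: "w \<in> sphere 0 1" "\<And>v. v \<in> sphere 0 1 \<Longrightarrow> w \<bullet> (P *v w) \<le> v \<bullet> (P *v v)"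
    using continuous_attains_inf[OF compact_sphere ne cont] by blast
  let ?m = "w \<bullet> (P *v w)"
  have "?m * (norm v)^2 \<le> v \<bullet> (P *v v)" for v
  proof (cases "v = 0")
    case False
    let ?u = "inverse (norm v) *\<^sub>R v"
    have "?m \<le> ?u \<bullet> (P *v ?u)" using False by (intro w(2)) simp
    also have "\<dots> = (v \<bullet> (P *v v)) / (norm v)^2"
      by (simp add: matrix_vector_mult_scaleR power2_eq_square divide_inverse)
    finally show ?thesis using False by (simp add: pos_le_divide_eq)
  qed simp
  moreover have "?m > 0"
  proof (rule assms)
    show "w \<noteq> 0" using w(1) by (cases "w = 0") auto
  qed
  ultimately show ?thesis using that by blast
qed

lemma symmetric_matrix_inner:
  fixes H :: "real^'n^'n"
  shows "transpose H = H \<Longrightarrow> x \<bullet> (H *v y) = (H *v x) \<bullet> y"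
  by (metis dot_lmul_matrix inner_commute transpose_matrix_vector)

lemma det_nonzero_bounded_below:
  fixes H :: "real^'n^'n"
  assumes "det H \<noteq> 0"
  obtains k where "k > 0" "\<forall>v. k * norm v \<le> norm (H *v v)"
proof -
  have "inj ((*v) H)" using assms by (simp add: inj_matrix_vector_mult invertible_det_nz)
  then show ?thesis
    using linear_inj_bounded_below_pos[of "(*v) H"] that by (metis matrix_vector_mul_linear)
qed

text \<open>If the form vanished at \<open>v\<close>, put \<open>w = H v\<close>, which is nonzero.
  The form at \<open>v + t w\<close> is \<open>2 t (w \<bullet> w) + t^2 a\<close>, so a small
  negative \<open>t\<close> would make it negative.\<close>

lemma semidefinite_nondegenerate_pos_def:
  fixes H :: "real^'n^'n"
  assumes sym: "transpose H = H" and det: "det H \<noteq> 0" and semi: "\<And>v. v \<bullet> (H *v v) \<ge> 0" and v: "v \<noteq> 0"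
  shows "v \<bullet> (H *v v) > 0"
proof (rule ccontr)
  assume "\<not> ?thesis"
  then have v0: "v \<bullet> (H *v v) = 0" using semi[of v] by simp
  let ?w = "H *v v"
  have "?w \<noteq> 0"
  proof
    assume "?w = 0"
    moreover obtain k where "k > 0" "\<forall>v. k * norm v \<le> norm (H *v v)" by (rule det_nonzero_bounded_below[OF det])
    ultimately show False using v by (metis mult_pos_pos norm_zero not_le zero_less_norm_iff)
  qed
  then have w: "?w \<bullet> ?w > 0" by simp
  define a where "a = ?w \<bullet> (H *v ?w)"
  \<comment> \<open>This choice gives \<open>\<bar>t\<bar> * a \<le> ?w \<bullet> ?w\<close>, so the
    linear term prevails; the summand 1 covers the case \<open>a = 0\<close>.\<close>
  define t where "t = - (?w \<bullet> ?w) / (a + 1)"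
  have a: "a \<ge> 0" using semi unfolding a_def by simp
  have "(v + t *\<^sub>R ?w) \<bullet> (H *v (v + t *\<^sub>R ?w)) = 2 * t * (?w \<bullet> ?w) + t^2 * a"
    using v0 symmetric_matrix_inner[OF sym, of v ?w]
    by (simp add: matrix_vector_right_distrib matrix_vector_mult_scaleR inner_add a_def power2_eq_square algebra_simps)
  also have "\<dots> = t * (2 * (?w \<bullet> ?w) + t * a)" by (simp add: power2_eq_square algebra_simps)
  also have "\<dots> < 0"
  proof (rule mult_neg_pos)
    show "t < 0" unfolding t_def using w a by (simp add: divide_neg_pos)
    have "t * a = - (?w \<bullet> ?w) * (a / (a + 1))" by (simp add: t_def)
    moreover have "(?w \<bullet> ?w) * (a / (a + 1)) \<le> (?w \<bullet> ?w) * 1" using w a by (intro mult_left_mono) auto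
    ultimately show "2 * (?w \<bullet> ?w) + t * a > 0" using w by linarith
  qed
  finally show False using semi[of "v + t *\<^sub>R ?w"] by simp
qed

text \<open>Near \<open>u\<close> the linear part, of size at least \<open>k * norm d\<close>,
  dominates the remainder, of size at most half of that.\<close>

lemma critical_point_isolated_plane:
  assumes der: "(G has_derivative (\<lambda>v. H *v v)) (at u)" and "G u = 0" "det H \<noteq> 0"
  obtains r where "r > 0" "\<forall>w\<in>ball u r. G w = 0 \<longrightarrow> w = (u :: real^2)"
proof -
  obtain k where k: "k > 0" "\<forall>v. k * norm v \<le> norm (H *v v)" by (rule det_nonzero_bounded_below[OF assms(3)])
  have "k / 2 > 0" using k by simp
  then obtain d where d: "d > 0" "\<And>y. norm (y - u) < d \<Longrightarrow> norm (G y - G u - H *v (y - u)) \<le> k / 2 * norm (y - u)"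
    using der unfolding has_derivative_at_alt by blast
  have "w = u" if "w \<in> ball u d" "G w = 0" for w
  proof -
    have "norm (H *v (w - u)) \<le> k / 2 * norm (w - u)"
      using d(2)[of w] that assms(2) by (simp add: dist_norm norm_minus_commute)
    then have "k * norm (w - u) \<le> k / 2 * norm (w - u)" using k(2) order_trans by blast
    then have "norm (w - u) \<le> 0" using k(1) by simp
    then show ?thesis by simp
  qed
  then show ?thesis using that d(1) by blast
qed

text \<open>Along each ray from \<open>u\<close> the function does not decrease: the remainder of
  the gradient is too small to overcome the lower bound \<open>m\<close> of the Hessian
  form.\<close>

lemma pos_def_hessian_local_min:
  assumes S: "open S" "u \<in> S" and h: "Ck_on (Suc (Suc 0)) S h"
    and grad: "euclidean_gradient h u = 0"
    and pos: "\<And>v. v \<noteq> 0 \<Longrightarrow> v \<bullet> (euclidean_hessian h u *v v) > 0"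
  shows "\<exists>r>0. \<forall>w\<in>ball u r. h u \<le> h w"
proof -
  let ?H = "euclidean_hessian h u" and ?G = "euclidean_gradient h"
  obtain m where m: "m > 0" "\<forall>v. m * (norm v)^2 \<le> v \<bullet> (?H *v v)" by (rule pos_def_bounded_below[OF pos])
  obtain d where d: "d > 0" "\<And>y. norm (y - u) < d \<Longrightarrow> norm (?G y - ?G u - ?H *v (y - u)) \<le> m * norm (y - u)"
    using gradient_has_derivative[OF S h] m(1) unfolding has_derivative_at_alt by blast
  obtain e where e: "e > 0" "ball u e \<subseteq> S" using S openE by blast
  define r where "r = min d e"
  have "h u \<le> h w" if w: "w \<in> ball u r" for w
  proof -
    let ?v = "w - u"
    have nv: "norm ?v < r" using w by (simp add: dist_norm norm_minus_commute)
    have "\<exists>y. ((\<lambda>t. h (u + t *\<^sub>R ?v)) has_real_derivative y) (at t) \<and> 0 \<le> y" if t: "0 \<le> t" "t \<le> 1" for t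
    proof (intro exI conjI)
      let ?x = "u + t *\<^sub>R ?v"
      have nx: "norm (?x - u) < r"
      proof -
        have "norm (?x - u) = t * norm ?v" using t by simp
        also have "\<dots> \<le> 1 * norm ?v" by (rule mult_right_mono) (use t in auto)
        finally show ?thesis using nv by simp
      qed
      then have "?x \<in> ball u e" by (simp add: dist_norm norm_minus_commute r_def)
      then have "?x \<in> S" using e by blast
      then have hd: "(h has_derivative (\<lambda>v. ?G ?x \<bullet> v)) (at ?x)"
        using Ck_on_has_derivative[OF h] frechet_derivative_gradient[of h ?x] h
        by (metis (no_types, lifting) Derivative.differentiableI ext)
      have ld: "((\<lambda>t. u + t *\<^sub>R ?v) has_derivative (\<lambda>s. s *\<^sub>R ?v)) (at t)"
        by (auto intro!: derivative_eq_intros)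
      show "((\<lambda>t. h (u + t *\<^sub>R ?v)) has_real_derivative ?G ?x \<bullet> ?v) (at t)"
        using has_derivative_compose[OF ld hd] unfolding has_field_derivative_def
        by (simp add: mult_commute_abs)
      have "\<bar>(?G ?x - ?H *v (t *\<^sub>R ?v)) \<bullet> ?v\<bar> \<le> norm (?G ?x - ?H *v (t *\<^sub>R ?v)) * norm ?v"
        by (rule Cauchy_Schwarz_ineq2)
      also have "\<dots> \<le> (m * norm (t *\<^sub>R ?v)) * norm ?v"
        using d(2)[of ?x] nx grad by (intro mult_right_mono) (auto simp: r_def)
      also have "\<dots> = t * (m * (norm ?v)^2)" using t by (simp add: power2_eq_square)
      also have "\<dots> \<le> t * (?v \<bullet> (?H *v ?v))" by (rule mult_left_mono) (use m t in auto)
      also have "\<dots> = (?H *v (t *\<^sub>R ?v)) \<bullet> ?v" by (simp add: matrix_vector_mult_scaleR inner_commute)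
      finally show "0 \<le> ?G ?x \<bullet> ?v" by (simp add: inner_diff_left abs_le_iff)
    qed
    then have "h (u + 0 *\<^sub>R ?v) \<le> h (u + 1 *\<^sub>R ?v)"
      by (intro DERIV_nonneg_imp_nondecreasing[of 0 1 "\<lambda>t. h (u + t *\<^sub>R ?v)"]) auto
    then show ?thesis by simp
  qed
  moreover have "r > 0" using d e by (simp add: r_def)
  ultimately show ?thesis by blast
qed

text \<open>For the linearization \<open>d' = - P H d\<close> the quadratic form of \<open>H\<close> is a Lyapunov function:
  its derivative is \<open>- 2 (H d) \<bullet> P (H d)\<close>. So two solutions that tend to \<open>u\<close> cannot differ
  by a vector on which the form is negative.\<close>

lemma no_convergence_in_negative_direction:
  fixes v :: "real^2 \<Rightarrow> real^2"
  assumes S: "open S" "u \<in> S" and v: "Ck_on (Suc 0) S v"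
    and Dv: "\<And>d. frechet_derivative v (at u) d = - (P *v (H *v d))"
    and P: "\<And>w. w \<noteq> 0 \<Longrightarrow> w \<bullet> (P *v w) > 0" and sym: "transpose H = H" and det: "det H \<noteq> 0"
  obtains r where "r > 0" "cball u r \<subseteq> S"
    "\<forall>x y. (\<forall>t\<ge>0. x t \<in> cball u r \<and> (x has_vector_derivative v (x t)) (at t)) \<longrightarrow>
      (\<forall>t\<ge>0. y t \<in> cball u r \<and> (y has_vector_derivative v (y t)) (at t)) \<longrightarrow>
      (x \<longlongrightarrow> u) at_top \<longrightarrow> (y \<longlongrightarrow> u) at_top \<longrightarrow> 0 \<le> (x 0 - y 0) \<bullet> (H *v (x (0::real) - y 0))"
proof -
  obtain m where m: "m > 0" "\<forall>w. m * (norm w)^2 \<le> w \<bullet> (P *v w)" by (rule pos_def_bounded_below[OF P])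
  obtain k where k: "k > 0" "\<forall>w. k * norm w \<le> norm (H *v w)" by (rule det_nonzero_bounded_below[OF det])
  have mk: "m * k > 0" using m k by simp
  \<comment> \<open>The constant \<open>m * k\<close> is what the main term absorbs: an error of
    norm at most \<open>m * k * norm d\<close>, paired with \<open>H d\<close>, contributes at most
    \<open>m * (norm (H d))^2\<close>, and the term with \<open>P\<close> contributes no more than
    the negative of this.\<close>
  obtain r where r: "r > 0" "cball u r \<subseteq> S" "(m * k)-lipschitz_on (cball u r) (\<lambda>x. v x - frechet_derivative v (at u) x)"
    by (rule C1_strictly_differentiable[OF S(1) v S(2) mk])
  show ?thesis
  proof (rule that[OF r(1,2)], intro allI impI)
    fix x y :: "real \<Rightarrow> real^2"
    assume x: "\<forall>t\<ge>0. x t \<in> cball u r \<and> (x has_vector_derivative v (x t)) (at t)"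
      and y: "\<forall>t\<ge>0. y t \<in> cball u r \<and> (y has_vector_derivative v (y t)) (at t)"
      and lim: "(x \<longlongrightarrow> u) at_top" "(y \<longlongrightarrow> u) at_top"
    define q where "q = (\<lambda>t. (x t - y t) \<bullet> (H *v (x t - y t)))"
    have bl: "bounded_linear ((*v) H)" by (rule matrix_vector_mul_bounded_linear)
    have dq: "\<exists>z. (q has_real_derivative z) (at t) \<and> z \<le> 0" if t: "t \<ge> 0" for t
    proof (intro exI conjI)
      let ?d = "x t - y t" and ?d' = "v (x t) - v (y t)"
      have dd: "((\<lambda>s. x s - y s) has_derivative (\<lambda>h. h *\<^sub>R ?d')) (at t)"
        using has_vector_derivative_diff x y t unfolding has_vector_derivative_def[symmetric] by blast
      have "((\<lambda>s. (x s - y s) \<bullet> (H *v (x s - y s))) has_derivative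
          (\<lambda>h. ?d \<bullet> (H *v (h *\<^sub>R ?d')) + (h *\<^sub>R ?d') \<bullet> (H *v ?d))) (at t)"
        by (rule has_derivative_inner[OF dd bounded_linear.has_derivative[OF bl dd]])
      moreover have "(\<lambda>h. ?d \<bullet> (H *v (h *\<^sub>R ?d')) + (h *\<^sub>R ?d') \<bullet> (H *v ?d)) = (*) (2 * ((H *v ?d) \<bullet> ?d'))"
      proof
        fix h
        have "?d \<bullet> (H *v (h *\<^sub>R ?d')) = (H *v ?d) \<bullet> (h *\<^sub>R ?d')"
          by (rule symmetric_matrix_inner[OF sym])
        then have "?d \<bullet> (H *v (h *\<^sub>R ?d')) = h * ((H *v ?d) \<bullet> ?d')"
          by (simp add: inner_commute)
        moreover have "(h *\<^sub>R ?d') \<bullet> (H *v ?d) = h * ((H *v ?d) \<bullet> ?d')"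
          by (simp add: inner_commute)
        ultimately show "?d \<bullet> (H *v (h *\<^sub>R ?d')) + (h *\<^sub>R ?d') \<bullet> (H *v ?d) = 2 * ((H *v ?d) \<bullet> ?d') * h"
          by simp
      qed
      ultimately show "(q has_real_derivative 2 * ((H *v ?d) \<bullet> ?d')) (at t)"
        unfolding q_def has_field_derivative_def by simp
      let ?e = "?d' + P *v (H *v ?d)"
      have e: "norm ?e \<le> m * k * norm ?d"
      proof -
        have eq: "?e = (v (x t) - frechet_derivative v (at u) (x t)) - (v (y t) - frechet_derivative v (at u) (y t))"
          by (simp add: Dv matrix_vector_mult_diff_distrib)
        show ?thesis
          unfolding eq using lipschitz_onD[OF r(3), of "x t" "y t"] x y t by (simp add: dist_norm)
      qed
      have "(H *v ?d) \<bullet> ?d' = (H *v ?d) \<bullet> ?e - (H *v ?d) \<bullet> (P *v (H *v ?d))"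
        by (simp add: inner_add_right)
      also have "\<dots> \<le> norm (H *v ?d) * norm ?e - m * (norm (H *v ?d))^2"
        using norm_cauchy_schwarz[of "H *v ?d" ?e] m(2) by (intro diff_mono) auto
      also have "\<dots> \<le> norm (H *v ?d) * (m * (k * norm ?d)) - m * (norm (H *v ?d))^2"
        using e by (intro diff_right_mono mult_left_mono) (auto simp: mult.assoc)
      also have "\<dots> \<le> norm (H *v ?d) * (m * norm (H *v ?d)) - m * (norm (H *v ?d))^2"
        using k(2) m(1) by (intro diff_right_mono mult_left_mono) auto
      also have "\<dots> = 0" by (simp add: power2_eq_square)
      finally show "2 * ((H *v ?d) \<bullet> ?d') \<le> 0" by simp
    qed
    \<comment> \<open>A nonincreasing function with limit 0 starts at a nonnegative value.\<close>
    have "q t \<le> q 0" if "t \<ge> 0" for t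
      by (rule DERIV_nonpos_imp_nonincreasing[OF that dq]) auto
    then have ev: "\<forall>\<^sub>F t in at_top. q t \<le> q 0" by (rule eventually_mono[OF eventually_ge_at_top])
    have "((\<lambda>t. x t - y t) \<longlongrightarrow> u - u) at_top" by (rule tendsto_diff[OF lim])
    then have "(q \<longlongrightarrow> (u - u) \<bullet> (H *v (u - u))) at_top"
      unfolding q_def by (intro tendsto_inner bounded_linear.tendsto[OF bl])
    then have "(u - u) \<bullet> (H *v (u - u)) \<le> q 0"
      by (rule tendsto_upperbound[OF _ ev]) simp
    then show "0 \<le> (x 0 - y 0) \<bullet> (H *v (x 0 - y 0))" by (simp add: q_def)
  qed
qed

lemma matrix_inv_inverse:
  fixes P :: "real^'n^'n"
  assumes "det P \<noteq> 0"
  shows "P ** matrix_inv P = mat 1" "matrix_inv P ** P = mat 1"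
proof -
  have "\<exists>B. P ** B = mat 1 \<and> B ** P = mat 1"
    using assms unfolding invertible_det_nz[symmetric] invertible_def .
  from someI_ex[OF this] show "P ** matrix_inv P = mat 1" "matrix_inv P ** P = mat 1"
    unfolding matrix_inv_def by auto
qed

text \<open>The explicit adjugate shows the entries of the inverse as smooth expressions in the
  entries of the matrix.\<close>

lemma matrix_inv_2:
  fixes P :: "real^2^2"
  assumes "det P \<noteq> 0"
  shows "matrix_inv P = inverse (det P) *\<^sub>R vector [vector [P $ 2 $ 2, - P $ 1 $ 2], vector [- P $ 2 $ 1, P $ 1 $ 1]]"
    (is "_ = ?Q")
proof -
  have D: "P $ 1 $ 1 * P $ 2 $ 2 = det P + P $ 1 $ 2 * P $ 2 $ 1" by (simp add: det_2)
  have "P ** ?Q = mat 1"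
    using assms D by (simp add: vec_eq_iff forall_2 matrix_matrix_mult_def sum_2 mat_def field_simps)
  then have "matrix_inv P ** (P ** ?Q) = matrix_inv P" by simp
  then show ?thesis by (simp add: matrix_mul_assoc matrix_inv_inverse[OF assms])
qed

lemma pos_def_det_nonzero:
  fixes P :: "real^'n^'n"
  assumes "\<And>v. v \<noteq> 0 \<Longrightarrow> v \<bullet> (P *v v) > 0"
  shows "det P \<noteq> 0"
proof -
  have "P *v v = 0 \<Longrightarrow> v = 0" for v
    using assms[of v] by force
  then have "\<exists>B. B ** P = mat 1" unfolding matrix_left_invertible_ker by blast
  then show ?thesis using invertible_det_nz invertible_left_inverse by blast
qed

lemma pos_def_matrix_inv:
  fixes P :: "real^'n^'n"
  assumes pos: "\<And>v. v \<noteq> 0 \<Longrightarrow> v \<bullet> (P *v v) > 0" and w: "w \<noteq> 0"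
  shows "w \<bullet> (matrix_inv P *v w) > 0"
proof -
  let ?z = "matrix_inv P *v w"
  have "P *v ?z = w"
    by (simp add: matrix_vector_mul_assoc matrix_inv_inverse[OF pos_def_det_nonzero[OF pos]])
  then have "?z \<noteq> 0" "w \<bullet> ?z = ?z \<bullet> (P *v ?z)" using w by (auto simp: inner_commute)
  then show ?thesis using pos by simp
qed

section \<open>Gradient flows of Morse functions\<close>

lemma has_derivative_vec_nth:
  fixes f :: "real^'m \<Rightarrow> real^'n"
  assumes "\<And>i. ((\<lambda>x. f x $ i) has_derivative (\<lambda>h. f' h $ i)) (at u)"
  shows "(f has_derivative f') (at u)"
  unfolding has_derivative_componentwise_within[of f]
  using assms by (auto simp: Basis_vec_def inner_axis)

text \<open>In the product rule the derivative of \<open>M\<close> is applied to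
  \<open>G u = 0\<close>. Hence derivatives of the metric do not enter the linearization of the
  gradient field at a critical point.\<close>

lemma has_derivative_matrix_vector_at_zero:
  fixes M :: "real^2 \<Rightarrow> real^2^2"
  assumes M: "\<And>i j. (\<lambda>x. M x $ i $ j) differentiable (at u)"
    and G: "(G has_derivative G') (at u)" and "G u = 0"
  shows "((\<lambda>x. M x *v G x) has_derivative (\<lambda>d. M u *v G' d)) (at u)"
proof (rule has_derivative_vec_nth)
  fix i
  have Md: "((\<lambda>x. M x $ i $ j) has_derivative frechet_derivative (\<lambda>x. M x $ i $ j) (at u)) (at u)" for j
    using M frechet_derivative_works by blast
  have Gd: "((\<lambda>x. G x $ j) has_derivative (\<lambda>d. G' d $ j)) (at u)" for j
    by (rule bounded_linear.has_derivative[OF bounded_linear_vec_nth G])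
  have "((\<lambda>x. \<Sum>j\<in>UNIV. M x $ i $ j * G x $ j) has_derivative
      (\<lambda>d. \<Sum>j\<in>UNIV. M u $ i $ j * G' d $ j + frechet_derivative (\<lambda>x. M x $ i $ j) (at u) d * G u $ j)) (at u)"
    by (rule has_derivative_sum) (rule has_derivative_mult[OF Md Gd])
  then show "((\<lambda>x. (M x *v G x) $ i) has_derivative (\<lambda>d. (M u *v G' d) $ i)) (at u)"
    by (simp add: matrix_vector_mult_def assms(3))
qed

lemma Ck_on_matrix_inv:
  fixes P :: "real^2 \<Rightarrow> real^2^2"
  assumes S: "open S" and P: "\<And>i j. Ck_on k S (\<lambda>u. P u $ i $ j)" and det: "\<And>u. u \<in> S \<Longrightarrow> det (P u) \<noteq> 0"
  shows "Ck_on k S (\<lambda>u. matrix_inv (P u) $ i $ j)"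
proof -
  have D: "Ck_on k S (\<lambda>u. det (P u))"
    unfolding det_2 by (rule Ck_on_diff[OF S Ck_on_mult[OF S P P] Ck_on_mult[OF S P P]])
  have I: "Ck_on k S (\<lambda>u. inverse (det (P u)))" by (rule Ck_on_inverse[OF S D det])
  let ?Q = "\<lambda>u. vector [vector [P u $ 2 $ 2, - P u $ 1 $ 2], vector [- P u $ 2 $ 1, P u $ 1 $ 1]] :: real^2^2"
  have Q: "Ck_on k S (\<lambda>u. ?Q u $ i $ j)"
    using exhaust_2[of i] exhaust_2[of j] by (auto simp: P Ck_on_minus[OF S P])
  have eq: "matrix_inv (P u) $ i $ j = inverse (det (P u)) * ?Q u $ i $ j" if "u \<in> S" for u
    unfolding matrix_inv_2[OF det[OF that]] by simp
  show ?thesis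
    by (rule Ck_on_eqI[OF S Ck_on_mult[OF S I Q] eq])
qed

lemma finite_disjoint_neighbourhoods:
  assumes "finite (C :: 'a::t2_space set)"
  obtains U where "\<forall>s\<in>C. open (U s) \<and> s \<in> U s" "\<forall>s\<in>C. \<forall>t\<in>C. s \<noteq> t \<longrightarrow> U s \<inter> U t = {}"
proof -
  have "\<forall>s t. \<exists>U V. s \<noteq> t \<longrightarrow> open U \<and> open V \<and> s \<in> (U :: 'a set) \<and> t \<in> V \<and> U \<inter> V = {}"
    using hausdorff by metis
  then obtain P Q where PQ: "\<And>s t. s \<noteq> t \<Longrightarrow> open (P s t) \<and> open (Q s t) \<and> s \<in> (P s t :: 'a set) \<and> t \<in> Q s t \<and> P s t \<inter> Q s t = {}"
    by metis
  define U where "U = (\<lambda>s. \<Inter>t\<in>C - {s}. P s t \<inter> Q t s)"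
  have "open (U s) \<and> s \<in> U s" if "s \<in> C" for s
  proof -
    have "open (P s t \<inter> Q t s) \<and> s \<in> P s t \<inter> Q t s" if "t \<in> C - {s}" for t
      using PQ[of s t] PQ[of t s] that by (auto intro: open_Int)
    then show ?thesis unfolding U_def using assms by (auto intro!: open_INT)
  qed
  moreover have "U s \<inter> U t = {}" if "s \<in> C" "t \<in> C" "s \<noteq> t" for s t
  proof -
    have "U s \<subseteq> P s t" "U t \<subseteq> Q s t" using that unfolding U_def by blast+
    then show ?thesis using PQ[OF that(3)] by blast
  qed
  ultimately show ?thesis using that[of U] by blast
qed

lemma partial_deriv_minus:
  "h differentiable (at u) \<Longrightarrow> partial_deriv i (\<lambda>u. - h u) u = - partial_deriv i h u"
  using frechet_derivative_eqI[OF has_derivative_minus, of h _ u] frechet_derivative_works[of h "at u"]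
  unfolding partial_deriv_def by metis

lemma euclidean_hessian_minus:
  assumes "open S" "u \<in> S" "Ck_on (Suc (Suc 0)) S h"
  shows "euclidean_hessian (\<lambda>u. - h u) u = - euclidean_hessian h u"
proof -
  have d: "h differentiable (at x)" if "x \<in> S" for x using assms(3) that by simp
  have d2: "partial_deriv j h differentiable (at u)" for j
    using assms(2,3) by (simp add: partial_deriv_def[abs_def])
  have "euclidean_gradient (partial_deriv j (\<lambda>u. - h u)) u = euclidean_gradient (\<lambda>x. - partial_deriv j h x) u" for j
    by (rule euclidean_gradient_cong[OF assms(1,2)]) (use partial_deriv_minus d in blast)
  then show ?thesis
    using partial_deriv_minus[OF d2] by (simp add: euclidean_hessian_def euclidean_gradient_def vec_eq_iff)
qed

locale gradient_flow = compact_manifold A for A :: "('m::t2_space) chart set" +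
  fixes g :: "'m metric" and F :: "'m \<Rightarrow> real"
  assumes metric: "riemannian_metric A g" and morse: "morse_on A UNIV F"
begin

lemma F_smooth: "smooth_fun_on A UNIV F"
  using morse unfolding morse_on_def by blast

lemma F_continuous: "continuous_on UNIV F"
  by (rule smooth_fun_on_imp_continuous_on[OF open_UNIV F_smooth])

lemma F_Ck: "c \<in> A \<Longrightarrow> Ck_on k (snd c ` fst c) (in_chart c F)"
  using smooth_fun_on_Ck[OF F_smooth] by simp

lemma chart_range_open: "c \<in> A \<Longrightarrow> open (snd c ` fst c)"
  using open_chart_image'[OF _ open_chart order_refl] .

lemma metric_pos: "c \<in> A \<Longrightarrow> x \<in> fst c \<Longrightarrow> v \<noteq> 0 \<Longrightarrow> v \<bullet> (g c x *v v) > 0"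
  using metric unfolding riemannian_metric_def by blast

lemma metric_det: "c \<in> A \<Longrightarrow> x \<in> fst c \<Longrightarrow> det (g c x) \<noteq> 0"
  using pos_def_det_nonzero metric_pos by blast

lemma metric_transform:
  assumes "c \<in> A" "d \<in> A" "x \<in> fst c" "x \<in> fst d"
  shows "g c x = transpose (transition_jacobian c d x) ** g d x ** transition_jacobian c d x"
  using metric assms unfolding riemannian_metric_def transition_jacobian_def Let_def by blast

lemma metric_inv_Ck:
  assumes "c \<in> A"
  shows "Ck_on k (snd c ` fst c) (\<lambda>u. matrix_inv (in_chart c (g c) u) $ i $ j)"
proof (rule Ck_on_matrix_inv[OF chart_range_open[OF assms]])
  show "Ck_on k (snd c ` fst c) (\<lambda>u. in_chart c (g c) u $ i $ j)" for i j
    using metric assms unfolding riemannian_metric_def by (blast intro: smooth_onD)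
  show "det (in_chart c (g c) u) \<noteq> 0" if u: "u \<in> snd c ` fst c" for u
  proof -
    obtain x where x: "x \<in> fst c" "u = snd c x" using u by blast
    show ?thesis
      unfolding x(2) in_chart_apply[OF assms x(1)] by (rule metric_det[OF assms x(1)])
  qed
qed

lemma gradient_eq: "gradient g c F x = matrix_inv (g c x) *v chart_gradient c F x"
  by (simp add: gradient_def chart_gradient_def euclidean_gradient_def)

lemma in_chart_gradient:
  assumes "c \<in> A" "u \<in> snd c ` fst c"
  shows "in_chart c (\<lambda>x. - gradient g c F x) u = - (matrix_inv (in_chart c (g c) u) *v euclidean_gradient (in_chart c F) u)"
  using assms by (auto simp: in_chart_apply gradient_eq chart_gradient_def)

lemma gradient_field_C1:
  assumes "c \<in> A"
  shows "Ck_on (Suc 0) (snd c ` fst c) (in_chart c (\<lambda>x. - gradient g c F x))"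
proof -
  let ?S = "snd c ` fst c"
  have S: "open ?S" by (rule chart_range_open[OF assms])
  have "Ck_on (Suc 0) ?S (\<lambda>u. euclidean_gradient (in_chart c F) u $ j)" for j
    by (rule Ck_on_nth[OF S Ck_on_gradient[OF S F_Ck[OF assms]]])
  then have "Ck_on (Suc 0) ?S (\<lambda>u. \<Sum>j\<in>UNIV. matrix_inv (in_chart c (g c) u) $ i $ j * euclidean_gradient (in_chart c F) u $ j)" for i
    by (rule Ck_on_sum[OF S Ck_on_mult[OF S metric_inv_Ck[OF assms]]])
  then have "Ck_on (Suc 0) ?S (\<lambda>u. (matrix_inv (in_chart c (g c) u) *v euclidean_gradient (in_chart c F) u) $ i)" for i
    by (simp only: matrix_vector_mult_def vec_lambda_beta)
  then have "Ck_on (Suc 0) ?S (\<lambda>u. - (matrix_inv (in_chart c (g c) u) *v euclidean_gradient (in_chart c F) u))"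
    by (rule Ck_on_minus[OF S Ck_on_vec[OF S]])
  then show ?thesis by (rule Ck_on_eqI[OF S]) (rule in_chart_gradient[OF assms])
qed

text \<open>The equation \<open>g w = dF\<close> for the gradient \<open>w\<close>, written in chart
  \<open>c\<close>, has an invertible factor \<open>transpose J\<close> on both sides when expressed
  through chart \<open>d\<close>; cancelling it leaves the same equation in \<open>d\<close> for
  \<open>J *v w\<close>.\<close>

lemma gradient_field_transform:
  assumes "c \<in> A" "d \<in> A" "x \<in> fst c" "x \<in> fst d"
  shows "- gradient g d F x = transition_jacobian c d x *v (- gradient g c F x)"
proof -
  let ?J = "transition_jacobian c d x" and ?w = "gradient g c F x"
  have dJ: "det (transpose ?J) \<noteq> 0" using det_transition_jacobian[OF assms] by (simp add: det_transpose)
  have "g c x *v ?w = chart_gradient c F x"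
    by (simp add: gradient_eq matrix_vector_mul_assoc matrix_inv_inverse[OF metric_det[OF assms(1,3)]])
  also have "\<dots> = transpose ?J *v chart_gradient d F x"
    by (rule chart_gradient_transform[OF open_UNIV F_smooth UNIV_I assms])
  finally have "transpose ?J *v (g d x *v (?J *v ?w)) = transpose ?J *v chart_gradient d F x"
    unfolding metric_transform[OF assms] by (simp only: matrix_vector_mul_assoc matrix_mul_assoc)
  then have "matrix_inv (transpose ?J) *v (transpose ?J *v (g d x *v (?J *v ?w))) =
      matrix_inv (transpose ?J) *v (transpose ?J *v chart_gradient d F x)" by (rule arg_cong)
  then have "g d x *v (?J *v ?w) = chart_gradient d F x"
    unfolding matrix_vector_mul_assoc[of "matrix_inv (transpose ?J)"] matrix_inv_inverse[OF dJ] matrix_vector_mul_lid .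
  then have "matrix_inv (g d x) *v (g d x *v (?J *v ?w)) = gradient g d F x" by (simp only: gradient_eq)
  then have "?J *v ?w = gradient g d F x"
    unfolding matrix_vector_mul_assoc[of "matrix_inv (g d x)"] matrix_inv_inverse[OF metric_det[OF assms(2,4)]] matrix_vector_mul_lid .
  then show ?thesis by (simp add: linear_neg[OF matrix_vector_mul_linear])
qed

sublocale vector_field A "\<lambda>c x. - gradient g c F x"
  by unfold_locales (rule gradient_field_C1 gradient_field_transform; assumption)+

lemma descent_curve_iff: "descent_curve A g F \<gamma> \<longleftrightarrow> integral_curve UNIV \<gamma>"
  unfolding descent_curve_def integral_curve_def continuous_on_eq_continuous_at[OF open_UNIV] by blast

lemma full_flow_eq: "full_flow A g F t x = flow_line t x"
  by (simp add: full_flow_def flow_line_def descent_curve_iff)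

lemma critical_iff: "c \<in> A \<Longrightarrow> x \<in> fst c \<Longrightarrow> critical_point A F x \<longleftrightarrow> chart_gradient c F x = 0"
  by (rule critical_point_iff[OF open_UNIV F_smooth UNIV_I])

lemma critical_hessian_det:
  assumes "c \<in> A" "x \<in> fst c" "critical_point A F x"
  shows "det (hessian c F x) \<noteq> 0"
  using morse assms nondegenerate_iff[OF open_UNIV F_smooth UNIV_I assms] unfolding morse_on_def by blast

lemma in_chart_F_derivative:
  assumes "c \<in> A" "x \<in> fst c"
  shows "(in_chart c F has_derivative (\<lambda>v. chart_gradient c F x \<bullet> v)) (at (snd c x))"
proof -
  have d: "in_chart c F differentiable (at (snd c x))"
    by (rule in_chart_differentiable[OF F_smooth assms UNIV_I])
  have "(in_chart c F has_derivative frechet_derivative (in_chart c F) (at (snd c x))) (at (snd c x))"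
    using d frechet_derivative_works by blast
  moreover have "frechet_derivative (in_chart c F) (at (snd c x)) = (\<lambda>v. chart_gradient c F x \<bullet> v)"
    using frechet_derivative_gradient[OF d] by (simp add: chart_gradient_def fun_eq_iff)
  ultimately show ?thesis by simp
qed

lemma eventually_in_chart:
  assumes "c \<in> A" "x \<in> fst c" "\<forall>\<^sub>F y in nhds x. P y"
  obtains S where "open S" "snd c x \<in> S" "S \<subseteq> snd c ` fst c" "\<forall>y\<in>fst c. snd c y \<in> S \<longrightarrow> P y"
proof -
  obtain U where U: "open U" "x \<in> U" "\<forall>y\<in>U. P y" using assms(3) unfolding eventually_nhds by blast
  have "P y" if "y \<in> fst c" "snd c y \<in> snd c ` (fst c \<inter> U)" for y
    using that inj_on_chart[OF assms(1)] U(3) by (auto dest: inj_onD)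
  then show ?thesis
    using that[of "snd c ` (fst c \<inter> U)"] open_chart_image[OF assms(1) U(1)] assms(2) U(2) by blast
qed

lemma eventually_from_chart:
  assumes "c \<in> A" "x \<in> fst c" "r > 0" "\<forall>w\<in>ball (snd c x) r. Q w"
  shows "\<forall>\<^sub>F y in nhds x. y \<in> fst c \<and> Q (snd c y)"
proof -
  have "isCont (snd c) x"
    using continuous_on_chart[OF assms(1)] open_chart[OF assms(1)] assms(2) continuous_on_eq_continuous_at by blast
  then obtain T where T: "open T" "x \<in> T" "\<forall>y\<in>T. snd c y \<in> ball (snd c x) r"
    using assms(3) unfolding continuous_at_open by (meson centre_in_ball open_ball)
  then show ?thesis
    unfolding eventually_nhds using assms open_chart[OF assms(1)] by (intro exI[of _ "T \<inter> fst c"]) auto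
qed

section \<open>Critical points and the decrease of the energy\<close>

lemma local_extremum_critical:
  assumes "(\<forall>\<^sub>F y in nhds x. F y \<le> F x) \<or> (\<forall>\<^sub>F y in nhds x. F x \<le> F y)"
  shows "critical_point A F x"
proof -
  obtain c where c: "c \<in> A" "x \<in> fst c" by (rule chart_cover)
  obtain S where S: "open S" "snd c x \<in> S" "S \<subseteq> snd c ` fst c"
    and ext: "(\<forall>u\<in>S. in_chart c F u \<le> in_chart c F (snd c x)) \<or> (\<forall>u\<in>S. in_chart c F (snd c x) \<le> in_chart c F u)"
    using assms
  proof
    assume "\<forall>\<^sub>F y in nhds x. F y \<le> F x"
    then obtain S where S: "open S" "snd c x \<in> S" "S \<subseteq> snd c ` fst c" "\<forall>y\<in>fst c. snd c y \<in> S \<longrightarrow> F y \<le> F x"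
      by (rule eventually_in_chart[OF c])
    then have "\<forall>u\<in>S. in_chart c F u \<le> in_chart c F (snd c x)" using c by (auto simp: in_chart_apply)
    then show ?thesis using that S by blast
  next
    assume "\<forall>\<^sub>F y in nhds x. F x \<le> F y"
    then obtain S where S: "open S" "snd c x \<in> S" "S \<subseteq> snd c ` fst c" "\<forall>y\<in>fst c. snd c y \<in> S \<longrightarrow> F x \<le> F y"
      by (rule eventually_in_chart[OF c])
    then have "\<forall>u\<in>S. in_chart c F (snd c x) \<le> in_chart c F u" using c by (auto simp: in_chart_apply)
    then show ?thesis using that S by blast
  qed
  have "(\<lambda>v. chart_gradient c F x \<bullet> v) = (\<lambda>v. 0)"
    by (rule differential_zero_maxmin[OF S(2,1) in_chart_F_derivative[OF c] ext])
  from fun_cong[OF this, of "chart_gradient c F x"] show ?thesis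
    unfolding critical_iff[OF c] by simp
qed

lemma critical_isolated:
  assumes "critical_point A F x"
  shows "\<forall>\<^sub>F y in nhds x. critical_point A F y \<longrightarrow> y = x"
proof -
  obtain c where c: "c \<in> A" "x \<in> fst c" by (rule chart_cover)
  have "(euclidean_gradient (in_chart c F) has_derivative (\<lambda>v. hessian c F x *v v)) (at (snd c x))"
    unfolding hessian_eq_euclidean
    by (rule gradient_has_derivative[OF chart_range_open[OF c(1)] _ F_Ck[OF c(1)]]) (use c in blast)
  moreover have "euclidean_gradient (in_chart c F) (snd c x) = 0"
    using assms critical_iff[OF c] by (simp add: chart_gradient_def)
  ultimately obtain r where r: "r > 0" "\<forall>w\<in>ball (snd c x) r. euclidean_gradient (in_chart c F) w = 0 \<longrightarrow> w = snd c x"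
    using critical_hessian_det[OF c assms] by (rule critical_point_isolated_plane)
  from eventually_from_chart[OF c r] show ?thesis
  proof (rule eventually_mono, intro impI)
    fix y assume y: "y \<in> fst c \<and> (euclidean_gradient (in_chart c F) (snd c y) = 0 \<longrightarrow> snd c y = snd c x)"
      and "critical_point A F y"
    then have "snd c y = snd c x" using critical_iff[OF c(1)] by (simp add: chart_gradient_def)
    then show "y = x" using y c inj_on_chart by (meson inj_onD)
  qed
qed

text \<open>Every point, critical or not, has a neighbourhood without critical points other than
  possibly itself. So the centres of a finite subcover include all critical points.\<close>

lemma finite_critical: "finite {x. critical_point A F x}"
proof -
  have "\<exists>U. open U \<and> x \<in> U \<and> (\<forall>y\<in>U. critical_point A F y \<longrightarrow> y = x)" for x
  proof (cases "critical_point A F x")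
    case True
    then show ?thesis using critical_isolated unfolding eventually_nhds by blast
  next
    case False
    obtain c where c: "c \<in> A" "x \<in> fst c" by (rule chart_cover)
    let ?G = "euclidean_gradient (in_chart c F)" and ?S = "snd c ` fst c"
    have S: "open ?S" by (rule chart_range_open[OF c(1)])
    have "continuous_on ?S ?G"
      by (rule Ck_on_imp_continuous[OF Ck_on_gradient[OF S F_Ck[OF c(1)]]])
    then have "isCont ?G (snd c x)" using S c continuous_on_eq_continuous_at by blast
    moreover have "?G (snd c x) \<noteq> 0" using False critical_iff[OF c] by (simp add: chart_gradient_def)
    ultimately obtain r where r: "r > 0" "\<forall>w. dist (snd c x) w < r \<longrightarrow> ?G w \<noteq> 0"
      using continuous_at_avoid by blast
    then have "\<forall>w\<in>ball (snd c x) r. ?G w \<noteq> 0" by simp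
    from eventually_from_chart[OF c r(1) this]
    have "\<forall>\<^sub>F y in nhds x. \<not> critical_point A F y"
      by (rule eventually_mono) (use critical_iff[OF c(1)] in \<open>auto simp: chart_gradient_def\<close>)
    then show ?thesis unfolding eventually_nhds by blast
  qed
  then obtain U where U: "\<And>x. open (U x) \<and> x \<in> U x \<and> (\<forall>y\<in>U x. critical_point A F y \<longrightarrow> y = x)" by metis
  have "\<exists>I\<subseteq>UNIV. finite I \<and> UNIV \<subseteq> (\<Union>x\<in>I. U x)"
    by (rule compact_finite_cover[OF compact_UNIV]) (use U in blast)
  then obtain I where I: "finite I" "UNIV \<subseteq> (\<Union>x\<in>I. U x)" by blast
  have "{x. critical_point A F x} \<subseteq> I"
  proof (intro subsetI, elim CollectE)
    fix x assume x: "critical_point A F x"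
    obtain i where "i \<in> I" "x \<in> U i" using I(2) by blast
    then show "x \<in> I" using U[of i] x by blast
  qed
  then show ?thesis using I finite_subset by blast
qed

text \<open>The derivative \<open>D\<close> is minus the squared length of the gradient in the
  metric, since the differential of \<open>F\<close> equals \<open>g\<close> applied to the
  gradient.\<close>

lemma energy_derivative:
  assumes \<gamma>: "integral_curve UNIV \<gamma>"
  obtains D where "((\<lambda>t. F (\<gamma> t)) has_real_derivative D) (at t)" "D \<le> 0" "\<not> critical_point A F (\<gamma> t) \<longrightarrow> D < 0"
proof -
  obtain c where c: "c \<in> A" "\<gamma> t \<in> fst c" by (rule chart_cover)
  let ?w = "gradient g c F (\<gamma> t)"
  have gw: "g c (\<gamma> t) *v ?w = chart_gradient c F (\<gamma> t)"
    by (simp add: gradient_eq matrix_vector_mul_assoc matrix_inv_inverse[OF metric_det[OF c]])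
  have "isCont \<gamma> t" by (rule integral_curve_isCont[OF \<gamma> UNIV_I])
  then obtain T where T: "open T" "t \<in> T" "\<forall>s\<in>T. \<gamma> s \<in> fst c"
    using c open_chart[OF c(1)] unfolding continuous_at_open by blast
  have "((snd c \<circ> \<gamma>) has_derivative (\<lambda>h. h *\<^sub>R (- ?w))) (at t)"
    using \<gamma> c unfolding integral_curve_def has_vector_derivative_def by blast
  moreover have "(in_chart c F has_derivative (\<lambda>v. chart_gradient c F (\<gamma> t) \<bullet> v)) (at ((snd c \<circ> \<gamma>) t))"
    using in_chart_F_derivative[OF c] by simp
  ultimately have "((\<lambda>s. in_chart c F ((snd c \<circ> \<gamma>) s)) has_derivative (\<lambda>h. chart_gradient c F (\<gamma> t) \<bullet> (h *\<^sub>R (- ?w)))) (at t)"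
    by (rule has_derivative_compose)
  then have "((\<lambda>s. F (\<gamma> s)) has_derivative (\<lambda>h. chart_gradient c F (\<gamma> t) \<bullet> (h *\<^sub>R (- ?w)))) (at t)"
    by (rule has_derivative_transform_within_open[OF _ T(1,2)]) (use T c in \<open>simp add: in_chart_apply\<close>)
  moreover have "(\<lambda>h. chart_gradient c F (\<gamma> t) \<bullet> (h *\<^sub>R (- ?w))) = (*) (- (?w \<bullet> (g c (\<gamma> t) *v ?w)))"
    unfolding gw by (simp add: fun_eq_iff inner_commute)
  ultimately have D: "((\<lambda>t. F (\<gamma> t)) has_real_derivative - (?w \<bullet> (g c (\<gamma> t) *v ?w))) (at t)"
    unfolding has_field_derivative_def by simp
  have "?w \<bullet> (g c (\<gamma> t) *v ?w) \<ge> 0" using metric_pos[OF c, of ?w] by (cases "?w = 0") auto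
  moreover have "?w \<bullet> (g c (\<gamma> t) *v ?w) > 0" if "\<not> critical_point A F (\<gamma> t)"
  proof (rule metric_pos[OF c])
    show "?w \<noteq> 0" using that gw critical_iff[OF c] by auto
  qed
  ultimately show ?thesis using that[OF D] by simp
qed

section \<open>Convergence of flow lines to critical points\<close>

lemma energy_antimono: "s \<le> t \<Longrightarrow> F (flow_line t x) \<le> F (flow_line s x)"
  by (rule DERIV_nonpos_imp_nonincreasing[of s t "\<lambda>t. F (flow_line t x)"])
     (use energy_derivative[OF flow_line_curve] in blast)+

lemma energy_decreases:
  assumes "\<not> critical_point A F x" "t > 0"
  shows "F (flow_line t x) < F x"
proof -
  obtain D where D: "((\<lambda>t. F (flow_line t x)) has_real_derivative D) (at 0)"
      "D \<le> 0" "\<not> critical_point A F (flow_line 0 x) \<longrightarrow> D < 0"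
    by (rule energy_derivative[OF flow_line_curve])
  then have "D < 0" using assms by simp
  then obtain d where d: "d > 0" "\<forall>h>0. h < d \<longrightarrow> F (flow_line (0 + h) x) < F (flow_line 0 x)"
    using DERIV_neg_dec_right[OF D(1)] by blast
  define h where "h = min t (d / 2)"
  have h: "0 < h" "h < d" "h \<le> t" using d assms by (auto simp: h_def)
  have "F (flow_line t x) \<le> F (flow_line h x)" by (rule energy_antimono[OF h(3)])
  also have "\<dots> < F x" using d(2) h by auto
  finally show ?thesis .
qed

lemma flow_line_critical:
  assumes "critical_point A F x"
  shows "flow_line t x = x"
proof -
  have "integral_curve UNIV (\<lambda>t. x)"
    unfolding integral_curve_def
  proof (intro ballI conjI impI)
    fix c t assume c: "c \<in> A" "x \<in> fst c"
    have "gradient g c F x = 0" using assms critical_iff[OF c] by (simp add: gradient_eq)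
    then show "((snd c \<circ> (\<lambda>t. x)) has_vector_derivative - gradient g c F x) (at (t::real))"
      by (simp add: comp_def)
  qed simp
  from flow_line_unique[OF this open_UNIV connected_UNIV UNIV_I UNIV_I, of t] show ?thesis by simp
qed

text \<open>Off \<open>U\<close> there are no critical points, so by compactness the energy lost
  within one unit of time has a positive minimum there. The energy is bounded below, so this loss
  cannot occur at arbitrarily late times.\<close>

lemma eventually_near_critical:
  assumes U: "open U" "{x. critical_point A F x} \<subseteq> U"
  shows "\<forall>\<^sub>F t in at_top. flow_line t x \<in> U"
proof (cases "- U = {}")
  case True
  then have "U = UNIV" by blast
  then show ?thesis by simp
next
  case False
  let ?D = "\<lambda>z. F z - F (flow_line 1 z)" and ?E = "\<lambda>t. F (flow_line t x)"
  have cU: "compact (- U)" using compact_Int_closed[OF compact_UNIV closed_Compl[OF U(1)]] by simp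
  have "continuous_on (- U) ?D"
    using continuous_on_compose2[OF F_continuous flow_line_continuous[of 1] subset_UNIV] F_continuous
    by (intro continuous_on_diff) (auto intro: continuous_on_subset)
  then obtain w where w: "w \<in> - U" "\<And>z. z \<in> - U \<Longrightarrow> ?D w \<le> ?D z"
    using continuous_attains_inf[OF cU False] by blast
  have Dw: "?D w > 0" using energy_decreases[of w 1] w(1) U(2) by auto
  have "compact (F ` UNIV)" by (rule compact_continuous_image[OF F_continuous compact_UNIV])
  then have "bounded (F ` UNIV)" by (rule compact_imp_bounded)
  then have "bdd_below (F ` UNIV)" by (rule bounded_imp_bdd_below)
  then have bdd: "bdd_below (range ?E)" by (rule bdd_below_mono) blast
  define l where "l = Inf (range ?E)"
  \<comment> \<open>From such a time \<open>T\<close> on, less than \<open>?D w\<close> is left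
    above the infimum, while each visit outside \<open>U\<close> would cost at least
    \<open>?D w\<close>.\<close>
  have "l < l + ?D w" using Dw by simp
  then obtain T where T: "?E T < l + ?D w"
    unfolding l_def using cInf_less_iff[OF _ bdd] by blast
  have "flow_line t x \<in> U" if "t \<ge> T" for t
  proof (rule ccontr)
    assume "flow_line t x \<notin> U"
    then have "?D w \<le> ?E t - F (flow_line 1 (flow_line t x))" using w(2) by auto
    then have "?D w \<le> ?E t - ?E (1 + t)" by (simp add: flow_line_add)
    moreover have "l \<le> ?E (1 + t)" unfolding l_def by (rule cInf_lower[OF _ bdd]) blast
    moreover have "?E t \<le> ?E T" by (rule energy_antimono[OF that])
    ultimately show False using T by linarith
  qed
  then show ?thesis unfolding eventually_at_top_linorder by blast
qed

text \<open>The curve ends up in the union of disjoint neighbourhoods of the finitely many critical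
  points, hence, being connected, in just one of them. Shrinking that one neighbourhood gives the
  limit.\<close>

lemma flow_line_converges:
  obtains s where "critical_point A F s" "((\<lambda>t. flow_line t x) \<longlongrightarrow> s) at_top"
proof -
  let ?C = "{x. critical_point A F x}"
  obtain U where U: "\<forall>s\<in>?C. open (U s) \<and> s \<in> U s" "\<forall>s\<in>?C. \<forall>t\<in>?C. s \<noteq> t \<longrightarrow> U s \<inter> U t = {}"
    by (rule finite_disjoint_neighbourhoods[OF finite_critical])
  have "\<forall>\<^sub>F t in at_top. flow_line t x \<in> (\<Union>s\<in>?C. U s)"
    by (rule eventually_near_critical) (use U(1) in auto)
  then obtain T where T: "\<And>t. t \<ge> T \<Longrightarrow> flow_line t x \<in> (\<Union>s\<in>?C. U s)"
    unfolding eventually_at_top_linorder by blast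
  obtain s where s: "s \<in> ?C" "flow_line T x \<in> U s" using T[of T] by blast
  let ?R = "\<Union>t\<in>?C - {s}. U t"
  have conn: "connected ((\<lambda>t. flow_line t x) ` {T..})"
    by (rule connected_continuous_image)
       (auto intro: continuous_at_imp_continuous_on flow_line_isCont)
  have RU: "U s \<inter> ?R = {}" using U(2) s(1) by blast
  have op: "open (U s)" "open ?R" using U(1) s(1) by auto
  have "(\<lambda>t. flow_line t x) ` {T..} \<subseteq> U s \<union> ?R" using T by blast
  then have "U s \<inter> (\<lambda>t. flow_line t x) ` {T..} = {} \<or> ?R \<inter> (\<lambda>t. flow_line t x) ` {T..} = {}"
    using connectedD[OF conn op] RU by blast
  then have inR: "flow_line t x \<notin> ?R" if "t \<ge> T" for t using s(2) that by auto
  have "((\<lambda>t. flow_line t x) \<longlongrightarrow> s) at_top"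
  proof (rule topological_tendstoI)
    \<comment> \<open>\<open>W\<close> and the old neighbourhoods of the other critical points again
      cover all critical points, and the old neighbourhoods are already known to be avoided.\<close>
    fix W assume W: "open W" "s \<in> W"
    have "\<forall>\<^sub>F t in at_top. flow_line t x \<in> W \<union> ?R"
      by (rule eventually_near_critical) (use W U(1) in auto)
    then show "\<forall>\<^sub>F t in at_top. flow_line t x \<in> W"
      using eventually_ge_at_top[of T] by eventually_elim (use inR in blast)
  qed
  then show ?thesis using that s by blast
qed

section \<open>Basins of critical points other than local minima\<close>

lemma negative_direction:
  assumes crit: "critical_point A F s" and nmin: "\<not> (\<forall>\<^sub>F y in nhds s. F s \<le> F y)" and c: "c \<in> A" "s \<in> fst c"
  obtains e where "e \<bullet> (hessian c F s *v e) < 0"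
proof (rule ccontr)
  assume "\<not> thesis"
  \<comment> \<open>Without a negative direction the Hessian is semidefinite; being nondegenerate it
    is positive definite, and \<open>s\<close> would be a local minimum.\<close>
  then have semi: "v \<bullet> (hessian c F s *v v) \<ge> 0" for v using that not_le by blast
  let ?h = "in_chart c F" and ?u = "snd c s"
  have S: "open (snd c ` fst c)" "?u \<in> snd c ` fst c" using chart_range_open c by auto
  have sym: "transpose (hessian c F s) = hessian c F s"
    unfolding hessian_eq_euclidean by (rule euclidean_hessian_symmetric[OF S F_Ck[OF c(1)]])
  have pos: "v \<bullet> (euclidean_hessian ?h ?u *v v) > 0" if "v \<noteq> 0" for v
    using semidefinite_nondegenerate_pos_def[OF sym critical_hessian_det[OF c crit] semi that]
    by (simp add: hessian_eq_euclidean)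
  have "euclidean_gradient ?h ?u = 0" using crit critical_iff[OF c] by (simp add: chart_gradient_def)
  from pos_def_hessian_local_min[OF S F_Ck[OF c(1)] this pos]
  obtain r where r: "r > 0" "\<forall>w\<in>ball ?u r. ?h ?u \<le> ?h w" by blast
  from eventually_from_chart[OF c r] have "\<forall>\<^sub>F y in nhds s. F s \<le> F y"
    by (rule eventually_mono) (use c in \<open>auto simp: in_chart_apply\<close>)
  then show False using nmin by blast
qed

lemma field_linearization:
  assumes crit: "critical_point A F s" and c: "c \<in> A" "s \<in> fst c"
  shows "frechet_derivative (in_chart c (\<lambda>x. - gradient g c F x)) (at (snd c s)) d =
    - (matrix_inv (g c s) *v (hessian c F s *v d))"
proof -
  let ?S = "snd c ` fst c" and ?u = "snd c s"
  have S: "open ?S" "?u \<in> ?S" using chart_range_open c by auto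
  have M: "(\<lambda>x. matrix_inv (in_chart c (g c) x) $ i $ j) differentiable (at ?u)" for i j
    by (rule differentiableI[OF Ck_on_has_derivative[OF metric_inv_Ck[OF c(1)] S(2)]])
  have G: "(euclidean_gradient (in_chart c F) has_derivative (\<lambda>v. hessian c F s *v v)) (at ?u)"
    unfolding hessian_eq_euclidean by (rule gradient_has_derivative[OF S F_Ck[OF c(1)]])
  have G0: "euclidean_gradient (in_chart c F) ?u = 0" using crit critical_iff[OF c] by (simp add: chart_gradient_def)
  have "((\<lambda>x. - (matrix_inv (in_chart c (g c) x) *v euclidean_gradient (in_chart c F) x)) has_derivative
      (\<lambda>d. - (matrix_inv (in_chart c (g c) ?u) *v (hessian c F s *v d)))) (at ?u)"
    by (rule has_derivative_minus[OF has_derivative_matrix_vector_at_zero[OF M G G0]])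
  then have "(in_chart c (\<lambda>x. - gradient g c F x) has_derivative
      (\<lambda>d. - (matrix_inv (in_chart c (g c) ?u) *v (hessian c F s *v d)))) (at ?u)"
    by (rule has_derivative_transform_within_open[OF _ S]) (rule in_chart_gradient[OF c(1), symmetric])
  from frechet_derivative_eqI[OF this] show ?thesis using c by (simp add: in_chart_apply)
qed

text \<open>\<open>K n\<close> collects the points whose curve remains in a small closed ball
  \<open>B\<close> around \<open>s\<close> from time \<open>n\<close> on; every curve that tends to
  \<open>s\<close> does so for some \<open>n\<close>. If \<open>K n\<close> had interior, its image
  under the flow at time \<open>n\<close> would be an open set of points that stay in
  \<open>B\<close> from time 0 on, and so tend to \<open>s\<close>. Two of them would differ by a
  multiple of a negative direction.\<close>

lemma basin_of_non_minimum:
  assumes crit: "critical_point A F s" and nmin: "\<not> (\<forall>\<^sub>F y in nhds s. F s \<le> F y)"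
  obtains K :: "nat \<Rightarrow> 'm set" where "\<forall>n. closed (K n) \<and> interior (K n) = {}"
    "{x. ((\<lambda>t. flow_line t x) \<longlongrightarrow> s) at_top} \<subseteq> (\<Union>n. K n)"
proof -
  obtain c where c: "c \<in> A" "s \<in> fst c" by (rule chart_cover)
  let ?u = "snd c s" and ?H = "hessian c F s" and ?v = "in_chart c (\<lambda>x. - gradient g c F x)" and ?i = "inv_into (fst c) (snd c)"
  obtain e where e: "e \<bullet> (?H *v e) < 0" by (rule negative_direction[OF crit nmin c])
  have S: "open (snd c ` fst c)" "?u \<in> snd c ` fst c" using chart_range_open c by auto
  have P: "w \<bullet> (matrix_inv (g c s) *v w) > 0" if "w \<noteq> 0" for w
    by (rule pos_def_matrix_inv[OF metric_pos[OF c] that])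
  have sym: "transpose ?H = ?H"
    unfolding hessian_eq_euclidean by (rule euclidean_hessian_symmetric[OF S F_Ck[OF c(1)]])
  obtain r0 where r0: "r0 > 0" "cball ?u r0 \<subseteq> snd c ` fst c"
    and no: "\<forall>x y. (\<forall>t\<ge>0. x t \<in> cball ?u r0 \<and> (x has_vector_derivative ?v (x t)) (at t)) \<longrightarrow>
      (\<forall>t\<ge>0. y t \<in> cball ?u r0 \<and> (y has_vector_derivative ?v (y t)) (at t)) \<longrightarrow>
      (x \<longlongrightarrow> ?u) at_top \<longrightarrow> (y \<longlongrightarrow> ?u) at_top \<longrightarrow> 0 \<le> (x 0 - y 0) \<bullet> (?H *v (x (0::real) - y 0))"
    by (rule no_convergence_in_negative_direction[OF S gradient_field_C1[OF c(1)] field_linearization[OF crit c] P sym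
          critical_hessian_det[OF c crit]])
  obtain U where U: "open U" "s \<in> U" "\<forall>y\<in>U. critical_point A F y \<longrightarrow> y = s"
    using critical_isolated[OF crit] unfolding eventually_nhds by blast
  obtain r1 where r1: "r1 > 0" "cball ?u r1 \<subseteq> snd c ` (fst c \<inter> U)" by (rule chart_ball[OF c U(1,2)])
  \<comment> \<open>Radius \<open>r0\<close> serves the comparison of two solutions,
    \<open>r1\<close> excludes other critical points, which forces a curve trapped in
    \<open>B\<close> to tend to \<open>s\<close>.\<close>
  define r where "r = min r0 r1"
  have r: "r > 0" "cball ?u r \<subseteq> cball ?u r0" "cball ?u r \<subseteq> snd c ` (fst c \<inter> U)"
    using r0 r1 by (auto simp: r_def)
  have rc: "cball ?u r \<subseteq> snd c ` fst c" and rb: "ball ?u r \<subseteq> snd c ` fst c" using r(3) ball_subset_cball by blast+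
  define B where "B = ?i ` cball ?u r"
  have memB: "x \<in> B \<longleftrightarrow> x \<in> fst c \<and> snd c x \<in> cball ?u r" for x
    unfolding B_def by (rule mem_inv_image_iff[OF c(1) rc])
  have B: "closed B" unfolding B_def by (rule compact_imp_closed[OF compact_inv_cball[OF c(1) rc]])
  have BU: "x \<in> U" if "x \<in> B" for x
  proof -
    have "x \<in> fst c" "snd c x \<in> snd c ` (fst c \<inter> U)" using that memB r(3) by auto
    then show ?thesis using inj_on_chart[OF c(1)] by (auto dest: inj_onD)
  qed
  define K where "K = (\<lambda>n::nat. {x. \<forall>t\<ge>real n. flow_line t x \<in> B})"
  have "closed (K n)" for n
  proof -
    have "K n = (\<Inter>t\<in>{real n..}. flow_line t -` B)" unfolding K_def by auto
    then show ?thesis using closed_vimage[OF B flow_line_continuous] by auto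
  qed
  moreover have "interior (K n) = {}" for n
  proof (rule ccontr)
    assume "interior (K n) \<noteq> {}"
    then obtain x where x: "x \<in> interior (K n)" by blast
    define W where "W = flow_line (real n) ` interior (K n)"
    have W: "open W" unfolding W_def by (rule open_flow_line_image[OF open_interior])
    have stay: "flow_line t z \<in> B" if zt: "z \<in> W" "t \<ge> 0" for z t
    proof -
      obtain y where y: "y \<in> K n" "z = flow_line (real n) y" using zt(1) interior_subset unfolding W_def by blast
      have "flow_line (t + real n) y \<in> B" using y(1) zt(2) unfolding K_def by auto
      then show ?thesis using y(2) by (simp add: flow_line_add)
    qed
    have lim: "((\<lambda>t. flow_line t z) \<longlongrightarrow> s) at_top" if "z \<in> W" for z
    proof -
      obtain s' where s': "critical_point A F s'" "((\<lambda>t. flow_line t z) \<longlongrightarrow> s') at_top"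
        by (rule flow_line_converges)
      have "\<forall>\<^sub>F t in at_top. flow_line t z \<in> B"
        by (rule eventually_mono[OF eventually_ge_at_top[of 0]]) (rule stay[OF that])
      then have "s' \<in> B" using Lim_in_closed_set[OF B _ _ s'(2)] by simp
      then show ?thesis using U(3) BU s' by blast
    qed
    have isc: "isCont (snd c) s"
      using continuous_on_chart[OF c(1)] open_chart[OF c(1)] c(2) continuous_on_eq_continuous_at by blast
    have sol: "(\<forall>t\<ge>0. snd c (flow_line t z) \<in> cball ?u r0 \<and>
        ((\<lambda>t. snd c (flow_line t z)) has_vector_derivative ?v (snd c (flow_line t z))) (at t)) \<and>
        ((\<lambda>t. snd c (flow_line t z)) \<longlongrightarrow> ?u) at_top" if z: "z \<in> W" for z
    proof (intro conjI allI impI)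
      fix t :: real assume "t \<ge> 0"
      then have b: "flow_line t z \<in> fst c" "snd c (flow_line t z) \<in> cball ?u r" using stay[OF z] memB by auto
      then show "snd c (flow_line t z) \<in> cball ?u r0" using r(2) by blast
      show "((\<lambda>t. snd c (flow_line t z)) has_vector_derivative ?v (snd c (flow_line t z))) (at t)"
        using integral_curve_in_chart[OF flow_line_curve UNIV_I c(1) b(1)] by (simp add: comp_def)
    next
      show "((\<lambda>t. snd c (flow_line t z)) \<longlongrightarrow> ?u) at_top"
        by (rule isCont_tendsto_compose[OF isc lim[OF z]])
    qed
    define z0 where "z0 = flow_line (real n) x"
    have z0: "z0 \<in> W" using x by (simp add: W_def z0_def)
    have Wc: "W \<subseteq> fst c" using stay[of _ 0] memB by fastforce
    have "open (snd c ` W)" by (rule open_chart_image'[OF c(1) W Wc])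
    then obtain d where d: "d > 0" "ball (snd c z0) d \<subseteq> snd c ` W" using z0 openE by blast
    have "e \<noteq> 0" using e by auto
    \<comment> \<open>The shift \<open>a e\<close> has length \<open>d / 2\<close>, so the second
      point stays in the coordinate ball of radius \<open>d\<close> inside the image of
      \<open>W\<close>.\<close>
    define a where "a = d / (2 * norm e)"
    have a: "a > 0" using d(1) \<open>e \<noteq> 0\<close> by (simp add: a_def)
    have "norm (a *\<^sub>R e) < d" using d(1) \<open>e \<noteq> 0\<close> by (simp add: a_def)
    then have "snd c z0 + a *\<^sub>R e \<in> ball (snd c z0) d" by (simp add: dist_norm)
    then obtain z1 where z1: "z1 \<in> W" "snd c z1 = snd c z0 + a *\<^sub>R e" using d(2) by (metis (no_types, lifting) imageE subsetD)
    have "0 \<le> (snd c (flow_line 0 z1) - snd c (flow_line 0 z0)) \<bullet> (?H *v (snd c (flow_line 0 z1) - snd c (flow_line 0 z0)))"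
      using no[rule_format, of "\<lambda>t. snd c (flow_line t z1)" "\<lambda>t. snd c (flow_line t z0)"] sol[OF z1(1)] sol[OF z0] by blast
    then have "0 \<le> (a *\<^sub>R e) \<bullet> (?H *v (a *\<^sub>R e))" by (simp add: z1(2))
    then have "0 \<le> a * (a * (e \<bullet> (?H *v e)))" by (simp add: matrix_vector_mult_scaleR)
    then show False using a e by (simp add: zero_le_mult_iff)
  qed
  moreover have "x \<in> (\<Union>n. K n)" if lim: "((\<lambda>t. flow_line t x) \<longlongrightarrow> s) at_top" for x
  proof -
    have memI: "y \<in> ?i ` ball ?u r \<longleftrightarrow> y \<in> fst c \<and> snd c y \<in> ball ?u r" for y
      by (rule mem_inv_image_iff[OF c(1) rb])
    have "\<forall>\<^sub>F t in at_top. flow_line t x \<in> ?i ` ball ?u r"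
      by (rule topological_tendstoD[OF lim open_inv_chart_image[OF c(1) open_ball rb]])
         (use memI c r(1) in simp)
    then have "\<forall>\<^sub>F t in at_top. flow_line t x \<in> B"
      by (rule eventually_mono) (use memI memB in auto)
    then obtain T where T: "\<And>t. t \<ge> T \<Longrightarrow> flow_line t x \<in> B" unfolding eventually_at_top_linorder by blast
    obtain n :: nat where "T \<le> real n" using real_arch_simple by blast
    then have "x \<in> K n" unfolding K_def using T by auto
    then show ?thesis by blast
  qed
  ultimately show ?thesis using that[of K] by blast
qed

lemma generic_point_flows_to_minimum:
  assumes "open W" "W \<noteq> {}"
  obtains x p where "x \<in> W" "((\<lambda>t. flow_line t x) \<longlongrightarrow> p) at_top" "critical_point A F p" "\<forall>\<^sub>F y in nhds p. F p \<le> F y"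
proof (rule ccontr)
  assume neg: "\<not> thesis"
  define C where "C = {s. critical_point A F s \<and> \<not> (\<forall>\<^sub>F y in nhds s. F s \<le> F y)}"
  define cover where "cover = (\<lambda>s (K :: nat \<Rightarrow> 'm set). (\<forall>n. closed (K n) \<and> interior (K n) = {}) \<and>
      {x. ((\<lambda>t. flow_line t x) \<longlongrightarrow> s) at_top} \<subseteq> (\<Union>n. K n))"
  have "\<exists>K. cover s K" if s: "s \<in> C" for s
  proof -
    have s': "critical_point A F s" "\<not> (\<forall>\<^sub>F y in nhds s. F s \<le> F y)" using s by (auto simp: C_def)
    show ?thesis unfolding cover_def by (rule basin_of_non_minimum[OF s']) blast
  qed
  then obtain K where "\<And>s. s \<in> C \<Longrightarrow> cover s (K s)" by metis
  then have K: "\<And>s n. s \<in> C \<Longrightarrow> closed (K s n) \<and> interior (K s n) = {}"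
    "\<And>s. s \<in> C \<Longrightarrow> {x. ((\<lambda>t. flow_line t x) \<longlongrightarrow> s) at_top} \<subseteq> (\<Union>n. K s n)"
    unfolding cover_def by blast+
  let ?G = "(\<lambda>(s, n). K s n) ` (C \<times> UNIV)"
  \<comment> \<open>Baire is applied in its form for regular locally compact spaces; a compact
    Hausdorff space is of this kind, so no metric on the surface is called for.\<close>
  have "Hausdorff_space (euclidean :: 'm topology)"
    unfolding Hausdorff_space_def using hausdorff by (auto simp: disjnt_def)
  moreover have cs: "compact_space (euclidean :: 'm topology)" using compact_UNIV by (simp add: compact_space_def)
  ultimately have reg: "regular_space (euclidean :: 'm topology)" by (rule compact_Hausdorff_imp_regular_space[rotated])
  have "finite C" by (rule finite_subset[OF _ finite_critical]) (auto simp: C_def)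
  then have "countable ?G" by (intro countable_image countable_SIGMA) (auto intro: countable_finite)
  then have "euclidean interior_of (\<Union>?G) = {}"
    by (rule Baire_category_alt[rotated]) (use K compact_imp_locally_compact_space[OF cs] reg in \<open>auto\<close>)
  then have int: "interior (\<Union>?G) = {}" by simp
  have "W \<subseteq> \<Union>?G"
  proof
    fix x assume x: "x \<in> W"
    obtain s where s: "critical_point A F s" "((\<lambda>t. flow_line t x) \<longlongrightarrow> s) at_top" by (rule flow_line_converges)
    then have sC: "s \<in> C" using that[OF x s(2,1)] neg unfolding C_def by blast
    then obtain n where "x \<in> K s n" using K(2)[OF sC] s(2) by blast
    then show "x \<in> \<Union>?G" using sC by blast
  qed
  then have "W \<subseteq> interior (\<Union>?G)" using assms(1) by (rule interior_maximal)
  then show False using int assms(2) by blast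
qed

section \<open>Time reversal and backward limits\<close>

lemma gradient_flow_minus: "gradient_flow A g (\<lambda>x. - F x)"
proof unfold_locales
  show "riemannian_metric A g" by (rule metric)
  have sm: "smooth_fun_on A UNIV (\<lambda>x. - F x)" by (rule smooth_fun_on_minus[OF open_UNIV F_smooth])
  have "morse_at (\<lambda>x. - F x) x" for x
  proof -
    obtain c where c: "c \<in> A" "x \<in> fst c" by (rule chart_cover)
    have S: "open (snd c ` fst c)" "snd c x \<in> snd c ` fst c" using chart_range_open c by auto
    have ic: "in_chart c (\<lambda>x. - F x) = (\<lambda>u. - in_chart c F u)" by (simp add: in_chart_def fun_eq_iff)
    have "chart_gradient c (\<lambda>x. - F x) x = - chart_gradient c F x"
      unfolding chart_gradient_def ic euclidean_gradient_def
      using partial_deriv_minus[OF in_chart_differentiable[OF F_smooth c UNIV_I]] by (simp add: vec_eq_iff)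
    moreover have "hessian c (\<lambda>x. - F x) x = - hessian c F x"
      unfolding hessian_eq_euclidean ic by (rule euclidean_hessian_minus[OF S F_Ck[OF c(1)]])
    moreover have "morse_at F x" using morse unfolding morse_on_def morse_at_def by blast
    ultimately show ?thesis
      unfolding morse_at_iff[OF sm c] morse_at_iff[OF F_smooth c] by (simp add: det_2)
  qed
  then show "morse_on A UNIV (\<lambda>x. - F x)" using sm unfolding morse_on_def morse_at_def by blast
qed

lemma descent_curve_reverse:
  assumes "descent_curve A g (\<lambda>x. - F x) \<gamma>"
  shows "descent_curve A g F (\<lambda>t. \<gamma> (- t))"
  unfolding descent_curve_def
proof (intro conjI allI ballI impI)
  have c\<gamma>: "continuous_on UNIV \<gamma>" using assms unfolding descent_curve_def by blast
  show "continuous_on UNIV (\<lambda>t. \<gamma> (- t))"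
    by (rule continuous_on_compose2[OF c\<gamma>]) (auto intro: continuous_intros)
  fix t c assume c: "c \<in> A" "\<gamma> (- t) \<in> fst c"
  have "((snd c \<circ> \<gamma>) has_vector_derivative - gradient g c (\<lambda>x. - F x) (\<gamma> (- t))) (at (- t))"
    using assms c unfolding descent_curve_def by blast
  moreover have "gradient g c (\<lambda>x. - F x) (\<gamma> (- t)) = - gradient g c F (\<gamma> (- t))"
  proof -
    have ic: "in_chart c (\<lambda>x. - F x) = (\<lambda>u. - in_chart c F u)" by (simp add: in_chart_def fun_eq_iff)
    have "(\<chi> i. partial_deriv i (in_chart c (\<lambda>x. - F x)) (snd c (\<gamma> (- t)))) = - (\<chi> i. partial_deriv i (in_chart c F) (snd c (\<gamma> (- t))))"
      unfolding ic using partial_deriv_minus[OF in_chart_differentiable[OF F_smooth c UNIV_I]] by (simp add: vec_eq_iff)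
    then show ?thesis by (simp add: gradient_def linear_neg[OF matrix_vector_mul_linear])
  qed
  ultimately have d: "((snd c \<circ> \<gamma>) has_vector_derivative gradient g c F (\<gamma> (- t))) (at (- t))" by simp
  have l: "((\<lambda>t. - t) has_vector_derivative - 1) (at t)" by (auto intro!: derivative_eq_intros)
  show "((snd c \<circ> (\<lambda>t. \<gamma> (- t))) has_vector_derivative - gradient g c F (\<gamma> (- t))) (at t)"
    using vector_diff_chain_at[OF l d] by (simp add: comp_def)
qed

lemma critical_point_minus: "critical_point A (\<lambda>x. - F x) x \<longleftrightarrow> critical_point A F x"
proof -
  have "partial_deriv i (in_chart c (\<lambda>x. - F x)) (snd c x) = - partial_deriv i (in_chart c F) (snd c x)"
    if "c \<in> A" "x \<in> fst c" for c i
    using partial_deriv_minus[OF in_chart_differentiable[OF F_smooth that UNIV_I]]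
    by (simp add: in_chart_def comp_def)
  then show ?thesis by (auto simp: critical_point_def)
qed

lemma flow_line_converges_backward:
  obtains s where "critical_point A F s" "((\<lambda>t. flow_line t x) \<longlongrightarrow> s) at_bot"
proof -
  interpret rev: gradient_flow A g "\<lambda>x. - F x" by (rule gradient_flow_minus)
  obtain s where s: "critical_point A (\<lambda>x. - F x) s" "((\<lambda>t. rev.flow_line t x) \<longlongrightarrow> s) at_top"
    by (rule rev.flow_line_converges)
  have "descent_curve A g (\<lambda>x. - F x) (\<lambda>t. rev.flow_line t x)"
    by (simp only: rev.descent_curve_iff rev.flow_line_curve)
  from descent_curve_reverse[OF this]
  have ic: "integral_curve UNIV (\<lambda>t. rev.flow_line (- t) x)" by (simp only: descent_curve_iff)
  have "rev.flow_line (- t) x = flow_line t x" for t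
    using flow_line_unique[OF ic open_UNIV connected_UNIV UNIV_I UNIV_I, of t] by simp
  from this[of "- _"] have "flow_line (- t) x = rev.flow_line t x" for t by simp
  then have "((\<lambda>t. flow_line t x) \<longlongrightarrow> s) at_bot"
    using s(2) by (simp add: filterlim_at_bot_mirror)
  then show ?thesis using that s(1) critical_point_minus by blast
qed

text \<open>The maximum is strict nearby, so on the collar \<open>B - V\<close> around
  \<open>q\<close> the function stays at or below a level \<open>m < F q\<close>. Backwards in time
  \<open>F\<close> does not decrease; hence a curve that starts in \<open>V\<close> above level
  \<open>m\<close> never meets the collar, and its backward limit is the only critical point in
  \<open>B\<close>, namely \<open>q\<close>. A generic choice of the start provides the forward
  limit.\<close>

theorem descent_from_local_maximum:
  assumes max: "\<forall>\<^sub>F y in nhds q. F y \<le> F q" and W: "open W" "q \<in> W"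
  obtains \<gamma> p where "descent_curve A g F \<gamma>" "\<forall>t\<le>0. \<gamma> t \<in> W" "(\<gamma> \<longlongrightarrow> q) at_bot" "(\<gamma> \<longlongrightarrow> p) at_top"
    "critical_point A F p" "\<forall>\<^sub>F y in nhds p. F p \<le> F y"
proof -
  have crit: "critical_point A F q" using local_extremum_critical max by blast
  have "\<forall>\<^sub>F y in nhds q. y \<in> W" using W by (rule eventually_nhds_in_open)
  then have "\<forall>\<^sub>F y in nhds q. F y \<le> F q \<and> (critical_point A F y \<longrightarrow> y = q) \<and> y \<in> W"
    using max critical_isolated[OF crit] by eventually_elim blast
  then obtain U where U: "open U" "q \<in> U" "\<forall>y\<in>U. F y \<le> F q \<and> (critical_point A F y \<longrightarrow> y = q) \<and> y \<in> W"
    unfolding eventually_nhds by blast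
  have strict: "F y < F q" if y: "y \<in> U" "y \<noteq> q" for y
  proof (rule ccontr)
    assume "\<not> F y < F q"
    then have "F y = F q" using U(3) y by fastforce
    then have "\<forall>\<^sub>F z in nhds y. F z \<le> F y" unfolding eventually_nhds using U y by (intro exI[of _ U]) simp
    then have "critical_point A F y" using local_extremum_critical by blast
    then show False using U(3) y by blast
  qed
  obtain V B where VB: "open V" "q \<in> V" "V \<subseteq> B" "compact B" "B \<subseteq> U" by (rule compact_neighbourhood[OF U(1,2)])
  have cB: "closed B" by (rule compact_imp_closed[OF VB(4)])
  \<comment> \<open>The maximum of \<open>F\<close> on the compact collar serves as
    \<open>m\<close>; for an empty collar any value below \<open>F q\<close> will do.\<close>
  obtain m where m: "m < F q" "\<And>y. y \<in> B - V \<Longrightarrow> F y \<le> m"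
  proof (cases "B - V = {}")
    case True
    then show ?thesis using that[of "F q - 1"] by auto
  next
    case False
    have "compact (B - V)" using VB(4,1) by (rule compact_diff)
    then obtain z where z: "z \<in> B - V" "\<And>y. y \<in> B - V \<Longrightarrow> F y \<le> F z"
      using continuous_attains_sup[OF _ False continuous_on_subset[OF F_continuous subset_UNIV]] by blast
    have "F z < F q" using z(1) VB by (intro strict) auto
    then show ?thesis using that z(2) by blast
  qed
  define N where "N = V \<inter> F -` {m<..}"
  have N: "open N" unfolding N_def
    using continuous_open_preimage[OF F_continuous open_UNIV open_greaterThan, of m] VB(1) by (intro open_Int) auto
  have qN: "q \<in> N" using VB(2) m(1) by (simp add: N_def)
  obtain x p where x: "x \<in> N" and p: "((\<lambda>t. flow_line t x) \<longlongrightarrow> p) at_top" "critical_point A F p" "\<forall>\<^sub>F y in nhds p. F p \<le> F y"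
    by (rule generic_point_flows_to_minimum[OF N]) (use qN in auto)
  have stay: "flow_line t x \<in> V" if t: "t \<le> 0" for t
  proof (rule ccontr)
    assume out: "flow_line t x \<notin> V"
    let ?I = "(\<lambda>t. flow_line t x) ` {t..0}"
    have conn: "connected ?I"
      by (rule connected_continuous_image) (auto intro: continuous_at_imp_continuous_on flow_line_isCont)
    have "z \<notin> B - V" if z: "z \<in> ?I" for z
    proof
      assume zB: "z \<in> B - V"
      obtain s where s: "s \<le> 0" "z = flow_line s x" using z by auto
      have "F x \<le> F z" using energy_antimono[OF s(1), of x] s(2) by simp
      then show False using m(2)[OF zB] x by (simp add: N_def)
    qed
    then have sub: "?I \<subseteq> V \<union> - B" by blast
    have "x \<in> ?I" by (rule image_eqI[of _ _ 0]) (use t in auto)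
    moreover have "flow_line t x \<in> ?I" using t by auto
    moreover have "V \<inter> ?I = {} \<or> - B \<inter> ?I = {}"
      using connectedD[OF conn VB(1), of "- B"] cB sub VB(3) by blast
    ultimately show False using x out sub by (auto simp: N_def)
  qed
  obtain s where s: "critical_point A F s" "((\<lambda>t. flow_line t x) \<longlongrightarrow> s) at_bot"
    by (rule flow_line_converges_backward)
  have "\<forall>\<^sub>F t in at_bot. flow_line t x \<in> B"
    by (rule eventually_mono[OF eventually_le_at_bot[of 0]]) (use stay VB(3) in blast)
  then have "s \<in> B" using Lim_in_closed_set[OF cB _ _ s(2)] by simp
  then have "s = q" using U(3) VB(5) s(1) by blast
  then show ?thesis
    using that[of "\<lambda>t. flow_line t x" p] flow_line_curve descent_curve_iff stay VB U s(2) p by blast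
qed

end

section \<open>Nodal and Neumann domains\<close>

locale dirichlet_morse_function = gradient_flow A g "morse_extension A M f"
  for A :: "('m::t2_space) chart set" and g :: "'m metric" and M :: "'m set" and f :: "'m \<Rightarrow> real" +
  assumes compact_M: "compact M"
    and extension_eq: "x \<in> M \<Longrightarrow> morse_extension A M f x = f x"
    and dirichlet: "dirichlet M f"
begin

abbreviation F :: "'m \<Rightarrow> real" where "F \<equiv> morse_extension A M f"

lemma closed_M: "closed M"
  using compact_M by (rule compact_imp_closed)

section \<open>The stopped flow along a descent curve\<close>

lemma descent_curve_flow_line: "descent_curve A g F \<gamma> \<Longrightarrow> \<gamma> t = flow_line t (\<gamma> 0)"
  using flow_line_unique[of UNIV \<gamma> t] by (simp add: descent_curve_iff)

lemma flow_eq: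
  assumes "descent_curve A g F \<gamma>"
  shows "flow A g M f t (\<gamma> 0) = (if 0 \<le> t then
      (if \<forall>s\<in>{0..t}. \<gamma> s \<in> M then \<gamma> t else \<gamma> (LEAST s. s \<in> {0..t} \<and> \<gamma> s \<in> frontier M))
    else (if \<forall>s\<in>{t..0}. \<gamma> s \<in> M then \<gamma> t else \<gamma> (GREATEST s. s \<in> {t..0} \<and> \<gamma> s \<in> frontier M)))"
  unfolding flow_def Let_def full_flow_eq descent_curve_flow_line[OF assms, symmetric] ..

lemma stable_set_stay:
  assumes "descent_curve A g F \<gamma>" "\<forall>t\<ge>0. \<gamma> t \<in> M" "(\<gamma> \<longlongrightarrow> p) at_top"
  shows "\<gamma> 0 \<in> stable_set A g M f p"
proof -
  have "\<forall>\<^sub>F t in at_top. \<gamma> t = flow A g M f t (\<gamma> 0)"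
    by (rule eventually_mono[OF eventually_ge_at_top[of 0]]) (use assms(2) in \<open>simp add: flow_eq[OF assms(1)]\<close>)
  then have "((\<lambda>t. flow A g M f t (\<gamma> 0)) \<longlongrightarrow> p) at_top"
    by (rule Lim_transform_eventually[OF assms(3)])
  then show ?thesis using assms(2) by (simp add: stable_set_def)
qed

lemma unstable_set_stay:
  assumes "descent_curve A g F \<gamma>" "\<forall>t\<le>0. \<gamma> t \<in> M" "(\<gamma> \<longlongrightarrow> q) at_bot"
  shows "\<gamma> 0 \<in> unstable_set A g M f q"
proof -
  have "\<forall>\<^sub>F t in at_bot. \<gamma> t = flow A g M f t (\<gamma> 0)"
  proof (rule eventually_mono[OF eventually_le_at_bot[of 0]])
    fix t :: real assume "t \<le> 0"
    then show "\<gamma> t = flow A g M f t (\<gamma> 0)"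
      \<comment> \<open>Time 0 belongs to the forward branch of \<open>flow\<close> and is treated
        apart.\<close>
      using assms(2) by (cases "t = 0") (auto simp: flow_eq[OF assms(1)])
  qed
  then have "((\<lambda>t. flow A g M f t (\<gamma> 0)) \<longlongrightarrow> q) at_bot"
    by (rule Lim_transform_eventually[OF assms(3)])
  then show ?thesis using assms(2) by (simp add: unstable_set_def)
qed

lemma path_meets_frontier:
  assumes "descent_curve A g F \<gamma>" "a \<le> b" "\<gamma> a \<in> M \<and> \<gamma> b \<notin> M \<or> \<gamma> a \<notin> M \<and> \<gamma> b \<in> M"
  obtains s where "s \<in> {a..b}" "\<gamma> s \<in> frontier M"
proof -
  have c: "continuous_on UNIV \<gamma>" using assms(1) unfolding descent_curve_def by blast
  have "connected (\<gamma> ` {a..b})"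
    by (rule connected_continuous_image[OF continuous_on_subset[OF c subset_UNIV] connected_Icc])
  moreover have "\<gamma> a \<in> \<gamma> ` {a..b}" "\<gamma> b \<in> \<gamma> ` {a..b}" using assms(2) by auto
  ultimately have "\<gamma> ` {a..b} \<inter> frontier M \<noteq> {}"
    using assms(3) by (intro connected_Int_frontier) blast+
  then show ?thesis using that by blast
qed

lemma closed_frontier_times:
  assumes "descent_curve A g F \<gamma>"
  shows "closed {s. \<gamma> s \<in> frontier M}"
proof -
  have "continuous_on UNIV \<gamma>" using assms unfolding descent_curve_def by blast
  from closed_vimage[OF frontier_closed this] show ?thesis by (simp add: vimage_def)
qed

text \<open>A curve that leaves \<open>M\<close> meets the frontier, and the set of hitting times is
  closed, so there is a first one. The stopped flow freezes at that point, even if the curve only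
  touches the frontier then and leaves \<open>M\<close> later; being eventually constant, it
  converges.\<close>

lemma stable_set_exit:
  assumes \<gamma>: "descent_curve A g F \<gamma>" and "\<gamma> 0 \<in> M" "t1 \<ge> 0" "\<gamma> t1 \<notin> M"
  obtains t0 where "\<gamma> t0 \<in> frontier M" "\<gamma> 0 \<in> stable_set A g M f (\<gamma> t0)"
proof -
  obtain s1 where s1: "s1 \<in> {0..t1}" "\<gamma> s1 \<in> frontier M"
    by (rule path_meets_frontier[OF \<gamma> assms(3)]) (use assms in auto)
  let ?Z = "{0..} \<inter> {s. \<gamma> s \<in> frontier M}"
  define t0 where "t0 = Inf ?Z"
  have Z: "closed ?Z" "bdd_below ?Z" "?Z \<noteq> {}"
    using closed_frontier_times[OF \<gamma>] s1 by (auto intro: closed_Int bdd_belowI[of _ 0])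
  have t0: "t0 \<in> ?Z" unfolding t0_def by (rule closed_contains_Inf[OF Z(3,2,1)])
  have least: "t0 \<le> s" if "s \<in> ?Z" for s unfolding t0_def by (rule cInf_lower[OF that Z(2)])
  have "t0 \<le> t1" using least[of s1] s1 by auto
  have "flow A g M f t (\<gamma> 0) = \<gamma> t0" if t: "t \<ge> t1" for t
  proof -
    \<comment> \<open>\<open>LEAST\<close> ranges over reals and is meaningful because the infimum
      \<open>t0\<close> is attained; it gives the same value for every
      \<open>t \<ge> t1\<close>.\<close>
    have "(LEAST s. s \<in> {0..t} \<and> \<gamma> s \<in> frontier M) = t0"
      by (rule Least_equality) (use t0 least t \<open>t0 \<le> t1\<close> in auto)
    moreover have "\<not> (\<forall>s\<in>{0..t}. \<gamma> s \<in> M)" using assms(3,4) t by auto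
    ultimately show ?thesis using t assms(3) by (simp add: flow_eq[OF \<gamma>]) blast
  qed
  then have "\<forall>\<^sub>F t in at_top. flow A g M f t (\<gamma> 0) = \<gamma> t0"
    unfolding eventually_at_top_linorder by blast
  then have "((\<lambda>t. flow A g M f t (\<gamma> 0)) \<longlongrightarrow> \<gamma> t0) at_top" by (rule tendsto_eventually)
  then show ?thesis using that t0 assms(2) by (auto simp: stable_set_def)
qed

lemma unstable_set_exit:
  assumes \<gamma>: "descent_curve A g F \<gamma>" and "\<gamma> 0 \<in> M" "t1 \<le> 0" "\<gamma> t1 \<notin> M"
  obtains t0 where "\<gamma> t0 \<in> frontier M" "\<gamma> 0 \<in> unstable_set A g M f (\<gamma> t0)"
proof -
  obtain s1 where s1: "s1 \<in> {t1..0}" "\<gamma> s1 \<in> frontier M"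
    by (rule path_meets_frontier[OF \<gamma> assms(3)]) (use assms in auto)
  \<comment> \<open>Strict negativity puts all times \<open>t \<le> t1\<close> into the backward
    branch of \<open>flow\<close>.\<close>
  have "t1 < 0" using assms by (cases "t1 = 0") auto
  let ?Z = "{..0} \<inter> {s. \<gamma> s \<in> frontier M}"
  define t0 where "t0 = Sup ?Z"
  have Z: "closed ?Z" "bdd_above ?Z" "?Z \<noteq> {}"
    using closed_frontier_times[OF \<gamma>] s1 by (auto intro: closed_Int bdd_aboveI[of _ 0])
  have t0: "t0 \<in> ?Z" unfolding t0_def by (rule closed_contains_Sup[OF Z(3,2,1)])
  have greatest: "s \<le> t0" if "s \<in> ?Z" for s unfolding t0_def by (rule cSup_upper[OF that Z(2)])
  have "t1 \<le> t0" using greatest[of s1] s1 by auto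
  have "flow A g M f t (\<gamma> 0) = \<gamma> t0" if t: "t \<le> t1" for t
  proof -
    have "(GREATEST s. s \<in> {t..0} \<and> \<gamma> s \<in> frontier M) = t0"
      by (rule Greatest_equality) (use t0 greatest t \<open>t1 \<le> t0\<close> in auto)
    moreover have "\<not> (\<forall>s\<in>{t..0}. \<gamma> s \<in> M)" using assms(3,4) t by auto
    ultimately show ?thesis using t \<open>t1 < 0\<close> by (simp add: flow_eq[OF \<gamma>]) blast
  qed
  then have "\<forall>\<^sub>F t in at_bot. flow A g M f t (\<gamma> 0) = \<gamma> t0"
    unfolding eventually_at_bot_linorder by blast
  then have "((\<lambda>t. flow A g M f t (\<gamma> 0)) \<longlongrightarrow> \<gamma> t0) at_bot" by (rule tendsto_eventually)
  then show ?thesis using that t0 assms(2) by (auto simp: unstable_set_def)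
qed

text \<open>A critical point is a rest point of the flow: a curve through one is constant, contrary
  to its start in the interior of \<open>M\<close>. Stopping at a saddle would exclude the curve
  from every boundary Neumann domain.\<close>

lemma frontier_exit_not_saddle:
  assumes "descent_curve A g F \<gamma>" "\<gamma> 0 \<in> interior M" "\<gamma> t \<in> frontier M"
  shows "\<gamma> t \<notin> saddles A M f"
proof
  assume "\<gamma> t \<in> saddles A M f"
  then have "critical_point A F (\<gamma> t)" by (simp add: saddles_def crit_pts_def)
  then have "\<gamma> t = flow_line (- t) (\<gamma> t)" by (rule flow_line_critical[symmetric])
  also have "\<dots> = flow_line (- t) (flow_line t (\<gamma> 0))"
    using descent_curve_flow_line[OF assms(1), of t] by simp
  also have "\<dots> = \<gamma> 0" by (simp only: flow_line_add[symmetric] left_minus flow_line_0)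
  finally show False using assms(2,3) by (simp add: frontier_def)
qed

section \<open>Neumann domains attached to interior extrema\<close>

lemma component_in_subset:
  assumes "x \<in> S"
  obtains X where "X \<in> components S" "X \<noteq> {}" "X \<subseteq> S"
  using assms that[of "connected_component_set S x"]
  by (metis componentsI connected_component_eq_empty connected_component_subset)

lemma neumann_domain_of_maximum:
  assumes q: "q \<in> maxima A M f" "q \<in> interior M"
  obtains X where "X \<noteq> {}" "X \<subseteq> unstable_set A g M f q"
    "X \<in> inner_neumann_domains A g M f \<union> boundary_neumann_domains A g M f"
proof -
  have "\<forall>\<^sub>F y in nhds q. F y \<le> F q" using q(1) by (simp add: maxima_def)
  then obtain \<gamma> p where \<gamma>: "descent_curve A g F \<gamma>" "\<forall>t\<le>0. \<gamma> t \<in> interior M" "(\<gamma> \<longlongrightarrow> q) at_bot"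
    and p: "(\<gamma> \<longlongrightarrow> p) at_top" "critical_point A F p" "\<forall>\<^sub>F y in nhds p. F p \<le> F y"
    by (rule descent_from_local_maximum[OF _ open_interior q(2)])
  have x: "\<gamma> 0 \<in> interior M" "\<gamma> 0 \<in> M" using \<gamma>(2) interior_subset by auto
  have u: "\<gamma> 0 \<in> unstable_set A g M f q"
    by (rule unstable_set_stay[OF \<gamma>(1) _ \<gamma>(3)]) (use \<gamma>(2) interior_subset in blast)
  show ?thesis
  proof (cases "\<forall>t\<ge>0. \<gamma> t \<in> M")
    case True
    have "\<forall>\<^sub>F t in at_top. \<gamma> t \<in> M"
      by (rule eventually_mono[OF eventually_ge_at_top[of 0]]) (use True in blast)
    \<comment> \<open>\<open>p\<close> may lie on the frontier. This does no harm:
      \<open>minima\<close> admits every local minimum of the extension that lies in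
      \<open>M\<close>.\<close>
    then have "p \<in> M" using Lim_in_closed_set[OF closed_M _ _ p(1)] by simp
    then have pm: "p \<in> minima A M f" using p by (simp add: minima_def crit_pts_def)
    have "\<gamma> 0 \<in> stable_set A g M f p \<inter> unstable_set A g M f q"
      using stable_set_stay[OF \<gamma>(1) True p(1)] u by blast
    then obtain X where X: "X \<in> components (stable_set A g M f p \<inter> unstable_set A g M f q)" "X \<noteq> {}"
        "X \<subseteq> stable_set A g M f p \<inter> unstable_set A g M f q" by (rule component_in_subset)
    then have "X \<in> inner_neumann_domains A g M f"
      unfolding inner_neumann_domains_def using pm q(1) by blast
    then show ?thesis using that X by blast
  next
    case False
    then obtain t1 where "t1 \<ge> 0" "\<gamma> t1 \<notin> M" by blast
    then obtain t0 where t0: "\<gamma> t0 \<in> frontier M" "\<gamma> 0 \<in> stable_set A g M f (\<gamma> t0)"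
      by (rule stable_set_exit[OF \<gamma>(1) x(2)])
    let ?S = "(\<Union>y\<in>frontier M - saddles A M f. stable_set A g M f y) \<inter> unstable_set A g M f q"
    have "\<gamma> 0 \<in> ?S" using frontier_exit_not_saddle[OF \<gamma>(1) x(1) t0(1)] t0 u by blast
    then obtain X where X: "X \<in> components ?S" "X \<noteq> {}" "X \<subseteq> ?S" by (rule component_in_subset)
    then have "X \<in> boundary_neumann_domains A g M f"
      unfolding boundary_neumann_domains_def using q(1) by blast
    then show ?thesis using that X by blast
  qed
qed

lemma neumann_domain_of_minimum:
  assumes p: "p \<in> minima A M f" "p \<in> interior M"
  obtains X where "X \<noteq> {}" "X \<subseteq> stable_set A g M f p"
    "X \<in> inner_neumann_domains A g M f \<union> boundary_neumann_domains A g M f"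
proof -
  interpret rev: gradient_flow A g "\<lambda>x. - F x" by (rule gradient_flow_minus)
  have "\<forall>\<^sub>F y in nhds p. - F y \<le> - F p" using p(1) by (simp add: minima_def)
  then obtain \<delta> q where \<delta>: "descent_curve A g (\<lambda>x. - F x) \<delta>" "\<forall>t\<le>0. \<delta> t \<in> interior M" "(\<delta> \<longlongrightarrow> p) at_bot"
    and q: "(\<delta> \<longlongrightarrow> q) at_top" "critical_point A (\<lambda>x. - F x) q" "\<forall>\<^sub>F y in nhds q. - F q \<le> - F y"
    by (rule rev.descent_from_local_maximum[OF _ open_interior p(2)])
  \<comment> \<open>A descent curve of \<open>- F\<close> run backwards is a descent curve of
    \<open>F\<close>, so the backward limit \<open>p\<close> of \<open>\<delta>\<close> becomes the
    forward limit of \<open>\<gamma>\<close>.\<close>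
  define \<gamma> where "\<gamma> = (\<lambda>t. \<delta> (- t))"
  have \<gamma>: "descent_curve A g F \<gamma>" "\<forall>t\<ge>0. \<gamma> t \<in> interior M" "(\<gamma> \<longlongrightarrow> p) at_top" "(\<gamma> \<longlongrightarrow> q) at_bot"
    using descent_curve_reverse[OF \<delta>(1)] \<delta>(2,3) q(1)
    by (auto simp: \<gamma>_def filterlim_at_bot_mirror)
  have x: "\<gamma> 0 \<in> interior M" "\<gamma> 0 \<in> M" using \<gamma>(2) interior_subset by auto
  have u: "\<gamma> 0 \<in> stable_set A g M f p"
    by (rule stable_set_stay[OF \<gamma>(1) _ \<gamma>(3)]) (use \<gamma>(2) interior_subset in blast)
  show ?thesis
  proof (cases "\<forall>t\<le>0. \<gamma> t \<in> M")
    case True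
    have "\<forall>\<^sub>F t in at_bot. \<gamma> t \<in> M"
      by (rule eventually_mono[OF eventually_le_at_bot[of 0]]) (use True in blast)
    then have "q \<in> M" using Lim_in_closed_set[OF closed_M _ _ \<gamma>(4)] by simp
    then have qm: "q \<in> maxima A M f" using q critical_point_minus by (simp add: maxima_def crit_pts_def)
    have "\<gamma> 0 \<in> stable_set A g M f p \<inter> unstable_set A g M f q"
      using unstable_set_stay[OF \<gamma>(1) True \<gamma>(4)] u by blast
    then obtain X where X: "X \<in> components (stable_set A g M f p \<inter> unstable_set A g M f q)" "X \<noteq> {}"
        "X \<subseteq> stable_set A g M f p \<inter> unstable_set A g M f q" by (rule component_in_subset)
    then have "X \<in> inner_neumann_domains A g M f"
      unfolding inner_neumann_domains_def using qm p(1) by blast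
    then show ?thesis using that X by blast
  next
    case False
    then obtain t1 where "t1 \<le> 0" "\<gamma> t1 \<notin> M" by blast
    then obtain t0 where t0: "\<gamma> t0 \<in> frontier M" "\<gamma> 0 \<in> unstable_set A g M f (\<gamma> t0)"
      by (rule unstable_set_exit[OF \<gamma>(1) x(2)])
    let ?S = "stable_set A g M f p \<inter> (\<Union>y\<in>frontier M - saddles A M f. unstable_set A g M f y)"
    have "\<gamma> 0 \<in> ?S" using frontier_exit_not_saddle[OF \<gamma>(1) x(1) t0(1)] t0 u by blast
    then obtain X where X: "X \<in> components ?S" "X \<noteq> {}" "X \<subseteq> ?S" by (rule component_in_subset)
    then have "X \<in> boundary_neumann_domains A g M f"
      unfolding boundary_neumann_domains_def using p(1) by blast
    then show ?thesis using that X by blast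
  qed
qed

section \<open>Nodal domains and their extrema\<close>

lemma nodal_set_open: "open (M - f -` {0})" "M - f -` {0} \<subseteq> interior M"
proof -
  show sub: "M - f -` {0} \<subseteq> interior M"
  proof
    fix x assume x: "x \<in> M - f -` {0}"
    then have "x \<notin> frontier M" using dirichlet unfolding dirichlet_def by auto
    then show "x \<in> interior M" using x closure_subset by (auto simp: frontier_def)
  qed
  have "M - f -` {0} = interior M \<inter> F -` (- {0})"
    using sub extension_eq interior_subset[of M] by auto
  moreover have "open (F -` (- {0}))"
    using continuous_open_preimage[OF F_continuous open_UNIV open_Compl[OF closed_singleton[of 0]]] by simp
  ultimately show "open (M - f -` {0})" by (simp only: open_Int open_interior)
qed

text \<open>Coordinate balls are connected, so the surface is locally connected and components of
  its open sets are open.\<close>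

lemma nodal_domain_open:
  assumes D: "D \<in> nodal_domains M f"
  shows "open D"
proof (subst open_subopen, rule ballI)
  fix x assume x: "x \<in> D"
  have D': "D \<in> components (M - f -` {0})" using D by (simp add: nodal_domains_def)
  have xU: "x \<in> M - f -` {0}" using x in_components_subset[OF D'] by blast
  obtain c where c: "c \<in> A" "x \<in> fst c" by (rule chart_cover)
  obtain r where r: "r > 0" "cball (snd c x) r \<subseteq> snd c ` (fst c \<inter> (M - f -` {0}))"
    by (rule chart_ball[OF c nodal_set_open(1) xU])
  have b: "ball (snd c x) r \<subseteq> snd c ` (fst c \<inter> (M - f -` {0}))"
    using r(2) ball_subset_cball by (rule order_trans[rotated])
  then have b': "ball (snd c x) r \<subseteq> snd c ` fst c" by blast
  let ?V = "inv_into (fst c) (snd c) ` ball (snd c x) r"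
  have mem: "y \<in> ?V \<longleftrightarrow> y \<in> fst c \<and> snd c y \<in> ball (snd c x) r" for y
    by (rule mem_inv_image_iff[OF c(1) b'])
  have xV: "x \<in> ?V" unfolding mem using c r by simp
  have "?V \<subseteq> M - f -` {0}"
  proof
    fix y assume "y \<in> ?V"
    then have "y \<in> fst c" "snd c y \<in> snd c ` (fst c \<inter> (M - f -` {0}))" using mem b by blast+
    then show "y \<in> M - f -` {0}" using inj_on_chart[OF c(1)] by (auto dest: inj_onD)
  qed
  moreover have "connected ?V"
    by (rule connected_continuous_image[OF continuous_on_subset[OF continuous_on_inv_chart[OF c(1)] b']]) simp
  ultimately have "?V \<subseteq> D" using components_maximal[OF D'] x xV by blast
  then show "\<exists>T. open T \<and> x \<in> T \<and> T \<subseteq> D"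
    using open_inv_chart_image[OF c(1) open_ball b'] xV by blast
qed

text \<open>The extremum is a maximum point of \<open>\<bar>f\<bar>\<close> on the closure of the nodal domain.\<close>

lemma nodal_domain_extremum:
  assumes D: "D \<in> nodal_domains M f"
  obtains z where "z \<in> D" "z \<in> interior M" "z \<in> maxima A M f \<or> z \<in> minima A M f"
proof -
  let ?N = "M - f -` {0}"
  have D': "D \<in> components ?N" using D by (simp add: nodal_domains_def)
  have DN: "D \<subseteq> ?N" and ne: "D \<noteq> {}" using in_components_subset[OF D'] in_components_nonempty[OF D'] by auto
  have cM: "closure D \<subseteq> M" using DN closed_M by (intro closure_minimal) auto
  have cD: "compact (closure D)" using compact_Int_closed[OF compact_M closed_closure, of D] cM by (simp add: Int_absorb1)
  have cne: "closure D \<noteq> {}" using ne by simp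
  have "continuous_on (closure D) (\<lambda>x. \<bar>F x\<bar>)"
    by (intro continuous_intros continuous_on_subset[OF F_continuous subset_UNIV])
  from continuous_attains_sup[OF cD cne this]
  obtain z where z: "z \<in> closure D" "\<And>y. y \<in> closure D \<Longrightarrow> \<bar>F y\<bar> \<le> \<bar>F z\<bar>" by blast
  obtain y where y: "y \<in> D" using ne by blast
  then have "F y \<noteq> 0" using DN extension_eq[of y] by auto
  then have Fz: "F z \<noteq> 0" using z(2)[of y] y closure_subset by force
  then have zN: "z \<in> ?N" using cM z(1) extension_eq[of z] by auto
  \<comment> \<open>Adding a point of the closure keeps \<open>D\<close> connected. Since
    \<open>z\<close> is no zero of \<open>f\<close>, maximality of the component gives
    \<open>z \<in> D\<close>.\<close>
  have "connected (insert z D)"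
    by (rule connected_intermediate_closure[OF in_components_connected[OF D']]) (use z(1) closure_subset in auto)
  then have "insert z D \<subseteq> D" using components_maximal[OF D'] zN DN ne by blast
  then have zD: "z \<in> D" by blast
  have zi: "z \<in> interior M" using zN nodal_set_open(2) by blast
  have near: "\<forall>\<^sub>F y in nhds z. \<bar>F y\<bar> \<le> \<bar>F z\<bar>"
    unfolding eventually_nhds using nodal_domain_open[OF D] zD z(2) closure_subset by blast
  have "z \<in> maxima A M f \<or> z \<in> minima A M f"
  proof (cases "F z > 0")
    case True
    have "\<forall>\<^sub>F y in nhds z. F y \<le> F z" using near by eventually_elim (use True in auto)
    then show ?thesis using local_extremum_critical zN by (auto simp: maxima_def crit_pts_def)
  next
    case False
    have "\<forall>\<^sub>F y in nhds z. F z \<le> F y" using near by eventually_elim (use False in auto)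
    then show ?thesis using local_extremum_critical zN by (auto simp: minima_def crit_pts_def)
  qed
  then show ?thesis using that zD zi by blast
qed

section \<open>Counting\<close>

lemma stable_set_unique: "x \<in> stable_set A g M f p \<Longrightarrow> x \<in> stable_set A g M f q \<Longrightarrow> p = q"
  unfolding stable_set_def using tendsto_unique[OF trivial_limit_at_top_linorder] by blast

lemma unstable_set_unique: "x \<in> unstable_set A g M f p \<Longrightarrow> x \<in> unstable_set A g M f q \<Longrightarrow> p = q"
  unfolding unstable_set_def using tendsto_unique[OF trivial_limit_at_bot_linorder] by blast

text \<open>By definition the points of a boundary domain have a frontier limit in one direction of
  time, and limits of the stopped flow are unique.\<close>

lemma boundary_neumann_domain_one_interior_limit:
  assumes X: "X \<in> boundary_neumann_domains A g M f" and x: "x \<in> X"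
    and "x \<in> stable_set A g M f p" "x \<in> unstable_set A g M f q"
  shows "p \<notin> interior M \<or> q \<notin> interior M"
proof -
  have fr: "y \<notin> interior M" if "y \<in> frontier M" for y using that by (simp add: frontier_def)
  have sub: "X \<subseteq> S" if "X \<in> components S" for S using in_components_subset[OF that] .
  from X consider y where "y \<in> frontier M" "x \<in> unstable_set A g M f y"
    | y where "y \<in> frontier M" "x \<in> stable_set A g M f y"
    unfolding boundary_neumann_domains_def using x sub by fast
  then show ?thesis
    by cases (use assms(3,4) fr stable_set_unique unstable_set_unique in blast)+
qed

text \<open>One extremum is chosen in each nodal domain; by disjointness, different domains have
  different extrema. Attaching Neumann domains is injective on the maxima and on the minima
  separately, as each limit is unique. An inner domain can be used once by either map, a boundary
  domain only once altogether.\<close>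

lemma card_nodal_domains_le:
  assumes fin: "finite (inner_neumann_domains A g M f)" "finite (boundary_neumann_domains A g M f)"
  shows "finite (nodal_domains M f)"
    and "card (nodal_domains M f) \<le> 2 * card (inner_neumann_domains A g M f) + card (boundary_neumann_domains A g M f)"
proof -
  let ?N = "nodal_domains M f" and ?I = "inner_neumann_domains A g M f" and ?B = "boundary_neumann_domains A g M f"
  have "\<exists>z. z \<in> D \<and> z \<in> interior M \<and> (z \<in> maxima A M f \<or> z \<in> minima A M f)" if "D \<in> ?N" for D
    by (rule nodal_domain_extremum[OF that]) blast
  then obtain z where z: "\<And>D. D \<in> ?N \<Longrightarrow> z D \<in> D \<and> z D \<in> interior M \<and> (z D \<in> maxima A M f \<or> z D \<in> minima A M f)"
    by metis
  have zinj: "D = D'" if "D \<in> ?N" "D' \<in> ?N" "z D = z D'" for D D'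
    using components_eq[of D "M - f -` {0}" D'] that z[OF that(1)] z[OF that(2)]
    unfolding nodal_domains_def by auto
  \<comment> \<open>\<open>P\<close> holds the nodal domains whose chosen extremum is a maximum; for
    the others, in \<open>Q\<close>, it is a minimum.\<close>
  define P where "P = {D \<in> ?N. z D \<in> maxima A M f}"
  define Q where "Q = ?N - P"
  have zP: "z D \<in> maxima A M f" "z D \<in> interior M" "D \<in> ?N" if "D \<in> P" for D using that z unfolding P_def by auto
  have zQ: "z D \<in> minima A M f" "z D \<in> interior M" "D \<in> ?N" if "D \<in> Q" for D using that z unfolding P_def Q_def by auto
  have "\<exists>X. X \<noteq> {} \<and> X \<subseteq> unstable_set A g M f (z D) \<and> X \<in> ?I \<union> ?B" if "D \<in> P" for D
    by (rule neumann_domain_of_maximum[OF zP(1,2)[OF that]]) blast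
  then obtain X where X: "\<And>D. D \<in> P \<Longrightarrow> X D \<noteq> {} \<and> X D \<subseteq> unstable_set A g M f (z D) \<and> X D \<in> ?I \<union> ?B" by metis
  have "\<exists>Y. Y \<noteq> {} \<and> Y \<subseteq> stable_set A g M f (z D) \<and> Y \<in> ?I \<union> ?B" if "D \<in> Q" for D
    by (rule neumann_domain_of_minimum[OF zQ(1,2)[OF that]]) blast
  then obtain Y where Y: "\<And>D. D \<in> Q \<Longrightarrow> Y D \<noteq> {} \<and> Y D \<subseteq> stable_set A g M f (z D) \<and> Y D \<in> ?I \<union> ?B" by metis
  have Xinj: "inj_on X P"
  proof (rule inj_onI)
    fix D D' assume D: "D \<in> P" "D' \<in> P" "X D = X D'"
    obtain x where "x \<in> X D" using X[OF D(1)] by blast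
    then have "z D = z D'" using X[OF D(1)] X[OF D(2)] D(3) by (intro unstable_set_unique[of x]) auto
    then show "D = D'" using zinj zP(3) D by blast
  qed
  have Yinj: "inj_on Y Q"
  proof (rule inj_onI)
    fix D D' assume D: "D \<in> Q" "D' \<in> Q" "Y D = Y D'"
    obtain x where "x \<in> Y D" using Y[OF D(1)] by blast
    then have "z D = z D'" using Y[OF D(1)] Y[OF D(2)] D(3) by (intro stable_set_unique[of x]) auto
    then show "D = D'" using zinj zQ(3) D by blast
  qed
  have XI: "X ` P \<subseteq> ?I \<union> ?B" and YI: "Y ` Q \<subseteq> ?I \<union> ?B" using X Y by blast+
  have finP: "finite P" by (rule inj_on_finite[OF Xinj XI]) (use fin in simp)
  have finQ: "finite Q" by (rule inj_on_finite[OF Yinj YI]) (use fin in simp)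
  have NPQ: "?N = P \<union> Q" "P \<inter> Q = {}" unfolding P_def Q_def by auto
  show "finite ?N" using finP finQ NPQ(1) by simp
  \<comment> \<open>A boundary domain used by both maps would contain a point whose forward and
    backward limits are both interior.\<close>
  have disj: "X ` P \<inter> ?B \<inter> (Y ` Q \<inter> ?B) = {}"
  proof (rule ccontr)
    assume "X ` P \<inter> ?B \<inter> (Y ` Q \<inter> ?B) \<noteq> {}"
    then obtain D D' where D: "D \<in> P" "D' \<in> Q" "X D = Y D'" "X D \<in> ?B" by auto
    obtain x where x: "x \<in> X D" using X[OF D(1)] by blast
    then have "x \<in> unstable_set A g M f (z D)" "x \<in> stable_set A g M f (z D')"
      using X[OF D(1)] Y[OF D(2)] D(3) by auto
    then show False
      using boundary_neumann_domain_one_interior_limit[OF D(4) x] zP(2)[OF D(1)] zQ(2)[OF D(2)] by blast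
  qed
  have "card (X ` P) \<le> card ?I + card (X ` P \<inter> ?B)"
    by (rule order_trans[OF card_mono card_Un_le]) (use XI fin in auto)
  moreover have "card (Y ` Q) \<le> card ?I + card (Y ` Q \<inter> ?B)"
    by (rule order_trans[OF card_mono card_Un_le]) (use YI fin in auto)
  moreover have "card (X ` P \<inter> ?B) + card (Y ` Q \<inter> ?B) = card ((X ` P \<inter> ?B) \<union> (Y ` Q \<inter> ?B))"
    by (rule card_Un_disjoint[symmetric]) (use fin disj in auto)
  moreover have "\<dots> \<le> card ?B" by (rule card_mono) (use fin in auto)
  moreover have "card ?N = card P + card Q" unfolding NPQ(1) by (rule card_Un_disjoint[OF finP finQ NPQ(2)])
  moreover have "card (X ` P) = card P" "card (Y ` Q) = card Q" using card_image Xinj Yinj by auto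
  ultimately show "card ?N \<le> 2 * card ?I + card ?B" by linarith
qed

end

theorem corollary5p1:
  fixes A :: "('m::t2_space) chart set"
    and g :: "'m metric"
    and M :: "'m set"
    and f :: "'m \<Rightarrow> real"
    and ev :: real
    and \<mu>in \<mu>bd \<mu> \<nu> :: enat
  assumes "compact (UNIV :: 'm set)"
    and "smooth_atlas A"
    and "riemannian_metric A g"
    and "compact M"
    and "simply_connected M"
    and "piecewise_smooth_boundary A g M"
    and "boundary_angles_positive A g M"
    and "morse_eigenfunction A g M ev f"
    and "extension_property A M f"
    and "dirichlet M f"
    and "\<mu>in = number_of (inner_neumann_domains A g M f)"
    and "\<mu>bd = number_of (boundary_neumann_domains A g M f)"
    and "\<mu> = \<mu>in + \<mu>bd"
    and "\<nu> = number_of (nodal_domains M f)"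
  shows "2 * \<mu>in + \<mu>bd \<ge> \<nu> \<and> 2 * \<mu> \<ge> \<nu>"
proof -
  interpret compact_manifold A using assms(1,2) by unfold_locales
  obtain W F where W: "open W" "M \<subseteq> W" "morse_on A W F" "\<forall>x\<in>M. F x = f x"
    using assms(9) unfolding extension_property_def by blast
  \<comment> \<open>\<open>morse_extension\<close> is a \<open>SOME\<close> choice; its properties
    are available only once an extension is known to exist.\<close>
  have "\<exists>G. morse_on A UNIV G \<and> (\<forall>x\<in>M. G x = f x)"
    using morse_extension_exists[OF W(1) assms(4) W(2,3)] W(4) by simp
  from someI_ex[OF this]
  have ext: "morse_on A UNIV (morse_extension A M f)" "\<forall>x\<in>M. morse_extension A M f x = f x"
    unfolding morse_extension_def by auto
  interpret dirichlet_morse_function A g M f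
    using assms(3,4,10) ext by unfold_locales auto
  let ?I = "inner_neumann_domains A g M f" and ?B = "boundary_neumann_domains A g M f"
  have le: "\<nu> \<le> 2 * \<mu>in + \<mu>bd"
  proof (cases "finite ?I \<and> finite ?B")
    case True
    then show ?thesis
      using card_nodal_domains_le assms(11,12,14) by (simp add: number_of_def numeral_eq_enat)
  next
    case False
    then have "2 * \<mu>in + \<mu>bd = \<infinity>"
      using assms(11,12) by (auto simp: number_of_def numeral_eq_enat)
    then show ?thesis by simp
  qed
  also have "\<dots> \<le> 2 * \<mu>in + 2 * \<mu>bd"
    by (intro add_left_mono) (metis add_increasing2 mult_2 order_refl zero_le)
  also have "\<dots> = 2 * \<mu>" using assms(13) by (simp add: distrib_left)
  finally show ?thesis using le by blast
qed

end
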